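(* Let $T>0$ and let $C:[0,T]\rightrightarrows\mathbb{R}^n$ be a multivalued mapping that is Lipschitz with respect to the Hausdorff distance, is definable in some o-minimal structure (i.e. its graph is a definable set), and has nonempty compact values $C(t)$, $t\in[0,T]$. Let $d:\mathbb{R}^{n+1}\to\mathbb{R}^n$ be continuous and let $x_0\in C(0)$. Put $$K:=\{(x,t)\in\mathbb{R}^{n+1}:\ t\in[0,T],\ x\in C(t)\},$$ and let $G$ be the multivalued mapping whose graph is the closure of the graph of the multivalued mapping $$(d,x,t)\mapsto \mathrm{Proj}_{T_K(x,t)\cap\{t=1\}}(d,1),\qquad d\in\mathbb{R}^n,\ (x,t)\in K .$$ Then the projection process $$\dot x(t)\in Pr\ G(d(x(t),t),x(t),t),\qquad x(0)=x_0,\qquad x(t)\in C(t),$$ has a solution on $[0,T]$.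
   Context: Solution: an absolutely continuous function $x:[0,T]\to\mathbb{R}^n$ with $x(0)=x_0$, $x(t)\in C(t)$ for all $t\in[0,T]$, and satisfying the differential inclusion for almost every $t\in[0,T]$. Notation: $T_K(x,t)\subset\mathbb{R}^{n+1}$ is the Bouligand (contingent) tangent cone to $K$ at $(x,t)\in K$. The expression $\{t=1\}$ denotes the hyperplane of vectors in $\mathbb{R}^{n+1}$ whose $(n+1)$-th coordinate equals $1$. For a closed set $A\subset\mathbb{R}^{n+1}$ and a point $z$, $\mathrm{Proj}_A(z)$ is the metric projection, i.e. the (possibly non-singleton) set of all points of $A$ nearest to $z$ (empty if $A=\emptyset$). $Pr:\mathbb{R}^{n+1}\to\mathbb{R}^n$ is the projection on the first $n$ coordinates, and $Pr$ of a set is its image. In the definition of $G$, the symbol $d$ stands for a free vector variable in $\mathbb{R}^n$; the graph is a subset of $\mathbb{R}^n\times K\times\mathbb{R}^{n+1}$ and its closure is taken there. O-minimal structure (expanding the real field $\mathbb{R}$): a collection $\mathcal{S}=(\mathcal{S}^n)_{n\in\mathbb{N}}$, where each $\mathcal{S}^n$ is a set of subsets of $\mathbb{R}^n$, such that: (1) all algebraic subsets of $\mathbb{R}^n$ (common zero sets of finitely many polynomials) are in $\mathcal{S}^n$; (2) $\mathcal{S}^n$ is a Boolean subalgebra of the power set of $\mathbb{R}^n$; (3) if $A\in\mathcal{S}^m$ and $B\in\mathcal{S}^n$ then $A\times B\in\mathcal{S}^{m+n}$; (4) if $p:\mathbb{R}^{n+1}\to\mathbb{R}^n$ is the projection on the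 first $n$ coordinates and $A\in\mathcal{S}^{n+1}$, then $p(A)\in\mathcal{S}^n$; (5) the elements of $\mathcal{S}^1$ are precisely the finite unions of points and intervals. Elements of $\mathcal{S}^n$ are called definable subsets of $\mathbb{R}^n$. A multivalued map is definable if its graph is a definable set. *)

theory Defs
  imports "HOL-Analysis.Analysis" "HOL-Library.Poly_Mapping"
begin

section \<open>O-minimal structures\<close>

text \<open>
  An o-minimal structure lives on all the spaces $R^m$ at once, so here points of $R^m$ are
  lists of length \<open>m\<close>; the Cartesian product is then concatenation, and the projection on
  the first coordinates is \<^const>\<open>butlast\<close>.
\<close>

definition Rpow :: "nat \<Rightarrow> real list set" where
  "Rpow m = {xs. length xs = m}"

text \<open>
  Real multivariate polynomials are finitely supported maps from monomials to coefficients;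
  a monomial maps the index of each variable to its exponent.
\<close>

type_synonym rpoly = "(nat \<Rightarrow>\<^sub>0 nat) \<Rightarrow>\<^sub>0 real"

definition polys_in :: "nat \<Rightarrow> rpoly set" where
  "polys_in m = {p. \<forall>\<mu>\<in>Poly_Mapping.keys p. Poly_Mapping.keys \<mu> \<subseteq> {..<m}}"

definition poly_eval :: "rpoly \<Rightarrow> real list \<Rightarrow> real" where
  "poly_eval p xs = (\<Sum>\<mu>\<in>Poly_Mapping.keys p.
     Poly_Mapping.lookup p \<mu> *
       (\<Prod>i\<in>Poly_Mapping.keys \<mu>. (xs ! i) ^ Poly_Mapping.lookup \<mu> i))"

definition algebraic_subset :: "nat \<Rightarrow> real list set \<Rightarrow> bool" where
  "algebraic_subset m A \<longleftrightarrow>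
     (\<exists>P. finite P \<and> P \<subseteq> polys_in m \<and> A = {xs \<in> Rpow m. \<forall>p\<in>P. poly_eval p xs = 0})"

text \<open>
  \<^const>\<open>algebra\<close> is the library's notion of a (not necessarily sigma-) algebra of subsets.
  \<^const>\<open>is_interval\<close> covers bounded and unbounded, open, half-open and closed intervals.
\<close>

definition o_minimal :: "(nat \<Rightarrow> real list set set) \<Rightarrow> bool" where
  "o_minimal S \<longleftrightarrow>
     (\<forall>m A. algebraic_subset m A \<longrightarrow> A \<in> S m) \<and>
     (\<forall>m. algebra (Rpow m) (S m)) \<and>
     (\<forall>m k. \<forall>A\<in>S m. \<forall>B\<in>S k. {xs @ ys |xs ys. xs \<in> A \<and> ys \<in> B} \<in> S (m + k)) \<and>
     (\<forall>m. \<forall>A\<in>S (Suc m). butlast ` A \<in> S m) \<and>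
     S 1 = {(\<lambda>x. [x]) ` \<Union>F |F. finite F \<and> (\<forall>I\<in>F. (\<exists>a. I = {a}) \<or> is_interval I)}"

text \<open>
  The index type of a vector carries no order, so an enumeration \<open>e\<close> of it says which
  coordinate comes first, second, and so on.
\<close>

definition coord_list :: "(nat \<Rightarrow> 'n) \<Rightarrow> real ^ 'n \<Rightarrow> real list" where
  "coord_list e x = map (\<lambda>i. x $ e i) [0..<CARD('n)]"

definition definable_multimap ::
  "(nat \<Rightarrow> real list set set) \<Rightarrow> (nat \<Rightarrow> 'n) \<Rightarrow> real set \<Rightarrow> (real \<Rightarrow> (real ^ 'n) set) \<Rightarrow> bool"
where
  "definable_multimap S e I C \<longleftrightarrow>
     {t # coord_list e x |t x. t \<in> I \<and> x \<in> C t} \<in> S (Suc CARD('n))"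


section \<open>Metric notions\<close>

text \<open>On nonempty compact sets the suprema are attained.\<close>

definition hausdorff_distance :: "'a::metric_space set \<Rightarrow> 'a set \<Rightarrow> real" where
  "hausdorff_distance A B = max (SUP a\<in>A. infdist a B) (SUP b\<in>B. infdist b A)"

definition hausdorff_lipschitz_on :: "real set \<Rightarrow> (real \<Rightarrow> 'a::metric_space set) \<Rightarrow> bool" where
  "hausdorff_lipschitz_on I C \<longleftrightarrow>
     (\<exists>L\<ge>0. \<forall>s\<in>I. \<forall>t\<in>I. hausdorff_distance (C s) (C t) \<le> L * dist s t)"

definition metric_proj :: "'a::metric_space set \<Rightarrow> 'a \<Rightarrow> 'a set" where
  "metric_proj A z = {a \<in> A. \<forall>b\<in>A. dist z a \<le> dist z b}"

definition tangent_cone :: "'a::real_normed_vector set \<Rightarrow> 'a \<Rightarrow> 'a set" where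
  "tangent_cone K z =
     {v. \<exists>(h :: nat \<Rightarrow> real) (w :: nat \<Rightarrow> 'a).
           (\<forall>k. 0 < h k) \<and> h \<longlonglongrightarrow> 0 \<and> w \<longlonglongrightarrow> v \<and> (\<forall>k. z + h k *\<^sub>R w k \<in> K)}"

definition absolutely_continuous_on :: "real set \<Rightarrow> (real \<Rightarrow> 'a::metric_space) \<Rightarrow> bool" where
  "absolutely_continuous_on I f \<longleftrightarrow>
     (\<forall>\<epsilon>>0. \<exists>\<delta>>0. \<forall>(m :: nat) a b.
        (\<forall>i<m. a i \<le> b i \<and> {a i..b i} \<subseteq> I) \<and>
        disjoint_family_on (\<lambda>i. {a i<..<b i}) {..<m} \<and>
        (\<Sum>i<m. b i - a i) < \<delta>
        \<longrightarrow> (\<Sum>i<m. dist (f (a i)) (f (b i))) < \<epsilon>)"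


section \<open>The projection process\<close>

text \<open>
  $R^{n+1}$ is \<open>(real ^ 'n) \<times> real\<close>, whose norm is the Euclidean one.
\<close>

definition space_time_graph :: "real set \<Rightarrow> (real \<Rightarrow> 'v set) \<Rightarrow> ('v \<times> real) set" where
  "space_time_graph I C = {(x, t). t \<in> I \<and> x \<in> C t}"

definition tangent_proj_graph ::
  "((real ^ 'n) \<times> real) set \<Rightarrow> ((real ^ 'n) \<times> ((real ^ 'n) \<times> real) \<times> ((real ^ 'n) \<times> real)) set"
where
  "tangent_proj_graph K =
     {(d, z, y). z \<in> K \<and> y \<in> metric_proj (tangent_cone K z \<inter> {v. snd v = 1}) (d, 1)}"

definition G_map ::
  "((real ^ 'n) \<times> real) set \<Rightarrow> real ^ 'n \<Rightarrow> real ^ 'n \<Rightarrow> real \<Rightarrow> ((real ^ 'n) \<times> real) set"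
where
  "G_map K d x t =
     {y. (d, (x, t), y) \<in>
           (top_of_set (UNIV \<times> K \<times> UNIV)) closure_of (tangent_proj_graph K)}"

text \<open>
  At the endpoints of \<open>{0..T}\<close> the derivative is one-sided, which is immaterial for a condition
  required almost everywhere.
\<close>

definition projection_process_solution ::
  "real \<Rightarrow> (real \<Rightarrow> (real ^ 'n) set) \<Rightarrow> ((real ^ 'n) \<times> real \<Rightarrow> real ^ 'n) \<Rightarrow> real ^ 'n
    \<Rightarrow> (real \<Rightarrow> real ^ 'n) \<Rightarrow> bool"
where
  "projection_process_solution T C d x0 x \<longleftrightarrow>
     absolutely_continuous_on {0..T} x \<and>
     x 0 = x0 \<and>
     (\<forall>t\<in>{0..T}. x t \<in> C t) \<and>
     (AE t in lebesgue_on {0..T}.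
        \<exists>v. (x has_vector_derivative v) (at t within {0..T}) \<and>
            v \<in> fst ` G_map (space_time_graph {0..T} C) (d (x t, t)) (x t) t)"

end

theory Submission
  imports Defs "HOL-Complex_Analysis.Great_Picard"
begin

text \<open>
  A time-stepping scheme (made uniform by compactness of \<open>K\<close>) yields Lipschitz curves in \<open>K\<close> whose
  velocities lie near the convex hull of \<open>Pr G\<close> in the limit; the point is to remove the convexification.
  If \<open>(q, 1)\<close> is a projection of \<open>(d, 1)\<close>, then \<open>(d - q, - (d - q) \<bullet> q)\<close> is a limit of proximal normals
  to \<open>K\<close>. Definability enters through the projection formula: a limit \<open>\<nu>\<close> of normals at points that
  approach \<open>z\<close> in direction \<open>u\<close> satisfies \<open>\<nu> \<bullet> u \<le> 0\<close>, by curve selection and monotonicity of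
  definable functions of one variable. Along the limit curve with velocity \<open>v\<close>, at all times outside a
  countable set every \<open>q\<close> in \<open>Pr G\<close> is a limit of such \<open>q\<close> from later times, so
  \<open>(d - q) \<bullet> (v - q) \<le> 0\<close>. Averaging this over a convex combination of mean \<open>v\<close> shows that the
  combination has variance zero, so \<open>v\<close> itself lies in \<open>Pr G\<close>.
\<close>

section \<open>Definability in an o-minimal structure\<close>

text \<open>The drift \<open>d\<close> is merely continuous, so neither the solution nor the
  projections of its values can be treated as definable. Definability is therefore applied to a
  single relation, proximal normality to \<open>K\<close>, in which the limits \<open>\<nu>\<close>
  and \<open>u\<close> appear as fixed real constants. The last component of the normal is chosen to
  make it orthogonal to (q, 1); pairing it with (v, 1) then yields (d - q) \<bullet> (v - q). A
  second obstacle is that \<open>G\<close> is closed over all nearby points of \<open>K\<close>: a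
  velocity at (x t, t) may be a limit over points that approach in a direction unrelated to the
  curve, and such a limit alone says nothing about v. Hence velocities have to be recovered from
  points of the curve itself, and from later ones, because normals are tested along directions of
  positive time. The times at which this fails are counted by an argument valid for arbitrary
  set-valued maps of time.\<close>

locale o_minimal_structure =
  fixes S :: "nat \<Rightarrow> real list set set"
  assumes o_minimal: "o_minimal S"
begin

lemma algebraic_in: "algebraic_subset m A \<Longrightarrow> A \<in> S m"
  using o_minimal by (auto simp: o_minimal_def)

lemma algebra_S: "algebra (Rpow m) (S m)"
  using o_minimal by (auto simp: o_minimal_def)

lemma append_in: "A \<in> S m \<Longrightarrow> B \<in> S k \<Longrightarrow> {xs @ ys |xs ys. xs \<in> A \<and> ys \<in> B} \<in> S (m + k)"
  using o_minimal by (auto simp: o_minimal_def)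

lemma butlast_in: "A \<in> S (Suc m) \<Longrightarrow> butlast ` A \<in> S m"
  using o_minimal by (auto simp: o_minimal_def)

lemma S_1: "S 1 = {(\<lambda>x. [x]) ` \<Union>F |F. finite F \<and> (\<forall>I\<in>F. (\<exists>a. I = {a}) \<or> is_interval I)}"
  using o_minimal by (auto simp: o_minimal_def)

text \<open>Definable sets are written as predicates, so that definability of a first-order formula
  can be proved along its syntax.\<close>

definition dfn :: "nat \<Rightarrow> (real list \<Rightarrow> bool) \<Rightarrow> bool" where
  "dfn m P \<longleftrightarrow> {xs. length xs = m \<and> P xs} \<in> S m"

lemma dfn_cong: "(\<And>xs. length xs = m \<Longrightarrow> P xs = Q xs) \<Longrightarrow> dfn m P = dfn m Q"
  unfolding dfn_def by (intro arg_cong[of _ _ "\<lambda>X. X \<in> S m"] Collect_cong) auto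

lemma dfn_eqI: "dfn m P \<Longrightarrow> (\<And>xs. length xs = m \<Longrightarrow> P xs = Q xs) \<Longrightarrow> dfn m Q"
  using dfn_cong by blast

lemma dfn_conj: "dfn m P \<Longrightarrow> dfn m Q \<Longrightarrow> dfn m (\<lambda>xs. P xs \<and> Q xs)"
proof -
  assume a: "dfn m P" "dfn m Q"
  have "{xs. length xs = m \<and> P xs \<and> Q xs} = {xs. length xs = m \<and> P xs} \<inter> {xs. length xs = m \<and> Q xs}"
    by auto
  then show ?thesis
    using a algebra.Int_stable[OF algebra_S] unfolding dfn_def Int_stable_def by auto
qed

lemma dfn_neg: "dfn m P \<Longrightarrow> dfn m (\<lambda>xs. \<not> P xs)"
proof -
  assume a: "dfn m P"
  have "{xs. length xs = m \<and> \<not> P xs} = Rpow m - {xs. length xs = m \<and> P xs}"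
    by (auto simp: Rpow_def)
  then show ?thesis
    using a algebra_S unfolding dfn_def algebra_iff_Un by auto
qed

lemma dfn_disj: "dfn m P \<Longrightarrow> dfn m Q \<Longrightarrow> dfn m (\<lambda>xs. P xs \<or> Q xs)"
  using dfn_neg[OF dfn_conj[OF dfn_neg dfn_neg], of m P Q] by simp

lemma dfn_imp: "dfn m P \<Longrightarrow> dfn m Q \<Longrightarrow> dfn m (\<lambda>xs. P xs \<longrightarrow> Q xs)"
  using dfn_disj[OF dfn_neg, of m P Q] by simp

lemma dfn_True: "dfn m (\<lambda>_. True)"
  unfolding dfn_def
  by (rule algebraic_in, unfold algebraic_subset_def, rule exI[of _ "{}"]) (simp add: Rpow_def)

lemma dfn_ball: "(\<And>j. j < (k::nat) \<Longrightarrow> dfn m (P j)) \<Longrightarrow> dfn m (\<lambda>xs. \<forall>j<k. P j xs)"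
proof (induction k)
  case 0
  then show ?case using dfn_True by simp
next
  case (Suc k)
  then have "dfn m (\<lambda>xs. (\<forall>j<k. P j xs) \<and> P k xs)" by (intro dfn_conj) auto
  moreover have "(\<forall>j<Suc k. P j xs) = ((\<forall>j<k. P j xs) \<and> P k xs)" for xs
    by (auto simp: less_Suc_eq)
  ultimately show ?case by simp
qed

lemma dfn_ex: "dfn (Suc m) P \<Longrightarrow> dfn m (\<lambda>xs. \<exists>a. P (xs @ [a]))"
proof -
  assume a: "dfn (Suc m) P"
  have "{xs. length xs = m \<and> (\<exists>a. P (xs @ [a]))} = butlast ` {xs. length xs = Suc m \<and> P xs}"
  proof (intro set_eqI iffI)
    fix xs assume "xs \<in> {xs. length xs = m \<and> (\<exists>a. P (xs @ [a]))}"
    then obtain a where "length xs = m" "P (xs @ [a])" by auto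
    then show "xs \<in> butlast ` {xs. length xs = Suc m \<and> P xs}"
      by (intro image_eqI[of _ _ "xs @ [a]"]) auto
  next
    fix xs assume "xs \<in> butlast ` {xs. length xs = Suc m \<and> P xs}"
    then obtain ys where ys: "xs = butlast ys" "length ys = Suc m" "P ys" by auto
    then have "ys = xs @ [last ys]" by (metis append_butlast_last_id list.size(3) nat.distinct(1))
    then show "xs \<in> {xs. length xs = m \<and> (\<exists>a. P (xs @ [a]))}" using ys by (auto intro: exI[of _ "last ys"])
  qed
  then show ?thesis using butlast_in[of _ m] a unfolding dfn_def by auto
qed

lemma dfn_ex_list: "dfn (m + k) P \<Longrightarrow> dfn m (\<lambda>xs. \<exists>ys. length ys = k \<and> P (xs @ ys))"
proof (induction k arbitrary: P)
  case 0
  then show ?case by simp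
next
  case (Suc k)
  then have "dfn (m + k) (\<lambda>xs. \<exists>a. P (xs @ [a]))" by (intro dfn_ex) simp
  from Suc.IH[OF this] show ?case
  proof (rule dfn_eqI)
    fix xs :: "real list"
    show "(\<exists>ys. length ys = k \<and> (\<exists>a. P ((xs @ ys) @ [a]))) = (\<exists>ys. length ys = Suc k \<and> P (xs @ ys))"
      by (auto simp: length_Suc_conv_rev)
  qed
qed

lemma dfn_append: "dfn m P \<Longrightarrow> dfn k Q \<Longrightarrow> dfn (m + k) (\<lambda>xs. P (take m xs) \<and> Q (drop m xs))"
proof -
  assume a: "dfn m P" "dfn k Q"
  have "{xs. length xs = m + k \<and> P (take m xs) \<and> Q (drop m xs)} =
     {xs @ ys |xs ys. xs \<in> {xs. length xs = m \<and> P xs} \<and> ys \<in> {xs. length xs = k \<and> Q xs}}"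
  proof (intro set_eqI iffI)
    fix xs assume "xs \<in> {xs. length xs = m + k \<and> P (take m xs) \<and> Q (drop m xs)}"
    then show "xs \<in> {xs @ ys |xs ys. xs \<in> {xs. length xs = m \<and> P xs} \<and> ys \<in> {xs. length xs = k \<and> Q xs}}"
      by (simp, intro exI[of _ "take m xs"] exI[of _ "drop m xs"]) auto
  qed auto
  then show ?thesis unfolding dfn_def by (simp only:) (rule append_in, use a in \<open>auto simp: dfn_def\<close>)
qed

end

section \<open>Evaluation of polynomials\<close>

lemma poly_eval_superset:
  assumes "finite A" "Poly_Mapping.keys p \<subseteq> A"
  shows "poly_eval p xs = (\<Sum>\<mu>\<in>A. Poly_Mapping.lookup p \<mu> *
       (\<Prod>i\<in>Poly_Mapping.keys \<mu>. (xs ! i) ^ Poly_Mapping.lookup \<mu> i))"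
  unfolding poly_eval_def using assms
  by (intro sum.mono_neutral_left) (auto simp: in_keys_iff)

lemma poly_eval_add: "poly_eval (p + q) xs = poly_eval p xs + poly_eval q xs"
proof -
  let ?A = "Poly_Mapping.keys p \<union> Poly_Mapping.keys q"
  have "Poly_Mapping.keys (p + q) \<subseteq> ?A" by (rule keys_add)
  then show ?thesis
    by (simp add: poly_eval_superset[of ?A] lookup_add sum.distrib distrib_right)
qed

lemma poly_eval_single:
  "poly_eval (Poly_Mapping.single \<mu> c) xs =
     c * (\<Prod>i\<in>Poly_Mapping.keys \<mu>. (xs ! i) ^ Poly_Mapping.lookup \<mu> i)"
  by (subst poly_eval_superset[of "{\<mu>}"]) auto

lemma polys_in_add: "p \<in> polys_in m \<Longrightarrow> q \<in> polys_in m \<Longrightarrow> p + q \<in> polys_in m"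
  using keys_add[of p q] by (auto simp: polys_in_def subset_iff)

lemma polys_in_single: "Poly_Mapping.keys \<mu> \<subseteq> {..<m} \<Longrightarrow> Poly_Mapping.single \<mu> c \<in> polys_in m"
  by (auto simp: polys_in_def)

abbreviation poly_const :: "real \<Rightarrow> rpoly" where
  "poly_const c \<equiv> Poly_Mapping.single 0 c"

abbreviation poly_var :: "real \<Rightarrow> nat \<Rightarrow> rpoly" where
  "poly_var c i \<equiv> Poly_Mapping.single (Poly_Mapping.single i (Suc 0)) c"

lemma poly_eval_const: "poly_eval (poly_const c) xs = c"
  by (simp add: poly_eval_single)

lemma poly_eval_var: "poly_eval (poly_var c i) xs = c * xs ! i"
  by (simp add: poly_eval_single)

lemma poly_eval_var_times_var:
  assumes "i \<noteq> j"
  shows "poly_eval (Poly_Mapping.single (Poly_Mapping.single i (Suc 0) + Poly_Mapping.single j (Suc 0)) c) xs = c * (xs ! i * xs ! j)"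
    and "Poly_Mapping.keys (Poly_Mapping.single i (Suc 0) + Poly_Mapping.single j (Suc 0)) = {i, j}"
proof -
  show k: "Poly_Mapping.keys (Poly_Mapping.single i (Suc 0) + Poly_Mapping.single j (Suc 0)) = {i, j}"
    using assms by (auto simp: in_keys_iff lookup_add lookup_single when_def split: if_splits)
  show "poly_eval (Poly_Mapping.single (Poly_Mapping.single i (Suc 0) + Poly_Mapping.single j (Suc 0)) c) xs = c * (xs ! i * xs ! j)"
    using assms unfolding poly_eval_single k by (auto simp: lookup_add lookup_single when_def)
qed

context o_minimal_structure
begin

lemma dfn_poly: "p \<in> polys_in m \<Longrightarrow> dfn m (\<lambda>xs. poly_eval p xs = 0)"
  unfolding dfn_def
  by (rule algebraic_in, unfold algebraic_subset_def, rule exI[of _ "{p}"]) (simp add: Rpow_def)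

lemma dfn_var_eq_var: "i < m \<Longrightarrow> j < m \<Longrightarrow> dfn m (\<lambda>xs. xs ! i = xs ! j)"
proof -
  assume "i < m" "j < m"
  then have "dfn m (\<lambda>xs. poly_eval (poly_var 1 i + poly_var (-1) j) xs = 0)"
    by (intro dfn_poly polys_in_add polys_in_single) auto
  then show ?thesis by (simp add: poly_eval_add poly_eval_var)
qed

lemma dfn_var_eq_const: "i < m \<Longrightarrow> dfn m (\<lambda>xs. xs ! i = c)"
proof -
  assume "i < m"
  then have "dfn m (\<lambda>xs. poly_eval (poly_var 1 i + poly_const (-c)) xs = 0)"
    by (intro dfn_poly polys_in_add polys_in_single) auto
  then show ?thesis by (simp add: poly_eval_add poly_eval_var poly_eval_const)
qed

lemma dfn_var_add: "dfn 3 (\<lambda>xs. xs ! 2 = xs ! 0 + xs ! 1)"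
proof -
  have "dfn 3 (\<lambda>xs. poly_eval (poly_var (-1) 2 + (poly_var 1 0 + poly_var 1 1)) xs = 0)"
    by (intro dfn_poly polys_in_add polys_in_single) auto
  moreover have "- x + (y + z) = 0 \<longleftrightarrow> x = y + z" for x y z :: real by auto
  ultimately show ?thesis by (simp add: poly_eval_add poly_eval_var)
qed

lemma dfn_var_mult: "dfn 3 (\<lambda>xs. xs ! 2 = xs ! 0 * xs ! 1)"
proof -
  have "dfn 3 (\<lambda>xs. poly_eval (poly_var (-1) 2 +
     Poly_Mapping.single (Poly_Mapping.single 0 (Suc 0) + Poly_Mapping.single 1 (Suc 0)) 1) xs = 0)"
    using poly_eval_var_times_var(2)[of 0 1]
    by (intro dfn_poly polys_in_add polys_in_single) auto
  moreover have "- x + y = 0 \<longleftrightarrow> x = y" for x y z :: real by auto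
  ultimately show ?thesis by (simp add: poly_eval_add poly_eval_var poly_eval_var_times_var)
qed

text \<open>The closure axioms offer only products and the removal of the last coordinate.
  Permuting, repeating or dropping coordinates is obtained by appending k fresh ones, equating each
  with the chosen old one, and projecting the fresh ones away.\<close>

lemma dfn_map_var:
  assumes "dfn k P" "\<And>j. j < k \<Longrightarrow> f j < m"
  shows "dfn m (\<lambda>xs. P (map (\<lambda>j. xs ! f j) [0..<k]))"
proof -
  have "dfn (m + k) (\<lambda>xs. True \<and> P (drop m xs))"
    using dfn_append[OF dfn_True assms(1)] .
  moreover have "dfn (m + k) (\<lambda>xs. \<forall>j<k. xs ! f j = xs ! (m + j))"
    using assms(2) by (intro dfn_ball dfn_var_eq_var) (auto simp: trans_less_add1)
  ultimately have "dfn (m + k) (\<lambda>xs. P (drop m xs) \<and> (\<forall>j<k. xs ! f j = xs ! (m + j)))"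
    by (intro dfn_conj) auto
  from dfn_ex_list[OF this] show ?thesis
  proof (rule dfn_eqI)
    fix xs :: "real list" assume l: "length xs = m"
    show "(\<exists>ys. length ys = k \<and> P (drop m (xs @ ys)) \<and> (\<forall>j<k. (xs @ ys) ! f j = (xs @ ys) ! (m + j)))
        = P (map (\<lambda>j. xs ! f j) [0..<k])" (is "?L = ?R")
    proof
      assume ?L
      then obtain ys where ys: "length ys = k" "P ys" "\<forall>j<k. (xs @ ys) ! f j = (xs @ ys) ! (m + j)"
        using l by auto
      then have "ys = map (\<lambda>j. xs ! f j) [0..<k]"
        using l assms(2) by (intro nth_equalityI) (auto simp: nth_append)
      then show ?R using ys by simp
    next
      assume ?R
      then show ?L using l assms(2) by (intro exI[of _ "map (\<lambda>j. xs ! f j) [0..<k]"]) (auto simp: nth_append)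
    qed
  qed
qed

section \<open>Definable functions, given by graphs with the value as last coordinate\<close>

definition dfun :: "nat \<Rightarrow> (real list \<Rightarrow> real) \<Rightarrow> bool" where
  "dfun m f \<longleftrightarrow> dfn (Suc m) (\<lambda>xs. xs ! m = f (take m xs))"

lemma dfun_cong: "(\<And>xs. length xs = m \<Longrightarrow> f xs = g xs) \<Longrightarrow> dfun m f = dfun m g"
  unfolding dfun_def by (rule dfn_cong) auto

lemma dfun_eqI: "dfun m f \<Longrightarrow> (\<And>xs. length xs = m \<Longrightarrow> f xs = g xs) \<Longrightarrow> dfun m g"
  using dfun_cong by blast

lemma map_nth_take: "m \<le> length xs \<Longrightarrow> map ((!) xs) [0..<m] = take m xs"
  by (intro nth_equalityI) auto

text \<open>Same elimination of k fresh coordinates, now tied to the old ones by the graphs of the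
  \<open>f j\<close>; each graph first has its value moved from index m to index m + j.\<close>

lemma dfn_subst:
  assumes P: "dfn k P" and f: "\<And>j. j < k \<Longrightarrow> dfun m (f j)"
  shows "dfn m (\<lambda>xs. P (map (\<lambda>j. f j xs) [0..<k]))"
proof -
  have 1: "dfn (m + k) (\<lambda>xs. True \<and> P (drop m xs))"
    using dfn_append[OF dfn_True P] .
  have "dfn (m + k) (\<lambda>xs. xs ! (m + j) = f j (take m xs))" if "j < k" for j
  proof -
    have 2: "dfn (m + k) (\<lambda>xs. (map (\<lambda>i. xs ! (if i < m then i else m + j)) [0..<Suc m]) ! m =
        f j (take m (map (\<lambda>i. xs ! (if i < m then i else m + j)) [0..<Suc m])))"
      using f[OF that] that unfolding dfun_def by (rule_tac dfn_map_var) auto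
    have "take m (map (\<lambda>i. xs ! (if i < m then i else m + j)) [0..<Suc m]) = take m xs"
      if "length xs = m + k" for xs :: "real list"
      using that by (intro nth_equalityI) (auto simp del: upt_Suc)
    then show ?thesis
      using that by (intro dfn_eqI[OF 2]) (auto simp del: upt_Suc)
  qed
  then have "dfn (m + k) (\<lambda>xs. P (drop m xs) \<and> (\<forall>j<k. xs ! (m + j) = f j (take m xs)))"
    using 1 by (intro dfn_conj dfn_ball) auto
  from dfn_ex_list[OF this] show ?thesis
  proof (rule dfn_eqI)
    fix xs :: "real list" assume l: "length xs = m"
    show "(\<exists>ys. length ys = k \<and> P (drop m (xs @ ys)) \<and> (\<forall>j<k. (xs @ ys) ! (m + j) = f j (take m (xs @ ys))))
        = P (map (\<lambda>j. f j xs) [0..<k])" (is "?L = ?R")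
    proof
      assume ?L
      then obtain ys where ys: "length ys = k" "P ys" "\<forall>j<k. (xs @ ys) ! (m + j) = f j xs"
        using l by auto
      then have "ys = map (\<lambda>j. f j xs) [0..<k]"
        using l by (intro nth_equalityI) (auto simp: nth_append)
      then show ?R using ys by simp
    next
      assume ?R
      then show ?L using l by (intro exI[of _ "map (\<lambda>j. f j xs) [0..<k]"]) (auto simp: nth_append)
    qed
  qed
qed

lemma dfun_var: "i < m \<Longrightarrow> dfun m (\<lambda>xs. xs ! i)"
  unfolding dfun_def
  by (rule dfn_eqI[OF dfn_var_eq_var[of m "Suc m" i]]) simp_all

lemma dfun_const: "dfun m (\<lambda>_. c)"
  unfolding dfun_def by (rule dfn_var_eq_const) auto

lemma dfn_take:
  assumes "dfn m P" "m \<le> k" shows "dfn k (\<lambda>xs. P (take m xs))"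
proof -
  have 1: "dfn k (\<lambda>xs. P (map (\<lambda>j. xs ! j) [0..<m]))"
    using assms by (intro dfn_map_var) auto
  show ?thesis
    using assms by (intro dfn_eqI[OF 1]) (simp add: map_nth_take)
qed

lemma dfun_comp:
  assumes f: "dfun k f" and g: "\<And>j. j < k \<Longrightarrow> dfun m (g j)"
  shows "dfun m (\<lambda>xs. f (map (\<lambda>j. g j xs) [0..<k]))"
proof -
  have g': "dfun (Suc m) (\<lambda>xs. g j (take m xs))" if "j < k" for j
  proof -
    have 2: "dfn (Suc (Suc m)) (\<lambda>xs. (map (\<lambda>i. xs ! (if i < m then i else Suc m)) [0..<Suc m]) ! m =
        g j (take m (map (\<lambda>i. xs ! (if i < m then i else Suc m)) [0..<Suc m])))"
      using g[OF that] that unfolding dfun_def by (rule_tac dfn_map_var) auto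
    have "take m (map (\<lambda>i. xs ! (if i < m then i else Suc m)) [0..<Suc m]) = take m xs"
      if "length xs = Suc (Suc m)" for xs :: "real list"
      using that by (intro nth_equalityI) (auto simp del: upt_Suc)
    then show ?thesis unfolding dfun_def
      by (intro dfn_eqI[OF 2]) (auto simp del: upt_Suc)
  qed
  \<comment> \<open>Component k hands the value coordinate \<open>xs ! m\<close> through unchanged,
    behind the k arguments of f.\<close>
  have "dfn (Suc m) (\<lambda>xs. (map (\<lambda>j. (if j < k then g j (take m xs) else xs ! m)) [0..<Suc k]) ! k =
      f (take k (map (\<lambda>j. (if j < k then g j (take m xs) else xs ! m)) [0..<Suc k])))"
    using f unfolding dfun_def
    by (rule dfn_subst) (use g' dfun_var[of m "Suc m"] in \<open>auto simp: less_Suc_eq\<close>)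
  moreover have "take k (map (\<lambda>j. (if j < k then g j (take m xs) else xs ! m)) [0..<Suc k]) =
      map (\<lambda>j. g j (take m xs)) [0..<k]" for xs
    by (intro nth_equalityI) (auto simp del: upt_Suc)
  ultimately show ?thesis unfolding dfun_def by (simp del: upt_Suc)
qed

lemma dfun_take: "dfun m f \<Longrightarrow> m \<le> k \<Longrightarrow> dfun k (\<lambda>xs. f (take m xs))"
proof -
  assume a: "dfun m f" "m \<le> k"
  have 1: "dfun k (\<lambda>xs. f (map (\<lambda>j. xs ! j) [0..<m]))"
    using a by (intro dfun_comp dfun_var) auto
  show ?thesis
    using a by (intro dfun_eqI[OF 1]) (simp add: map_nth_take)
qed

lemma dfun_add: "dfun m f \<Longrightarrow> dfun m g \<Longrightarrow> dfun m (\<lambda>xs. f xs + g xs)"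
proof -
  assume a: "dfun m f" "dfun m g"
  have 1: "dfun 2 (\<lambda>xs. xs ! 0 + xs ! 1)"
    unfolding dfun_def
    by (rule dfn_eqI[OF dfn_var_add[unfolded numeral_3_eq_3 numeral_2_eq_2, folded numeral_2_eq_2]]) auto
  have "dfun m (\<lambda>xs. (map (\<lambda>j. (if j = 0 then f else g) xs) [0..<2]) ! 0 + (map (\<lambda>j. (if j = 0 then f else g) xs) [0..<2]) ! 1)"
    by (rule dfun_comp[OF 1]) (use a in auto)
  then show ?thesis by simp
qed

lemma dfun_mult: "dfun m f \<Longrightarrow> dfun m g \<Longrightarrow> dfun m (\<lambda>xs. f xs * g xs)"
proof -
  assume a: "dfun m f" "dfun m g"
  have 1: "dfun 2 (\<lambda>xs. xs ! 0 * xs ! 1)"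
    unfolding dfun_def
    by (rule dfn_eqI[OF dfn_var_mult[unfolded numeral_3_eq_3 numeral_2_eq_2, folded numeral_2_eq_2]]) auto
  have "dfun m (\<lambda>xs. (map (\<lambda>j. (if j = 0 then f else g) xs) [0..<2]) ! 0 * (map (\<lambda>j. (if j = 0 then f else g) xs) [0..<2]) ! 1)"
    by (rule dfun_comp[OF 1]) (use a in auto)
  then show ?thesis by simp
qed

lemma dfun_diff: "dfun m f \<Longrightarrow> dfun m g \<Longrightarrow> dfun m (\<lambda>xs. f xs - g xs)"
  using dfun_add[OF _ dfun_mult[OF dfun_const[of m "-1"]], of f g] by simp

lemma dfun_sum: "(\<And>i. i \<in> A \<Longrightarrow> dfun m (f i)) \<Longrightarrow> dfun m (\<lambda>xs. \<Sum>i\<in>A. f i xs)"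
  by (induction A rule: infinite_finite_induct) (auto intro: dfun_const dfun_add)

lemma dfn_eq: "dfun m f \<Longrightarrow> dfun m g \<Longrightarrow> dfn m (\<lambda>xs. f xs = g xs)"
proof -
  assume a: "dfun m f" "dfun m g"
  have 1: "dfn 2 (\<lambda>xs. xs ! 0 = xs ! 1)" by (rule dfn_var_eq_var) auto
  have "dfn m (\<lambda>xs. (map (\<lambda>j. (if j = 0 then f else g) xs) [0..<2]) ! 0 = (map (\<lambda>j. (if j = 0 then f else g) xs) [0..<2]) ! 1)"
    by (rule dfn_subst[OF 1]) (use a in auto)
  then show ?thesis by simp
qed

lemma dfn_ex_real:
  assumes "dfn (Suc m) (\<lambda>xs. P (take m xs) (xs ! m))"
  shows "dfn m (\<lambda>xs. \<exists>a. P xs a)"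
  by (rule dfn_eqI[OF dfn_ex[OF assms]]) (simp add: nth_append)

lemma dfn_all_real:
  assumes "dfn (Suc m) (\<lambda>xs. P (take m xs) (xs ! m))"
  shows "dfn m (\<lambda>xs. \<forall>a. P xs a)"
  using dfn_neg[OF dfn_ex_real[OF dfn_neg[OF assms]]] by simp

text \<open>In several variables the axioms supply algebraic sets only, so the order is expressed
  through squares: the difference of the two sides is the square of some nonzero b.\<close>

lemma dfn_less: "dfun m f \<Longrightarrow> dfun m g \<Longrightarrow> dfn m (\<lambda>xs. f xs < g xs)"
proof -
  assume a: "dfun m f" "dfun m g"
  have "dfn m (\<lambda>xs. \<exists>b. b \<noteq> 0 \<and> g xs = f xs + b * b)"
    using a by (intro dfn_ex_real dfn_conj dfn_neg dfn_eq dfun_add dfun_mult dfun_const dfun_var dfun_take) auto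
  moreover have "(\<exists>b. b \<noteq> 0 \<and> y = x + b * b) \<longleftrightarrow> x < y" for x y :: real
  proof
    assume "x < y"
    then show "\<exists>b. b \<noteq> 0 \<and> y = x + b * b"
      by (intro exI[of _ "sqrt (y - x)"]) auto
  next
    assume "\<exists>b. b \<noteq> 0 \<and> y = x + b * b"
    then show "x < y" by (auto simp: less_le)
  qed
  ultimately show ?thesis by simp
qed

lemma dfn_le: "dfun m f \<Longrightarrow> dfun m g \<Longrightarrow> dfn m (\<lambda>xs. f xs \<le> g xs)"
  using dfn_neg[OF dfn_less[of m g f]] by (simp add: not_less)

lemma dfun_fun_arg:
  assumes "dfun (Suc 0) (\<lambda>xs. h (xs ! 0))" "dfun m f"
  shows "dfun m (\<lambda>xs. h (f xs))"
  using dfun_comp[OF assms(1), of m "\<lambda>_. f"] assms(2) by simp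

end

section \<open>Monotonicity and definable choice\<close>

text \<open>An interval that meets every right neighbourhood of a contains, by convexity, everything
  between a and any one of its points beyond a.\<close>

lemma interval_eventually_right:
  fixes I :: "real set"
  assumes "is_interval I"
  shows "(\<forall>\<^sub>F s in at_right a. s \<in> I) \<or> (\<forall>\<^sub>F s in at_right a. s \<notin> I)"
proof (rule disjCI)
  assume n: "\<not> (\<forall>\<^sub>F s in at_right a. s \<notin> I)"
  then have ex: "\<exists>s. a < s \<and> s < b \<and> s \<in> I" if "b > a" for b
    using that unfolding eventually_at_right_field by blast
  obtain b where b: "a < b" "b \<in> I" using ex[of "a + 1"] by auto
  have "s \<in> I" if "a < s" "s < b" for s
    using ex[OF that(1)] b(2) that assms unfolding is_interval_1 by (meson less_imp_le)
  then show "\<forall>\<^sub>F s in at_right a. s \<in> I"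
    using b(1) unfolding eventually_at_right_field by blast
qed

lemma interval_eventually_left:
  fixes I :: "real set"
  assumes "is_interval I"
  shows "(\<forall>\<^sub>F s in at_left a. s \<in> I) \<or> (\<forall>\<^sub>F s in at_left a. s \<notin> I)"
proof (rule disjCI)
  assume n: "\<not> (\<forall>\<^sub>F s in at_left a. s \<notin> I)"
  then have ex: "\<exists>s. s < a \<and> b < s \<and> s \<in> I" if "b < a" for b
    using that unfolding eventually_at_left_field by blast
  obtain b where b: "b < a" "b \<in> I" using ex[of "a - 1"] by auto
  have "s \<in> I" if "s < a" "b < s" for s
    using ex[OF that(1)] b(2) that assms unfolding is_interval_1 by (meson less_imp_le)
  then show "\<forall>\<^sub>F s in at_left a. s \<in> I"
    using b(1) unfolding eventually_at_left_field by blast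
qed

lemma finite_Union_eventually_cases:
  assumes "finite F" "\<And>I. I \<in> F \<Longrightarrow> (\<forall>\<^sub>F s in flt. s \<in> I) \<or> (\<forall>\<^sub>F s in flt. s \<notin> I)"
  shows "(\<forall>\<^sub>F s in flt. s \<in> \<Union>F) \<or> (\<forall>\<^sub>F s in flt. s \<notin> \<Union>F)"
proof (cases "\<exists>I\<in>F. \<forall>\<^sub>F s in flt. s \<in> I")
  case True
  then obtain I where "I \<in> F" "\<forall>\<^sub>F s in flt. s \<in> I" by auto
  then have "\<forall>\<^sub>F s in flt. s \<in> \<Union>F" by (auto elim: eventually_mono)
  then show ?thesis ..
next
  case False
  then have "\<forall>\<^sub>F s in flt. \<forall>I\<in>F. s \<notin> I"
    using assms by (intro eventually_ball_finite) auto
  then show ?thesis by (auto elim: eventually_mono)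
qed

lemma countable_interval_finite:
  fixes I :: "real set"
  assumes "is_interval I" "countable I"
  shows "finite I"
proof (rule ccontr)
  assume inf: "infinite I"
  then obtain x where x: "x \<in> I" using infinite_imp_nonempty by blast
  have "infinite (I - {x})" using inf by simp
  then obtain y where y: "y \<in> I" "y \<noteq> x" using infinite_imp_nonempty by blast
  obtain a b where ab: "a \<in> I" "b \<in> I" "a < b"
    using x y by (metis linorder_neqE_linordered_idom)
  then have "{a..b} \<subseteq> I" using mem_is_interval_1_I[OF assms(1) ab(1,2)] by auto
  then have "countable {a..b}" using assms(2) countable_subset by blast
  then show False using uncountable_closed_interval ab(3) by blast
qed

text \<open>Continuous induction: continuity carries the bound to the supremum of the good points,
  and the local condition pushes beyond it. This replaces differentiation for curves whose growth is
  controlled only just to the right of each time.\<close>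

lemma antimono_of_local_right:
  fixes \<phi> :: "real \<Rightarrow> real"
  assumes ab: "a \<le> b" and cont: "continuous_on {a..b} \<phi>"
    and right: "\<And>r. a \<le> r \<Longrightarrow> r < b \<Longrightarrow> \<forall>\<^sub>F r' in at_right r. \<phi> r' \<le> \<phi> r"
  shows "\<phi> b \<le> \<phi> a"
proof -
  define A where "A = {c \<in> {a..b}. \<forall>y\<in>{a..c}. \<phi> y \<le> \<phi> a}"
  define c where "c = Sup A"
  have A: "a \<in> A" "bdd_above A" "A \<subseteq> {a..b}" using ab by (auto simp: A_def)
  then have c: "c \<in> {a..b}" unfolding c_def using cSup_least[of A b] cSup_upper[of a A] by force
  have below: "\<phi> y \<le> \<phi> a" if "a \<le> y" "y < c" for y
    using less_cSup_iff[of A y] A that unfolding c_def by (force simp: A_def)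
  have "\<phi> c \<le> \<phi> a"
  proof (cases "a = c")
    case False
    then have ac: "a < c" using c by auto
    have "continuous_on {a..c} \<phi>" using cont c by (auto elim: continuous_on_subset)
    then have "(\<phi> \<longlongrightarrow> \<phi> c) (at_left c)"
      using ac by (simp add: continuous_on_Icc_at_leftD)
    moreover have "\<forall>\<^sub>F y in at_left c. \<phi> y \<le> \<phi> a"
      using ac below unfolding eventually_at_left_field by (intro exI[of _ a]) auto
    ultimately show ?thesis by (rule tendsto_upperbound) auto
  qed auto
  then have le: "\<phi> y \<le> \<phi> a" if "y \<in> {a..c}" for y using below[of y] that by force
  show ?thesis
  proof (cases "c < b")
    case True
    then obtain d where d: "d > c" "\<And>y. c < y \<Longrightarrow> y < d \<Longrightarrow> \<phi> y \<le> \<phi> c"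
      using right[of c, unfolded eventually_at_right_field] c by auto
    define e where "e = min b ((c + d) / 2)"
    have e: "c < e" "e < d" "e \<le> b" using True d by (auto simp: e_def min_def field_simps)
    have "\<phi> y \<le> \<phi> a" if "y \<in> {a..e}" for y
    proof (cases "y \<le> c")
      case False
      then show ?thesis using d(2)[of y] le[of c] that e c by force
    qed (use le that in auto)
    then have "e \<in> A" using e c by (auto simp: A_def)
    then have "e \<le> c" unfolding c_def using A by (intro cSup_upper) auto
    then show ?thesis using e by simp
  qed (use le[of b] c in auto)
qed

text \<open>Again a supremum argument, but the left condition does the work of continuity: just
  below the supremum c there is y with h a < h y < h c.\<close>

lemma strict_mono_of_local:
  fixes h :: "real \<Rightarrow> real"
  assumes right: "\<And>s. s \<in> {a..b} \<Longrightarrow> \<forall>\<^sub>F s' in at_right s. h s < h s'"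
    and left: "\<And>s. s \<in> {a..b} \<Longrightarrow> \<forall>\<^sub>F s' in at_left s. h s' < h s"
    and ab: "a < b"
  shows "h a < h b"
proof -
  define A where "A = {c. a < c \<and> c \<le> b \<and> (\<forall>y\<in>{a<..c}. h a < h y)}"
  define c where "c = Sup A"
  have step: "\<exists>e. c < e \<and> e \<le> b \<and> (\<forall>y\<in>{c<..e}. h c < h y)" if "a \<le> c" "c < b" for c
  proof -
    have "c \<in> {a..b}" using that by simp
    from right[OF this] obtain d where d: "d > c" "\<And>y. c < y \<Longrightarrow> y < d \<Longrightarrow> h c < h y"
      unfolding eventually_at_right_field by auto
    define e where "e = min b ((c + d) / 2)"
    have "c < e" "e < d" "e \<le> b" using that d by (auto simp: e_def min_def field_simps)
    then show ?thesis using d by (intro exI[of _ e]) auto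
  qed
  obtain a' where a': "a' \<in> A" using step[of a] ab by (auto simp: A_def)
  have Ab: "a < x" "x \<le> b" "y \<in> {a<..x} \<Longrightarrow> h a < h y" if "x \<in> A" for x y
    using that by (auto simp: A_def)
  have A: "bdd_above A" using Ab(2) by (rule bdd_aboveI)
  have ne: "A \<noteq> {}" using a' by auto
  have c: "a < c" "c \<le> b"
    using cSup_upper[OF a' A] Ab(1)[OF a'] cSup_least[OF ne Ab(2)] unfolding c_def by auto
  have below: "h a < h y" if "a < y" "y < c" for y
  proof -
    obtain x where "x \<in> A" "y < x" using less_cSup_iff[OF ne A, of y] \<open>y < c\<close> unfolding c_def by blast
    then show ?thesis using Ab(3)[of x y] \<open>a < y\<close> by simp
  qed
  have "h a < h c"
  proof -
    have "c \<in> {a..b}" using c by simp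
    from left[OF this] obtain l where l: "l < c" "\<And>y. l < y \<Longrightarrow> y < c \<Longrightarrow> h y < h c"
      unfolding eventually_at_left_field by auto
    define y where "y = (max l a + c) / 2"
    have "l < y" "a < y" "y < c" using l c by (auto simp: y_def max_def field_simps)
    then show ?thesis using l(2)[of y] below[of y] by linarith
  qed
  then have le: "h a < h y" if "y \<in> {a<..c}" for y using below[of y] that by force
  show ?thesis
  proof (cases "c < b")
    case True
    then obtain e where e: "c < e" "e \<le> b" "\<forall>y\<in>{c<..e}. h c < h y" using step[of c] c by auto
    have "h a < h y" if "y \<in> {a<..e}" for y
    proof (cases "y \<le> c")
      case False
      then have "h c < h y" using e(3) that by simp
      then show ?thesis using le[of c] c by simp
    qed (use le[of y] that in simp)
    then have "e \<in> A" using e c by (auto simp: A_def)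
    then have "e \<le> c" unfolding c_def using A by (intro cSup_upper) auto
    then show ?thesis using e by simp
  qed (use le[of b] c in auto)
qed

section \<open>Definable predicates and functions of one real variable\<close>

context o_minimal_structure
begin

abbreviation dfn1 :: "(real \<Rightarrow> bool) \<Rightarrow> bool" where
  "dfn1 P \<equiv> dfn (Suc 0) (\<lambda>xs. P (xs ! 0))"

abbreviation dfun1 :: "(real \<Rightarrow> real) \<Rightarrow> bool" where
  "dfun1 h \<equiv> dfun (Suc 0) (\<lambda>xs. h (xs ! 0))"

lemma dfn1_finite_Union:
  assumes "dfn1 P"
  obtains F where "finite F" "\<And>I. I \<in> F \<Longrightarrow> is_interval I" "{a. P a} = \<Union>F"
proof -
  have "{xs. length xs = 1 \<and> P (xs ! 0)} \<in> S 1" using assms by (simp add: dfn_def)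
  then obtain F where F: "finite F" "\<forall>I\<in>F. (\<exists>a. I = {a}) \<or> is_interval I"
    "{xs. length xs = 1 \<and> P (xs ! 0)} = (\<lambda>x. [x]) ` \<Union>F"
    unfolding S_1 by blast
  have "P a \<longleftrightarrow> a \<in> \<Union>F" for a
  proof -
    have "P a \<longleftrightarrow> [a] \<in> {xs. length xs = 1 \<and> P (xs ! 0)}" by simp
    also have "\<dots> \<longleftrightarrow> a \<in> \<Union>F" unfolding F(3) by (rule inj_image_mem_iff) (simp add: inj_def)
    finally show ?thesis .
  qed
  then have eq: "{a. P a} = \<Union>F" by (intro set_eqI) (rule trans[OF mem_Collect_eq])
  have "is_interval I" if "I \<in> F" for I
  proof -
    have "(\<exists>a. I = {a}) \<or> is_interval I" using F(2) that by (rule bspec)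
    moreover have "is_interval {a}" for a :: real using is_interval_cc[of a a] by simp
    ultimately show ?thesis by auto
  qed
  from that[OF F(1) this eq] show ?thesis .
qed

text \<open>The form in which o-minimality is used throughout: a definable property of one variable
  cannot oscillate at a point, because finitely many intervals cannot.\<close>

lemma dfn1_eventually_right:
  assumes "dfn1 P"
  shows "(\<forall>\<^sub>F s in at_right a. P s) \<or> (\<forall>\<^sub>F s in at_right a. \<not> P s)"
proof -
  obtain F where F: "finite F" "\<And>I. I \<in> F \<Longrightarrow> is_interval I" "{a. P a} = \<Union>F"
    using dfn1_finite_Union[OF assms] by metis
  have "P s \<longleftrightarrow> s \<in> \<Union>F" for s using F(3) by blast
  then show ?thesis
    using finite_Union_eventually_cases[OF F(1), of "at_right a"] F(2) interval_eventually_right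
    by simp
qed

lemma dfn1_eventually_left:
  assumes "dfn1 P"
  shows "(\<forall>\<^sub>F s in at_left a. P s) \<or> (\<forall>\<^sub>F s in at_left a. \<not> P s)"
proof -
  obtain F where F: "finite F" "\<And>I. I \<in> F \<Longrightarrow> is_interval I" "{a. P a} = \<Union>F"
    using dfn1_finite_Union[OF assms] by metis
  have "P s \<longleftrightarrow> s \<in> \<Union>F" for s using F(3) by blast
  then show ?thesis
    using finite_Union_eventually_cases[OF F(1), of "at_left a"] F(2) interval_eventually_left
    by simp
qed

lemma dfn1_countable_finite:
  assumes "dfn1 P" "countable {a. P a}"
  shows "finite {a. P a}"
proof -
  obtain F where F: "finite F" "\<And>I. I \<in> F \<Longrightarrow> is_interval I" "{a. P a} = \<Union>F"
    using dfn1_finite_Union[OF assms(1)] by metis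
  have "finite I" if "I \<in> F" for I
    using assms(2) F(2)[OF that] countable_subset[of I "{a. P a}"] that unfolding F(3)
    by (intro countable_interval_finite) auto
  then show ?thesis using F(1,3) by auto
qed

lemma dfn_arg2:
  assumes "dfn (Suc (Suc 0)) (\<lambda>xs. Q (xs ! 0) (xs ! 1))" "dfun m f" "dfun m g"
  shows "dfn m (\<lambda>xs. Q (f xs) (g xs))"
proof -
  have "dfn m (\<lambda>xs. Q (map (\<lambda>j. (if j = 0 then f else g) xs) [0..<Suc (Suc 0)] ! 0)
     (map (\<lambda>j. (if j = 0 then f else g) xs) [0..<Suc (Suc 0)] ! 1))"
    by (rule dfn_subst[OF assms(1)]) (use assms in auto)
  then show ?thesis by simp
qed

text \<open>Unfolded, the filter is a quantification over neighbourhoods, hence first-order; so the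
  local behaviour of a definable function at s is itself a definable property of s.\<close>

lemma dfn_eventually_right:
  assumes "dfn (Suc (Suc 0)) (\<lambda>xs. Q (xs ! 0) (xs ! 1))"
  shows "dfn1 (\<lambda>s. \<forall>\<^sub>F y in at_right s. Q s y)"
proof -
  have "dfn (Suc 0) (\<lambda>xs. \<exists>b. b > xs ! 0 \<and> (\<forall>y. y > xs ! 0 \<longrightarrow> y < b \<longrightarrow> Q (xs ! 0) y))"
    by (intro dfn_ex_real dfn_all_real dfn_conj dfn_imp dfn_less dfn_arg2[OF assms] dfun_var)
       (auto intro: dfun_var)
  then show ?thesis unfolding eventually_at_right_field .
qed

lemma dfn_eventually_left:
  assumes "dfn (Suc (Suc 0)) (\<lambda>xs. Q (xs ! 0) (xs ! 1))"
  shows "dfn1 (\<lambda>s. \<forall>\<^sub>F y in at_left s. Q s y)"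
proof -
  have "dfn (Suc 0) (\<lambda>xs. \<exists>b. b < xs ! 0 \<and> (\<forall>y. y > b \<longrightarrow> y < xs ! 0 \<longrightarrow> Q (xs ! 0) y))"
    by (intro dfn_ex_real dfn_all_real dfn_conj dfn_imp dfn_less dfn_arg2[OF assms] dfun_var)
       (auto intro: dfun_var)
  then show ?thesis unfolding eventually_at_left_field .
qed

lemma dfun1_less_eventually_right:
  assumes "dfun1 h"
  shows "(\<forall>\<^sub>F y in at_right s. h s < h y) \<or> (\<forall>\<^sub>F y in at_right s. h y < h s) \<or> (\<forall>\<^sub>F y in at_right s. h y = h s)"
proof -
  have "dfn1 (\<lambda>y. h s < h y)" "dfn1 (\<lambda>y. h y < h s)"
    using assms by (auto intro!: dfn_less dfun_const)
  note cases = this[THEN dfn1_eventually_right, of s]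
  have "\<forall>\<^sub>F y in at_right s. h y = h s"
    if "\<forall>\<^sub>F y in at_right s. \<not> h s < h y" "\<forall>\<^sub>F y in at_right s. \<not> h y < h s"
    using that by eventually_elim simp
  then show ?thesis using cases by blast
qed

lemma dfun1_less_eventually_left:
  assumes "dfun1 h"
  shows "(\<forall>\<^sub>F y in at_left s. h s < h y) \<or> (\<forall>\<^sub>F y in at_left s. h y < h s) \<or> (\<forall>\<^sub>F y in at_left s. h y = h s)"
proof -
  have "dfn1 (\<lambda>y. h s < h y)" "dfn1 (\<lambda>y. h y < h s)"
    using assms by (auto intro!: dfn_less dfun_const)
  note cases = this[THEN dfn1_eventually_left, of s]
  have "\<forall>\<^sub>F y in at_left s. h y = h s"
    if "\<forall>\<^sub>F y in at_left s. \<not> h s < h y" "\<forall>\<^sub>F y in at_left s. \<not> h y < h s"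
    using that by eventually_elim simp
  then show ?thesis using cases by blast
qed

text \<open>The range is definable and countable, hence finite. Each level set contains either all
  or none of the points close to 0, and finitely many of them cannot all be missed.\<close>

lemma dfun1_countable_range:
  assumes h: "dfun1 h" and "\<delta> > 0" and c: "countable (h ` {0<..<\<delta>})"
  shows "\<exists>v. \<forall>\<^sub>F s in at_right 0. h s = v"
proof (rule ccontr)
  assume n: "\<not> ?thesis"
  have "dfn1 (\<lambda>v. \<exists>s. 0 < s \<and> s < \<delta> \<and> v = h s)"
    by (intro dfn_ex_real dfn_conj dfn_less dfn_eq dfun_const dfun_var dfun_take[OF dfun_var]
        dfun_fun_arg[OF h]) auto
  moreover have "{v. \<exists>s. 0 < s \<and> s < \<delta> \<and> v = h s} = h ` {0<..<\<delta>}" by auto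
  ultimately have fin: "finite (h ` {0<..<\<delta>})"
    using dfn1_countable_finite[of "\<lambda>v. \<exists>s. 0 < s \<and> s < \<delta> \<and> v = h s"] c by simp
  have "\<forall>\<^sub>F s in at_right 0. h s \<noteq> v" for v
  proof -
    have "dfn1 (\<lambda>s. h s = v)" using h by (intro dfn_eq dfun_const)
    from dfn1_eventually_right[OF this, of 0] show ?thesis using n by blast
  qed
  then have "\<forall>\<^sub>F s in at_right 0. \<forall>v\<in>h ` {0<..<\<delta>}. h s \<noteq> v"
    using fin by (intro eventually_ball_finite) auto
  moreover have "\<forall>\<^sub>F s in at_right 0. s \<in> {0<..<\<delta>}"
    using \<open>\<delta> > 0\<close> unfolding eventually_at_right_field by (intro exI[of _ \<delta>]) auto
  ultimately have "\<forall>\<^sub>F s::real in at_right 0. False" by eventually_elim blast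
  then show False using eventually_happens'[of "at_right (0::real)"] trivial_limit_at_right_real by blast
qed

end

text \<open>Every interval of constancy contains a rational, so all values in question are already
  taken at rationals.\<close>

lemma countable_range_right_const:
  fixes h :: "real \<Rightarrow> 'b"
  assumes "\<And>s. s \<in> A \<Longrightarrow> \<forall>\<^sub>F y in at_right s. h y = h s"
  shows "countable (h ` A)"
proof (rule countable_subset)
  show "h ` A \<subseteq> h ` \<rat>"
  proof
    fix v assume "v \<in> h ` A"
    then obtain s where s: "s \<in> A" "v = h s" by auto
    then obtain b where b: "b > s" "\<And>y. y > s \<Longrightarrow> y < b \<Longrightarrow> h y = h s"
      using assms[OF s(1)] unfolding eventually_at_right_field by auto
    obtain q where "q \<in> \<rat>" "s < q" "q < b" using Rats_dense_in_real[OF b(1)] by auto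
    then show "v \<in> h ` \<rat>" using b(2)[of q] s by (intro image_eqI[of _ _ q]) auto
  qed
  show "countable (h ` \<rat>)" by (intro countable_image countable_rat)
qed

lemma countable_range_left_const:
  fixes h :: "real \<Rightarrow> 'b"
  assumes "\<And>s. s \<in> A \<Longrightarrow> \<forall>\<^sub>F y in at_left s. h y = h s"
  shows "countable (h ` A)"
proof (rule countable_subset)
  show "h ` A \<subseteq> h ` \<rat>"
  proof
    fix v assume "v \<in> h ` A"
    then obtain s where s: "s \<in> A" "v = h s" by auto
    then obtain b where b: "b < s" "\<And>y. y > b \<Longrightarrow> y < s \<Longrightarrow> h y = h s"
      using assms[OF s(1)] unfolding eventually_at_left_field by auto
    obtain q where "q \<in> \<rat>" "b < q" "q < s" using Rats_dense_in_real[OF b(1)] by auto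
    then show "v \<in> h ` \<rat>" using b(2)[of q] s by (intro image_eqI[of _ _ q]) auto
  qed
  show "countable (h ` \<rat>)" by (intro countable_image countable_rat)
qed

text \<open>Two rationals close enough around a strict local minimum determine its value, as the
  minimum over the interval between them; \<open>?g\<close> reads this value off the pair.\<close>

lemma countable_range_local_min:
  fixes h :: "real \<Rightarrow> real"
  assumes r: "\<And>s. s \<in> A \<Longrightarrow> \<forall>\<^sub>F y in at_right s. h s < h y"
    and l: "\<And>s. s \<in> A \<Longrightarrow> \<forall>\<^sub>F y in at_left s. h s < h y"
  shows "countable (h ` A)"
proof (rule countable_subset)
  let ?g = "\<lambda>(p, q). THE v. \<exists>s\<in>{p<..<q}. v = h s \<and> (\<forall>y\<in>{p<..<q}. h s \<le> h y)"
  show "h ` A \<subseteq> ?g ` (\<rat> \<times> \<rat>)"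
  proof
    fix v assume "v \<in> h ` A"
    then obtain s where s: "s \<in> A" "v = h s" by auto
    obtain b where b: "b < s" "\<And>y. y > b \<Longrightarrow> y < s \<Longrightarrow> h s < h y"
      using l[OF s(1)] unfolding eventually_at_left_field by auto
    obtain c where c: "c > s" "\<And>y. y > s \<Longrightarrow> y < c \<Longrightarrow> h s < h y"
      using r[OF s(1)] unfolding eventually_at_right_field by auto
    obtain p where p: "p \<in> \<rat>" "b < p" "p < s" using Rats_dense_in_real[OF b(1)] by auto
    obtain q where q: "q \<in> \<rat>" "s < q" "q < c" using Rats_dense_in_real[OF c(1)] by auto
    have "h s \<le> h y" if "y \<in> {p<..<q}" for y
      using b(2)[of y] c(2)[of y] that p q by (cases y s rule: linorder_cases) auto
    then have "?g (p, q) = v"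
      unfolding prod.case
    proof (intro the_equality)
      show "\<exists>s\<in>{p<..<q}. v = h s \<and> (\<forall>y\<in>{p<..<q}. h s \<le> h y)"
        using s p q \<open>\<And>y. y \<in> {p<..<q} \<Longrightarrow> h s \<le> h y\<close> by (intro bexI[of _ s]) auto
    next
      fix w assume "\<exists>s\<in>{p<..<q}. w = h s \<and> (\<forall>y\<in>{p<..<q}. h s \<le> h y)"
      then obtain s' where "s' \<in> {p<..<q}" "w = h s'" "\<forall>y\<in>{p<..<q}. h s' \<le> h y" by auto
      then show "w = v" using s p q \<open>\<And>y. y \<in> {p<..<q} \<Longrightarrow> h s \<le> h y\<close> by (intro antisym) auto
    qed
    then show "v \<in> ?g ` (\<rat> \<times> \<rat>)" using p q by (intro image_eqI[of _ _ "(p, q)"]) auto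
  qed
  show "countable (?g ` (\<rat> \<times> \<rat>))" by (intro countable_image countable_SIGMA countable_rat)
qed

context o_minimal_structure
begin

lemma dfn1_cases_right:
  assumes "\<And>s. P s \<or> Q s \<or> R s" "dfn1 P" "dfn1 Q"
  shows "(\<forall>\<^sub>F s in at_right a. P s) \<or> (\<forall>\<^sub>F s in at_right a. Q s) \<or> (\<forall>\<^sub>F s in at_right a. R s)"
proof -
  have "\<forall>\<^sub>F s in at_right a. R s" if "\<forall>\<^sub>F s in at_right a. \<not> P s" "\<forall>\<^sub>F s in at_right a. \<not> Q s"
    using that by eventually_elim (use assms(1) in blast)
  then show ?thesis using assms(2,3)[THEN dfn1_eventually_right, of a] by blast
qed

text \<open>On each side of s the function is locally larger, smaller or equal, and each alternative
  is definable in s, so all s close to 0 are of the same type. Equality on a side or a strict local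
  extremum forces a countable range and thus a constant; the two remaining types are monotone by
  \<open>strict_mono_of_local\<close>.\<close>

theorem dfun1_monotonicity:
  assumes h: "dfun1 h"
  shows "\<exists>\<delta>>0. mono_on {0<..<\<delta>} h \<or> antimono_on {0<..<\<delta>} h"
proof -
  have d2: "dfn (Suc (Suc 0)) (\<lambda>xs. h (xs ! 0) < h (xs ! 1))"
    "dfn (Suc (Suc 0)) (\<lambda>xs. h (xs ! 1) < h (xs ! 0))"
    by (intro dfn_less dfun_fun_arg[OF h] dfun_var; simp)+
  have hm: "dfun1 (\<lambda>s. - h s)" using dfun_diff[OF dfun_const[of _ 0] h] by simp
  have interval: "\<exists>\<delta>>0. \<forall>s\<in>{0<..<\<delta>}. P s" if "\<forall>\<^sub>F s in at_right 0. P s" for P :: "real \<Rightarrow> bool"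
    using that unfolding eventually_at_right_field by auto
  have const: ?thesis if c: "\<delta> > 0" "countable (h ` {0<..<\<delta>})" for \<delta>
  proof -
    obtain v where "\<forall>\<^sub>F s in at_right 0. h s = v" using dfun1_countable_range[OF h c] by blast
    from interval[OF this] obtain \<epsilon> where "\<epsilon> > 0" "\<forall>s\<in>{0<..<\<epsilon>}. h s = v" by blast
    then have "mono_on {0<..<\<epsilon>} h" by (intro mono_onI) simp
    then show ?thesis using \<open>\<epsilon> > 0\<close> by blast
  qed
  \<comment> \<open>Of the nine combinations of a left and a right type, the first two cases absorb
    the five that contain an equality.\<close>
  consider (l0) "\<forall>\<^sub>F s in at_right 0. \<forall>\<^sub>F y in at_left s. h y = h s"
    | (r0) "\<forall>\<^sub>F s in at_right 0. \<forall>\<^sub>F y in at_right s. h y = h s"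
    | (inc) "\<forall>\<^sub>F s in at_right 0. \<forall>\<^sub>F y in at_left s. h y < h s"
        "\<forall>\<^sub>F s in at_right 0. \<forall>\<^sub>F y in at_right s. h s < h y"
    | (dec) "\<forall>\<^sub>F s in at_right 0. \<forall>\<^sub>F y in at_left s. h s < h y"
        "\<forall>\<^sub>F s in at_right 0. \<forall>\<^sub>F y in at_right s. h y < h s"
    | (min) "\<forall>\<^sub>F s in at_right 0. \<forall>\<^sub>F y in at_left s. h s < h y"
        "\<forall>\<^sub>F s in at_right 0. \<forall>\<^sub>F y in at_right s. h s < h y"
    | (max) "\<forall>\<^sub>F s in at_right 0. \<forall>\<^sub>F y in at_left s. h y < h s"
        "\<forall>\<^sub>F s in at_right 0. \<forall>\<^sub>F y in at_right s. h y < h s"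
    using dfn1_cases_right[OF dfun1_less_eventually_right[OF h] d2[THEN dfn_eventually_right], of 0]
      dfn1_cases_right[OF dfun1_less_eventually_left[OF h] d2[THEN dfn_eventually_left], of 0]
    by blast
  then show ?thesis
  proof cases
    case l0
    from interval[OF this] obtain \<delta> where d: "\<delta> > 0" "\<forall>s\<in>{0<..<\<delta>}. \<forall>\<^sub>F y in at_left s. h y = h s"
      by blast
    from d(2) have "countable (h ` {0<..<\<delta>})" by (intro countable_range_left_const) blast
    from const[OF d(1) this] show ?thesis .
  next
    case r0
    from interval[OF this] obtain \<delta> where d: "\<delta> > 0" "\<forall>s\<in>{0<..<\<delta>}. \<forall>\<^sub>F y in at_right s. h y = h s"
      by blast
    from d(2) have "countable (h ` {0<..<\<delta>})" by (intro countable_range_right_const) blast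
    from const[OF d(1) this] show ?thesis .
  next
    case inc
    obtain \<delta> where d: "\<delta> > 0"
      "\<forall>s\<in>{0<..<\<delta>}. (\<forall>\<^sub>F y in at_left s. h y < h s) \<and> (\<forall>\<^sub>F y in at_right s. h s < h y)"
      using interval[OF eventually_conj[OF inc]] by auto
    have "h a \<le> h b" if "a \<in> {0<..<\<delta>}" "b \<in> {0<..<\<delta>}" "a \<le> b" for a b
    proof (cases "a = b")
      case False
      have "h a < h b" by (rule strict_mono_of_local) (use d(2) that False in auto)
      then show ?thesis by simp
    qed simp
    then show ?thesis using d by (auto intro!: exI[of _ \<delta>] mono_onI)
  next
    case dec
    obtain \<delta> where d: "\<delta> > 0"
      "\<forall>s\<in>{0<..<\<delta>}. (\<forall>\<^sub>F y in at_left s. h s < h y) \<and> (\<forall>\<^sub>F y in at_right s. h y < h s)"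
      using interval[OF eventually_conj[OF dec]] by auto
    have "h b \<le> h a" if "a \<in> {0<..<\<delta>}" "b \<in> {0<..<\<delta>}" "a \<le> b" for a b
    proof (cases "a = b")
      case False
      have "- h a < - h b" by (rule strict_mono_of_local) (use d(2) that False in auto)
      then show ?thesis by simp
    qed simp
    then show ?thesis using d by (auto intro!: exI[of _ \<delta>] monotone_onI)
  next
    case min
    obtain \<delta> where d: "\<delta> > 0"
      "\<forall>s\<in>{0<..<\<delta>}. (\<forall>\<^sub>F y in at_left s. h s < h y) \<and> (\<forall>\<^sub>F y in at_right s. h s < h y)"
      using interval[OF eventually_conj[OF min]] by auto
    show ?thesis by (rule const[OF d(1) countable_range_local_min]) (use d in auto)
  next
    case max
    obtain \<delta> where d: "\<delta> > 0"
      "\<forall>s\<in>{0<..<\<delta>}. (\<forall>\<^sub>F y in at_left s. h y < h s) \<and> (\<forall>\<^sub>F y in at_right s. h y < h s)"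
      using interval[OF eventually_conj[OF max]] by auto
    have "countable ((\<lambda>s. - h s) ` {0<..<\<delta>})"
      by (rule countable_range_local_min) (use d in auto)
    then have "countable (uminus ` (\<lambda>s. - h s) ` {0<..<\<delta>})" by (rule countable_image)
    then have "countable (h ` {0<..<\<delta>})" by (simp add: image_image)
    from const[OF d(1) this] show ?thesis .
  qed
qed

text \<open>The estimate \<open>lin\<close> compares h with a line only from the point 0;
  monotonicity turns it into a bound between any two points. Since M exceeds the slope \<bar>u\<bar>
  + e, the function h s - M * s cannot increase near 0, so it is antitone, which bounds increments
  of h from above; applied to - h it bounds them from below.\<close>

lemma dfun1_lipschitz_at_0:
  assumes h: "dfun1 h" and "\<delta>0 > 0" "e \<ge> 0"
    and lin: "\<And>s. s \<in> {0<..<\<delta>0} \<Longrightarrow> \<bar>h s - c - s * u\<bar> \<le> e * s"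
  shows "\<exists>\<delta>>0. \<forall>s\<in>{0<..<\<delta>}. \<forall>t\<in>{0<..<\<delta>}. \<bar>h t - h s\<bar> \<le> (\<bar>u\<bar> + e + 1) * \<bar>t - s\<bar>"
proof -
  define M where "M = \<bar>u\<bar> + e + 1"
  have "M \<ge> 1" using \<open>e \<ge> 0\<close> by (simp add: M_def)
  have one: "\<exists>\<delta>>0. antimono_on {0<..<\<delta>} (\<lambda>s. g s - M * s)"
    if g: "dfun1 g" and lin: "\<And>s. s \<in> {0<..<\<delta>0} \<Longrightarrow> \<bar>g s - c - s * u\<bar> \<le> e * s" and M: "M = \<bar>u\<bar> + e + 1"
    for g c u
  proof -
    have "dfun1 (\<lambda>s. g s - M * s)"
      using g by (intro dfun_diff dfun_mult dfun_const dfun_var) auto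
    from dfun1_monotonicity[OF this] obtain \<delta> where d: "\<delta> > 0"
      "mono_on {0<..<\<delta>} (\<lambda>s. g s - M * s) \<or> antimono_on {0<..<\<delta>} (\<lambda>s. g s - M * s)" by auto
    have "\<not> mono_on {0<..<\<delta>} (\<lambda>s. g s - M * s)"
    proof
      assume mono: "mono_on {0<..<\<delta>} (\<lambda>s. g s - M * s)"
      define t where "t = min \<delta> \<delta>0 / 2"
      \<comment> \<open>Small enough that the drop of g - M * s below c, at most 2 * M * s at s,
        stays short of the drop at t, which is at least t.\<close>
      define s where "s = t / (2 * M + 1)"
      have t: "0 < t" "t < \<delta>" "t < \<delta>0" using d \<open>\<delta>0 > 0\<close> by (auto simp: t_def)
      have "0 < s" using t \<open>M \<ge> 1\<close> by (auto simp: s_def)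
      moreover have "s * (2 * M + 1) = t" using \<open>M \<ge> 1\<close> by (simp add: s_def)
      ultimately have s: "0 < s" "t = s * (2 * M) + s" by (simp_all add: distrib_left)
      then have "s < t" using \<open>M \<ge> 1\<close> by simp
      have "g s - M * s \<le> g t - M * t" using mono s(1) \<open>s < t\<close> t by (auto simp: mono_on_def)
      moreover have "g t \<le> c + t * u + e * t" "g s \<ge> c + s * u - e * s" using lin[of s] lin[of t] s(1) \<open>s < t\<close> t by (auto simp: abs_le_iff)
      moreover have "t * (u + e - M) \<le> t * (-1)" using t by (intro mult_left_mono) (auto simp: M)
      moreover have "s * (u - e - M) \<ge> s * (- (2 * M))" using s by (intro mult_left_mono) (auto simp: M)
      ultimately show False using s(1) by (simp add: algebra_simps s(2))
    qed
    then show ?thesis using d by auto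
  qed
  obtain \<delta>1 where d1: "\<delta>1 > 0" "antimono_on {0<..<\<delta>1} (\<lambda>s. h s - M * s)"
    using one[OF h lin M_def] by auto
  have hm: "dfun1 (\<lambda>s. - h s)" using dfun_diff[OF dfun_const[of _ 0] h] by simp
  obtain \<delta>2 where d2: "\<delta>2 > 0" "antimono_on {0<..<\<delta>2} (\<lambda>s. - h s - M * s)"
    using one[OF hm, of "-c" "-u"] lin by (force simp: M_def abs_le_iff)
  have *: "\<bar>h t - h s\<bar> \<le> M * (t - s)" if "0 < s" "s \<le> t" "t < min \<delta>1 \<delta>2" for s t
  proof -
    have "h t - M * t \<le> h s - M * s" "- h t - M * t \<le> - h s - M * s"
      using d1(2) d2(2) that by (auto simp: monotone_on_def)
    then show ?thesis by (simp add: abs_le_iff algebra_simps)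
  qed
  have "\<bar>h t - h s\<bar> \<le> M * \<bar>t - s\<bar>" if "s \<in> {0<..<min \<delta>1 \<delta>2}" "t \<in> {0<..<min \<delta>1 \<delta>2}" for s t
    using *[of s t] *[of t s] that by (cases "s \<le> t") (auto simp: abs_minus_commute)
  then show ?thesis using d1 d2 by (intro exI[of _ "min \<delta>1 \<delta>2"]) (auto simp: M_def)
qed

section \<open>Definable choice\<close>

lemma dfun_if: "dfn m P \<Longrightarrow> dfun m f \<Longrightarrow> dfun m g \<Longrightarrow> dfun m (\<lambda>xs. if P xs then f xs else g xs)"
proof -
  assume a: "dfn m P" "dfun m f" "dfun m g"
  have "dfn (Suc m) (\<lambda>xs. (P (take m xs) \<and> xs ! m = f (take m xs)) \<or> (\<not> P (take m xs) \<and> xs ! m = g (take m xs)))"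
    by (intro dfn_disj dfn_conj dfn_neg dfn_eq dfun_var dfun_take[OF a(2)] dfun_take[OF a(3)] dfn_take[OF a(1)]) auto
  then show ?thesis unfolding dfun_def by (rule dfn_eqI) auto
qed

lemma dfun1_Inf:
  assumes Q: "dfn (Suc (Suc 0)) (\<lambda>xs. Q (xs ! 0) (xs ! 1))"
    and ne: "\<And>s. \<exists>a. Q s a" and bd: "\<And>s a. Q s a \<Longrightarrow> B \<le> (a::real)"
  shows "dfun1 (\<lambda>s. Inf {a. Q s a})"
proof -
  have "dfn (Suc (Suc 0)) (\<lambda>xs. (\<forall>a. Q (xs ! 0) a \<longrightarrow> xs ! 1 \<le> a) \<and>
      (\<forall>w. (\<forall>a. Q (xs ! 0) a \<longrightarrow> w \<le> a) \<longrightarrow> w \<le> xs ! 1))"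
    by (intro dfn_all_real dfn_conj dfn_imp dfn_le dfn_arg2[OF Q] dfun_var)
       (auto intro: dfun_var)
  moreover have "(v = Inf {a. Q s a}) \<longleftrightarrow> (\<forall>a. Q s a \<longrightarrow> v \<le> a) \<and> (\<forall>w. (\<forall>a. Q s a \<longrightarrow> w \<le> a) \<longrightarrow> w \<le> v)" for s v
  proof -
    have b: "bdd_below {a. Q s a}" using bd by (intro bdd_belowI[of _ B]) auto
    show ?thesis using cInf_lower[OF _ b] cInf_greatest[of "{a. Q s a}"] ne[of s]
      by (auto intro!: antisym)
  qed
  ultimately show ?thesis unfolding dfun_def by (simp add: dfn_def cong: conj_cong)
qed

text \<open>The fibre over s is a finite union of intervals, so its leftmost piece can be named
  definably: take the infimum if it belongs to the fibre; otherwise the fibre contains a right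
  neighbourhood of the infimum, and the midpoint up to the first missing point is taken.\<close>

lemma definable_choice_real:
  assumes Q: "dfn (Suc (Suc 0)) (\<lambda>xs. Q (xs ! 0) (xs ! 1))"
    and bd: "\<And>s a. Q s a \<Longrightarrow> \<bar>a\<bar> \<le> B"
  shows "\<exists>f. dfun1 f \<and> (\<forall>s. (\<exists>a. Q s a) \<longrightarrow> Q s (f s))"
proof -
  \<comment> \<open>Empty fibres are replaced by {0}, so that all infima below exist and the
    selection is total.\<close>
  define R where "R s a \<longleftrightarrow> Q s a \<or> ((\<forall>b. \<not> Q s b) \<and> a = 0)" for s a
  have R2: "dfn (Suc (Suc 0)) (\<lambda>xs. R (xs ! 0) (xs ! 1))" unfolding R_def
    by (intro dfn_all_real dfn_neg dfn_disj dfn_conj dfn_eq dfn_arg2[OF Q] dfun_var dfun_const)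
       (auto intro: dfun_var)
  have ne: "\<exists>a. R s a" for s by (auto simp: R_def)
  have RB: "\<bar>a\<bar> \<le> \<bar>B\<bar>" if "R s a" for s a using that bd[of s a] by (auto simp: R_def)
  define g where "g s = Inf {a. R s a}" for s
  have g: "dfun1 g" unfolding g_def using RB by (intro dfun1_Inf[OF R2 ne, of "-\<bar>B\<bar>"]) (force simp: abs_le_iff)
  \<comment> \<open>The end of the initial piece of the fibre; the bound B provides missing points
    beyond it.\<close>
  define b where "b s = Inf {a. g s < a \<and> \<not> R s a}" for s
  have R: "dfn1 (\<lambda>a. R s a)" for s by (intro dfn_arg2[OF R2] dfun_const dfun_var) auto
  have bb: "bdd_below {a. R s a}" for s using RB by (intro bdd_belowI[of _ "-\<bar>B\<bar>"]) (force simp: abs_le_iff)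
  have gl: "g s \<le> a" if "R s a" for s a unfolding g_def using that by (intro cInf_lower bb) auto
  have gB: "\<bar>g s\<bar> \<le> \<bar>B\<bar>" for s
  proof -
    obtain a where a: "R s a" using ne by auto
    have "g s \<ge> - \<bar>B\<bar>" unfolding g_def using ne RB by (intro cInf_greatest) (force simp: abs_le_iff)+
    then show ?thesis using gl[OF a] RB[OF a] by (auto simp: abs_le_iff)
  qed
  have ne2: "\<exists>a. g s < a \<and> \<not> R s a" for s
    using gB[of s] RB[of s "\<bar>B\<bar> + 1"] by (intro exI[of _ "\<bar>B\<bar> + 1"]) (auto simp: abs_le_iff)
  have "dfn (Suc (Suc 0)) (\<lambda>xs. g (xs ! 0) < xs ! 1 \<and> \<not> R (xs ! 0) (xs ! 1))"
    by (intro dfn_conj dfn_less dfn_neg R2 dfun_fun_arg[OF g] dfun_var) auto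
  moreover have "- \<bar>B\<bar> \<le> a" if "g s < a \<and> \<not> R s a" for s a
    using gB[of s] that by (simp add: abs_le_iff)
  ultimately have "dfun1 b" unfolding b_def by (rule dfun1_Inf[OF _ ne2])
  define f where "f s = (if R s (g s) then g s else (g s + b s) * (1/2))" for s
  have "dfn (Suc 0) (\<lambda>xs. R (xs ! 0) (g (xs ! 0)))" by (intro dfn_arg2[OF R2] dfun_var g) auto
  then have "dfun1 f" unfolding f_def using g \<open>dfun1 b\<close>
    by (intro dfun_if dfun_mult dfun_add dfun_const) auto
  moreover have "R s (f s)" for s
  proof (cases "R s (g s)")
    case False
    have "\<exists>a. g s < a \<and> a < c \<and> R s a" if "c > g s" for c
    proof -
      have "\<exists>a\<in>{a. R s a}. a < c" using that ne[of s] bb[of s] unfolding g_def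
        by (subst (asm) cInf_less_iff) auto
      then show ?thesis using gl[of s] False by (metis less_le mem_Collect_eq)
    qed
    then have "\<not> (\<forall>\<^sub>F a in at_right (g s). \<not> R s a)"
      unfolding eventually_at_right_field by blast
    then have "\<forall>\<^sub>F a in at_right (g s). R s a" using dfn1_eventually_right[OF R] by blast
    then obtain c where c: "c > g s" "\<And>a. a > g s \<Longrightarrow> a < c \<Longrightarrow> R s a"
      unfolding eventually_at_right_field by blast
    have "c \<le> b s" unfolding b_def using ne2[of s] c(2) by (intro cInf_greatest) (auto simp: not_less[symmetric])
    then have lt: "g s < b s" using c by simp
    have bb2: "bdd_below {a. g s < a \<and> \<not> R s a}" by (intro bdd_belowI[of _ "g s"]) auto
    have "g s < f s" "f s < b s" using False lt by (auto simp: f_def)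
    then show ?thesis using cInf_lower[OF _ bb2, of "f s"] unfolding b_def by fastforce
  qed (simp add: f_def)
  ultimately show ?thesis by (intro exI[of _ f]) (auto simp: R_def)
qed

text \<open>Induction on the number of coordinates: the first is selected after the others have been
  quantified away, then substituted, and one coordinate fewer remains.\<close>

theorem definable_choice:
  assumes "dfn (Suc k) P" and bd: "\<And>s ys y. P (s # ys) \<Longrightarrow> y \<in> set ys \<Longrightarrow> \<bar>y\<bar> \<le> B"
  shows "\<exists>f. (\<forall>i<k. dfun1 (f i)) \<and>
    (\<forall>s. (\<exists>ys. length ys = k \<and> P (s # ys)) \<longrightarrow> P (s # map (\<lambda>i. f i s) [0..<k]))"
  using assms
proof (induction k arbitrary: P)
  case 0
  then show ?case by auto
next
  case (Suc k)
  define Q where "Q s a \<longleftrightarrow> (\<exists>ys. length ys = k \<and> P (s # a # ys))" for s a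
  have "dfn (Suc (Suc 0) + k) P" using Suc.prems(1) by simp
  from dfn_ex_list[OF this]
  have "dfn (Suc (Suc 0)) (\<lambda>xs. Q (xs ! 0) (xs ! 1))"
  proof (rule dfn_eqI)
    fix xs :: "real list" assume "length xs = Suc (Suc 0)"
    then obtain x y where "xs = [x, y]" by (auto simp: length_Suc_conv)
    then show "(\<exists>ys. length ys = k \<and> P (xs @ ys)) = Q (xs ! 0) (xs ! 1)" by (simp add: Q_def)
  qed
  moreover have "\<bar>a\<bar> \<le> B" if "Q s a" for s a
    using that Suc.prems(2)[of s _ a] by (auto simp: Q_def)
  ultimately obtain f0 where f0: "dfun1 f0" "\<And>s. (\<exists>a. Q s a) \<Longrightarrow> Q s (f0 s)"
    using definable_choice_real by metis
  define P' where "P' xs \<longleftrightarrow> P (hd xs # f0 (hd xs) # tl xs)" for xs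
  \<comment> \<open>The index shift inserts the selected value \<open>f0 (xs ! 0)\<close> at
    position 1 and moves the remaining coordinates one place up.\<close>
  have "dfn (Suc k) (\<lambda>xs. P (map (\<lambda>j. (if j = 0 then (\<lambda>xs. xs ! 0) else if j = 1 then (\<lambda>xs. f0 (xs ! 0)) else (\<lambda>xs. xs ! (j - 1))) xs) [0..<Suc (Suc k)]))"
    by (rule dfn_subst[OF Suc.prems(1)]) (auto intro!: dfun_var dfun_fun_arg[OF f0(1)])
  then have P': "dfn (Suc k) P'"
  proof (rule dfn_eqI)
    fix xs :: "real list" assume l: "length xs = Suc k"
    have "map (\<lambda>j. (if j = 0 then (\<lambda>xs. xs ! 0) else if j = 1 then (\<lambda>xs. f0 (xs ! 0)) else (\<lambda>xs. xs ! (j - 1))) xs) [0..<Suc (Suc k)]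
       = hd xs # f0 (hd xs) # tl xs"
      using l by (cases xs) (auto intro!: nth_equalityI simp: nth_Cons simp del: upt_Suc split: nat.splits)
    then show "P (map (\<lambda>j. (if j = 0 then (\<lambda>xs. xs ! 0) else if j = 1 then (\<lambda>xs. f0 (xs ! 0)) else (\<lambda>xs. xs ! (j - 1))) xs) [0..<Suc (Suc k)]) = P' xs"
      by (simp add: P'_def del: upt_Suc)
  qed
  have bd': "\<bar>y\<bar> \<le> B" if "P' (s # ys)" "y \<in> set ys" for s ys y
    using that Suc.prems(2)[of s "f0 s # ys" y] by (simp add: P'_def)
  have "\<exists>f. (\<forall>i<k. dfun1 (f i)) \<and>
    (\<forall>s. (\<exists>ys. length ys = k \<and> P' (s # ys)) \<longrightarrow> P' (s # map (\<lambda>i. f i s) [0..<k]))"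
    by (rule Suc.IH[OF P']) (erule (1) bd')
  then obtain f' where f': "\<forall>i<k. dfun1 (f' i)"
    "\<And>s. (\<exists>ys. length ys = k \<and> P' (s # ys)) \<Longrightarrow> P' (s # map (\<lambda>i. f' i s) [0..<k])" by blast
  define f where "f i = (case i of 0 \<Rightarrow> f0 | Suc i \<Rightarrow> f' i)" for i
  have "P (s # map (\<lambda>i. f i s) [0..<Suc k])" if ex: "\<exists>ys. length ys = Suc k \<and> P (s # ys)" for s
  proof -
    obtain a zs where "length zs = k" "P (s # a # zs)" using ex by (auto simp: length_Suc_conv)
    then have "Q s a" by (auto simp: Q_def)
    then have "Q s (f0 s)" using f0(2) by blast
    then have "P' (s # map (\<lambda>i. f' i s) [0..<k])" by (intro f'(2)) (auto simp: Q_def P'_def)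
    moreover have "map (\<lambda>i. f i s) [0..<Suc k] = f0 s # map (\<lambda>i. f' i s) [0..<k]"
      by (simp add: map_upt_Suc f_def del: upt_Suc)
    ultimately show ?thesis by (simp add: P'_def del: upt_Suc)
  qed
  moreover have "\<forall>i<Suc k. dfun1 (f i)" using f0(1) f'(1) by (auto simp: f_def split: nat.splits)
  ultimately show ?case by blast
qed

end

section \<open>Tangent cones and proximal normals\<close>

text \<open>The inequality is global on K with a constant of either sign depending on y and \<nu>.
  In this form it is first-order over K and therefore definable when K is.\<close>

definition proximal_normal :: "'a::real_inner set \<Rightarrow> 'a \<Rightarrow> 'a \<Rightarrow> bool" where
  "proximal_normal K y \<nu> \<longleftrightarrow> y \<in> K \<and> (\<exists>\<sigma>. \<forall>w\<in>K. \<nu> \<bullet> (w - y) \<le> \<sigma> * ((w - y) \<bullet> (w - y)))"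

lemma tangent_coneI:
  assumes "\<And>k. 0 < h k" "h \<longlonglongrightarrow> 0" "w \<longlonglongrightarrow> v" "\<And>k. z + h k *\<^sub>R w k \<in> K"
  shows "v \<in> tangent_cone K z"
  using assms unfolding tangent_cone_def by blast

lemma tangent_coneE:
  assumes "v \<in> tangent_cone K z"
  obtains h w where "\<And>k. (0::real) < h k" "h \<longlonglongrightarrow> 0" "w \<longlonglongrightarrow> v" "\<And>k::nat. z + h k *\<^sub>R w k \<in> K"
  using assms unfolding tangent_cone_def by blast

lemma tangent_cone_scaleR:
  assumes "v \<in> tangent_cone K z" "c > 0"
  shows "c *\<^sub>R v \<in> tangent_cone K z"
proof -
  obtain h w where hw: "\<And>k. (0::real) < h k" "h \<longlonglongrightarrow> 0" "w \<longlonglongrightarrow> v" "\<And>k::nat. z + h k *\<^sub>R w k \<in> K"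
    using tangent_coneE[OF assms(1)] by metis
  show ?thesis
  proof (rule tangent_coneI[where h = "\<lambda>k. h k / c" and w = "\<lambda>k. c *\<^sub>R w k"])
    show "(\<lambda>k. h k / c) \<longlonglongrightarrow> 0" using tendsto_divide[OF hw(2) tendsto_const[of c]] assms(2) by simp
    show "(\<lambda>k. c *\<^sub>R w k) \<longlonglongrightarrow> c *\<^sub>R v" by (intro tendsto_scaleR tendsto_const hw)
  qed (use hw assms in auto)
qed

lemma inner_diff_self:
  fixes u v :: "'a::real_inner"
  shows "(u - v) \<bullet> (u - v) = u \<bullet> u - 2 * (u \<bullet> v) + v \<bullet> v"
  by (simp add: inner_diff_left inner_diff_right inner_commute)

text \<open>Expanding the square of the distance from a to w around the nearest point gives the
  quadratic inequality, with constant 1 / (2 * \<tau>) after scaling.\<close>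

lemma closest_point_proximal:
  fixes K :: "'a::euclidean_space set"
  assumes "closed K" "K \<noteq> {}" "\<tau> > 0"
  shows "proximal_normal K (closest_point K a) ((a - closest_point K a) /\<^sub>R \<tau>)"
proof -
  let ?b = "closest_point K a"
  have b: "?b \<in> K" using assms closest_point_in_set by blast
  have "((a - ?b) /\<^sub>R \<tau>) \<bullet> (w - ?b) \<le> (1 / (2 * \<tau>)) * ((w - ?b) \<bullet> (w - ?b))" if "w \<in> K" for w
  proof -
    have "dist a ?b \<le> dist a w" using assms that closest_point_le by blast
    then have "norm (a - ?b) \<le> norm (a - w)" by (simp add: dist_norm)
    then have "(a - ?b) \<bullet> (a - ?b) \<le> (a - w) \<bullet> (a - w)" by (rule norm_le[THEN iffD1])
    moreover have "(a - w) \<bullet> (a - w) = (a - ?b) \<bullet> (a - ?b) - 2 * ((a - ?b) \<bullet> (w - ?b)) + (w - ?b) \<bullet> (w - ?b)"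
      using inner_diff_self[of "a - ?b" "w - ?b"] by (simp only: diff_diff_eq2 diff_add_cancel)
    ultimately have "(a - ?b) \<bullet> (w - ?b) \<le> ((w - ?b) \<bullet> (w - ?b)) / 2" by linarith
    then have "inverse \<tau> * ((a - ?b) \<bullet> (w - ?b)) \<le> inverse \<tau> * (((w - ?b) \<bullet> (w - ?b)) / 2)"
      using \<open>\<tau> > 0\<close> by (intro mult_left_mono) auto
    also have "\<dots> = 1 / (2 * \<tau>) * ((w - ?b) \<bullet> (w - ?b))" by (simp add: inverse_eq_divide)
    finally show ?thesis by (simp only: inner_scaleR_left)
  qed
  then show ?thesis using b unfolding proximal_normal_def by blast
qed

text \<open>
  Blow-up argument: for small \<open>\<tau>\<close> the point \<open>p\<close> is the only point of the tangent cone nearest to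
  \<open>p + \<tau> \<nu>\<close>, so the points of \<open>(K - z) / h\<close> nearest to \<open>p + \<tau> \<nu>\<close> converge to \<open>p\<close> as \<open>h\<close> tends to 0.
\<close>

lemma tangent_cone_normal_approx:
  fixes K :: "'a::euclidean_space set"
  assumes K: "closed K" and p: "p \<in> tangent_cone K z" and "r > 0" "c \<ge> 0" "\<epsilon> > 0"
    and \<nu>: "\<And>w. w \<in> tangent_cone K z \<Longrightarrow> norm (w - p) \<le> r \<Longrightarrow> \<nu> \<bullet> (w - p) \<le> c * ((w - p) \<bullet> (w - p))"
  shows "\<exists>z' \<nu>'. proximal_normal K z' \<nu>' \<and> norm (z' - z) < \<epsilon> \<and> norm (\<nu>' - \<nu>) < \<epsilon>"
proof -
  obtain h w where hw: "\<And>k. (0::real) < h k" "h \<longlonglongrightarrow> 0" "w \<longlonglongrightarrow> p" "\<And>k::nat. z + h k *\<^sub>R w k \<in> K"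
    using tangent_coneE[OF p] by metis
  then have ne: "K \<noteq> {}" by auto
  \<comment> \<open>The first bound gives 2 * \<tau> * c < 1, which makes p the unique nearest
    point; the second keeps any competitor within distance r of p, where the hypothesis on \<nu> is
    available.\<close>
  define \<tau> where "\<tau> = min (1 / (4 * (c + 1))) (r / (2 * (norm \<nu> + 1)))"
  have \<tau>: "\<tau> > 0" using \<open>c \<ge> 0\<close> \<open>r > 0\<close> norm_ge_zero[of \<nu>]
    by (simp add: \<tau>_def add_nonneg_pos del: norm_ge_zero)
  have "\<tau> \<le> 1 / (4 * (c + 1))" by (simp add: \<tau>_def)
  then have "\<tau> * (4 * (c + 1)) \<le> 1" using \<open>c \<ge> 0\<close> by (subst (asm) pos_le_divide_eq) auto
  then have \<tau>c: "2 * \<tau> * c < 1" using \<tau> by (simp add: algebra_simps)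
  have "\<tau> \<le> r / (2 * (norm \<nu> + 1))" by (simp add: \<tau>_def)
  then have "\<tau> * (2 * (norm \<nu> + 1)) \<le> r"
    using norm_ge_zero[of \<nu>] by (subst (asm) pos_le_divide_eq) (auto simp del: norm_ge_zero)
  then have \<tau>r: "2 * \<tau> * norm \<nu> \<le> r" using \<tau> by (simp add: algebra_simps)
  define a where "a j = z + h j *\<^sub>R (p + \<tau> *\<^sub>R \<nu>)" for j
  define b where "b j = closest_point K (a j)" for j
  define P where "P j = (b j - z) /\<^sub>R h j" for j
  have bK: "b j \<in> K" for j unfolding b_def using K ne closest_point_in_set by blast
  have bP: "b j = z + h j *\<^sub>R P j" for j using hw(1)[of j] by (simp add: P_def)
  have aP: "a j - b j = h j *\<^sub>R (p + \<tau> *\<^sub>R \<nu> - P j)" for j by (simp add: a_def bP algebra_simps)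
  have Pw: "norm (p + \<tau> *\<^sub>R \<nu> - P j) \<le> norm (p + \<tau> *\<^sub>R \<nu> - w j)" for j
  proof -
    have "norm (a j - b j) \<le> norm (a j - (z + h j *\<^sub>R w j))"
      using closest_point_le[OF K hw(4), of "a j" j] by (simp add: b_def dist_norm)
    also have "a j - (z + h j *\<^sub>R w j) = h j *\<^sub>R (p + \<tau> *\<^sub>R \<nu> - w j)" by (simp add: a_def algebra_simps)
    finally show ?thesis using hw(1)[of j] by (simp add: aP)
  qed
  have lim: "(\<lambda>j. norm (p + \<tau> *\<^sub>R \<nu> - w j)) \<longlonglongrightarrow> norm (p + \<tau> *\<^sub>R \<nu> - p)"
    by (intro tendsto_norm tendsto_diff tendsto_const hw)
  then have "bounded (range (\<lambda>j. norm (p + \<tau> *\<^sub>R \<nu> - w j)))" by (rule convergent_imp_bounded)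
  then obtain B where B: "\<And>j. norm (p + \<tau> *\<^sub>R \<nu> - w j) \<le> B" unfolding bounded_iff by auto
  have "bounded (range P)"
  proof (rule boundedI)
    fix y assume "y \<in> range P"
    then obtain j where "y = P j" by auto
    then show "norm y \<le> norm (p + \<tau> *\<^sub>R \<nu>) + B"
      using norm_triangle_sub[of y "p + \<tau> *\<^sub>R \<nu>"] Pw[of j] B[of j] by (simp add: norm_minus_commute)
  qed
  then obtain l r' where r': "strict_mono r'" "(P \<circ> r') \<longlonglongrightarrow> l"
    using bounded_imp_convergent_subsequence by blast
  have h': "(h \<circ> r') \<longlonglongrightarrow> 0" using hw(2) r'(1) LIMSEQ_subseq_LIMSEQ by blast
  have lT: "l \<in> tangent_cone K z"
    by (rule tangent_coneI[OF _ h' r'(2)]) (use hw(1) bK bP in \<open>auto simp: o_def\<close>)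
  have "norm (p + \<tau> *\<^sub>R \<nu> - l) \<le> norm (p + \<tau> *\<^sub>R \<nu> - p)"
  proof (rule LIMSEQ_le)
    show "(\<lambda>j. norm (p + \<tau> *\<^sub>R \<nu> - (P \<circ> r') j)) \<longlonglongrightarrow> norm (p + \<tau> *\<^sub>R \<nu> - l)"
      by (intro tendsto_norm tendsto_diff tendsto_const r')
    show "(\<lambda>j. norm (p + \<tau> *\<^sub>R \<nu> - w (r' j))) \<longlonglongrightarrow> norm (p + \<tau> *\<^sub>R \<nu> - p)"
      using LIMSEQ_subseq_LIMSEQ[OF lim r'(1)] by (simp add: o_def)
  qed (use Pw in auto)
  then have le: "norm (\<tau> *\<^sub>R \<nu> - (l - p)) \<le> norm (\<tau> *\<^sub>R \<nu>)" by (simp add: algebra_simps)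
  have "norm (l - p) \<le> r"
    using norm_triangle_sub[of "l - p" "\<tau> *\<^sub>R \<nu>"] le \<tau> \<tau>r by (simp add: norm_minus_commute)
  then have "\<nu> \<bullet> (l - p) \<le> c * ((l - p) \<bullet> (l - p))" using \<nu> lT by blast
  then have "2 * \<tau> * (\<nu> \<bullet> (l - p)) \<le> 2 * \<tau> * (c * ((l - p) \<bullet> (l - p)))"
    using \<tau> by (intro mult_left_mono) auto
  moreover have "(\<tau> *\<^sub>R \<nu> - (l - p)) \<bullet> (\<tau> *\<^sub>R \<nu> - (l - p)) \<le> (\<tau> *\<^sub>R \<nu>) \<bullet> (\<tau> *\<^sub>R \<nu>)"
    using le by (rule norm_le[THEN iffD1])
  then have "(l - p) \<bullet> (l - p) \<le> 2 * \<tau> * (\<nu> \<bullet> (l - p))"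
    unfolding inner_diff_self by simp
  ultimately have "(1 - 2 * \<tau> * c) * ((l - p) \<bullet> (l - p)) \<le> 0" by (simp add: algebra_simps)
  then have "(l - p) \<bullet> (l - p) \<le> 0" using \<tau>c by (simp add: mult_le_0_iff)
  then have "l = p" by (metis inner_eq_zero_iff inner_ge_zero antisym right_minus_eq)
  then have "(\<lambda>j. P (r' j) - p) \<longlonglongrightarrow> 0" using r'(2) by (simp add: o_def LIM_zero)
  then have "(\<lambda>j. norm (P (r' j) - p)) \<longlonglongrightarrow> 0" by (rule tendsto_norm_zero)
  moreover have "(\<lambda>j. h (r' j) *\<^sub>R P (r' j)) \<longlonglongrightarrow> 0"
    using tendsto_scaleR[OF h' r'(2)] by (simp add: o_def)
  then have "(\<lambda>j. norm (h (r' j) *\<^sub>R P (r' j))) \<longlonglongrightarrow> 0" by (rule tendsto_norm_zero)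
  ultimately
  have "\<forall>\<^sub>F j in sequentially. norm (P (r' j) - p) < \<epsilon> * \<tau>" "\<forall>\<^sub>F j in sequentially. norm (h (r' j) *\<^sub>R P (r' j)) < \<epsilon>"
    using \<open>\<epsilon> > 0\<close> \<tau> by (auto elim!: order_tendstoD(2))
  then have "\<forall>\<^sub>F j in sequentially. norm (P (r' j) - p) < \<epsilon> * \<tau> \<and> norm (h (r' j) *\<^sub>R P (r' j)) < \<epsilon>"
    by (rule eventually_conj)
  then obtain j where j: "norm (P (r' j) - p) < \<epsilon> * \<tau>" "norm (h (r' j) *\<^sub>R P (r' j)) < \<epsilon>"
    using eventually_happens'[OF sequentially_bot] by blast
  let ?j = "r' j"
  \<comment> \<open>The rescaled normal misses \<nu> exactly by (p - P) / \<tau>, which tends to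
    0.\<close>
  have "(a ?j - b ?j) /\<^sub>R (\<tau> * h ?j) - \<nu> = (p - P ?j) /\<^sub>R \<tau>"
    using hw(1)[of ?j] \<tau> by (simp add: aP algebra_simps)
  moreover have "norm ((p - P ?j) /\<^sub>R \<tau>) < \<epsilon>"
    unfolding norm_scaleR using j(1) \<tau>
    by (simp add: norm_minus_commute[of p] pos_divide_less_eq divide_inverse_commute[symmetric])
  moreover have "norm (b ?j - z) < \<epsilon>" using j(2) by (simp add: bP)
  moreover have "proximal_normal K (b ?j) ((a ?j - b ?j) /\<^sub>R (\<tau> * h ?j))"
    unfolding b_def using hw(1) \<tau> by (intro closest_point_proximal K ne) auto
  ultimately show ?thesis by metis
qed

lemma tangent_proj_graphD:
  fixes K :: "((real ^ 'n) \<times> real) set"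
  assumes "(d, z, y) \<in> tangent_proj_graph K"
  shows "z \<in> K" "snd y = 1" "y \<in> tangent_cone K z"
    "\<And>w. (w, 1) \<in> tangent_cone K z \<Longrightarrow> norm (d - fst y) \<le> norm (d - w)"
proof -
  have *: "z \<in> K" "snd y = 1" "y \<in> tangent_cone K z"
    "\<And>b. b \<in> tangent_cone K z \<Longrightarrow> snd b = 1 \<Longrightarrow> dist (d, 1) y \<le> dist (d, 1) b"
    using assms by (auto simp: tangent_proj_graph_def metric_proj_def)
  show "z \<in> K" "snd y = 1" "y \<in> tangent_cone K z" by fact+
  have 1: "dist (d, 1) b = norm (d - fst b)" if "snd b = 1" for b :: "(real ^ 'n) \<times> real"
    using that by (simp add: dist_prod_def dist_norm)
  show "norm (d - fst y) \<le> norm (d - w)" if "(w, 1) \<in> tangent_cone K z" for w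
    using *(4)[OF that] 1[OF *(2)] 1[of "(w, 1)"] by simp
qed

text \<open>The slice of the cone need not be convex, so q gives only a quadratic inequality, and
  only in the slice. Homogeneity spreads it: for (x, s) in the cone, x / s is a competitor of q, and
  multiplying by s gives 2 * s * ((d - q) \<bullet> (x - s q)) \<le> \<bar>x - s q\<bar>^2. The
  radius 1/2 keeps s \<ge> 1/2, and the constant comes from x - s q = (x - q) - (s - 1) q.\<close>

lemma tangent_proj_normal:
  fixes K :: "((real ^ 'n) \<times> real) set"
  assumes K: "closed K" and g: "(d, z, (q, 1)) \<in> tangent_proj_graph K" and "\<epsilon> > 0"
  shows "\<exists>z' \<nu>'. proximal_normal K z' \<nu>' \<and> norm (z' - z) < \<epsilon> \<and>
     norm (\<nu>' - (d - q, - ((d - q) \<bullet> q))) < \<epsilon>"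
proof (rule tangent_cone_normal_approx[where p = "(q, 1)" and r = "1/2" and c = "(1 + norm q)^2"])
  show "(q, 1) \<in> tangent_cone K z" using tangent_proj_graphD[OF g] by auto
  fix w assume w: "w \<in> tangent_cone K z" and wr: "norm (w - (q, 1)) \<le> 1 / 2"
  obtain x s where xs: "w = (x, s)" by fastforce
  have s1: "\<bar>s - 1\<bar> \<le> norm (w - (q, 1))" and x1: "norm (x - q) \<le> norm (w - (q, 1))"
    using norm_snd_le[of "s - 1" "x - q"] norm_fst_le[of "x - q" "s - 1"] by (auto simp: xs)
  then have s: "s \<ge> 1/2" using wr by auto
  have "(1 / s) *\<^sub>R w \<in> tangent_cone K z" using w s by (intro tangent_cone_scaleR) auto
  then have "((1 / s) *\<^sub>R x, 1) \<in> tangent_cone K z" using s by (simp add: xs)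
  from tangent_proj_graphD(4)[OF g this] have "norm (d - q) \<le> norm (d - (1 / s) *\<^sub>R x)" by simp
  then have "s * norm (d - q) \<le> norm (s *\<^sub>R (d - (1 / s) *\<^sub>R x))" using s by simp
  also have "s *\<^sub>R (d - (1 / s) *\<^sub>R x) = s *\<^sub>R (d - q) - (x - s *\<^sub>R q)" using s by (simp add: algebra_simps)
  finally have "norm (s *\<^sub>R (d - q)) \<le> norm (s *\<^sub>R (d - q) - (x - s *\<^sub>R q))" using s by simp
  then have "(s *\<^sub>R (d - q)) \<bullet> (s *\<^sub>R (d - q)) \<le> (s *\<^sub>R (d - q) - (x - s *\<^sub>R q)) \<bullet> (s *\<^sub>R (d - q) - (x - s *\<^sub>R q))"
    by (rule norm_le[THEN iffD1])
  then have "2 * s * ((d - q) \<bullet> (x - s *\<^sub>R q)) \<le> (x - s *\<^sub>R q) \<bullet> (x - s *\<^sub>R q)"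
    unfolding inner_diff_self by simp
  moreover have "(d - q) \<bullet> (x - s *\<^sub>R q) \<le> 2 * s * ((d - q) \<bullet> (x - s *\<^sub>R q)) \<or> (d - q) \<bullet> (x - s *\<^sub>R q) \<le> 0"
    using mult_right_mono[of 1 "2 * s" "(d - q) \<bullet> (x - s *\<^sub>R q)"] s by linarith
  ultimately have 1: "(d - q) \<bullet> (x - s *\<^sub>R q) \<le> (x - s *\<^sub>R q) \<bullet> (x - s *\<^sub>R q)"
    using inner_ge_zero[of "x - s *\<^sub>R q"] by linarith
  have eq: "x - s *\<^sub>R q = (x - q) - (s - 1) *\<^sub>R q" by (simp add: algebra_simps)
  have "norm (x - s *\<^sub>R q) \<le> norm (x - q) + \<bar>s - 1\<bar> * norm q"
    by (subst eq, rule order_trans[OF norm_triangle_ineq4]) simp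
  also have "\<dots> \<le> (1 + norm q) * norm (w - (q, 1))"
    using x1 mult_right_mono[OF s1, of "norm q"] by (simp add: algebra_simps)
  finally have "norm (x - s *\<^sub>R q) ^ 2 \<le> ((1 + norm q) * norm (w - (q, 1))) ^ 2" by (intro power_mono) auto
  then have 2: "(x - s *\<^sub>R q) \<bullet> (x - s *\<^sub>R q) \<le> (1 + norm q)^2 * ((w - (q, 1)) \<bullet> (w - (q, 1)))"
    by (simp add: power_mult_distrib dot_square_norm)
  have "(d - q, - ((d - q) \<bullet> q)) \<bullet> (w - (q, 1)) = (d - q) \<bullet> (x - s *\<^sub>R q)"
    by (simp add: xs inner_diff_right algebra_simps)
  then show "(d - q, - ((d - q) \<bullet> q)) \<bullet> (w - (q, 1)) \<le> (1 + norm q)^2 * ((w - (q, 1)) \<bullet> (w - (q, 1)))"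
    using 1 2 by simp
qed (use assms in auto)

section \<open>Coordinates on space-time\<close>

locale o_minimal_coordinates = o_minimal_structure S
  for S :: "nat \<Rightarrow> real list set set" +
  fixes e :: "nat \<Rightarrow> 'n::finite"
  assumes bij_e: "bij_betw e {..<CARD('n)} UNIV"
begin

definition N :: nat where "N = Suc CARD('n)"

text \<open>Time is coordinate 0 and space follows in the order of \<open>e\<close>. This is the
  layout of \<open>definable_multimap\<close>, so \<open>enc\<close> maps the space-time graph onto
  the set assumed definable.\<close>

definition comp :: "(real ^ 'n) \<times> real \<Rightarrow> nat \<Rightarrow> real" where
  "comp v j = (case j of 0 \<Rightarrow> snd v | Suc i \<Rightarrow> fst v $ e i)"

definition enc :: "(real ^ 'n) \<times> real \<Rightarrow> real list" where
  "enc v = map (comp v) [0..<N]"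

definition dec :: "real list \<Rightarrow> (real ^ 'n) \<times> real" where
  "dec ys = (\<chi> i. ys ! Suc (the_inv_into {..<CARD('n)} e i), ys ! 0)"

lemma comp_dec: "j < N \<Longrightarrow> comp (dec ys) j = ys ! j"
  using bij_e by (auto simp: comp_def dec_def N_def the_inv_into_f_f bij_betw_def split: nat.splits)

lemma enc_dec: "length ys = N \<Longrightarrow> enc (dec ys) = ys"
  by (intro nth_equalityI) (auto simp: enc_def comp_dec)

lemma dec_enc: "dec (enc v) = v"
proof -
  have *: "the_inv_into {..<CARD('n)} e i < CARD('n)" "e (the_inv_into {..<CARD('n)} e i) = i" for i
    using bij_e the_inv_into_into[of e "{..<CARD('n)}" i] f_the_inv_into_f[of e "{..<CARD('n)}" i]
    by (auto simp: bij_betw_def)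
  have "fst (dec (enc v)) $ i = fst v $ i" for i
    using *[of i] by (simp add: dec_def enc_def N_def comp_def del: upt_Suc)
  then show ?thesis
    by (intro prod_eqI vec_eq_iff[THEN iffD2]) (auto simp: dec_def enc_def N_def comp_def simp del: upt_Suc)
qed

lemma length_enc: "length (enc v) = N"
  by (simp add: enc_def)

lemma inner_comp: "v \<bullet> w = (\<Sum>j<N. comp v j * comp w j)"
proof -
  have "fst v \<bullet> fst w = (\<Sum>j<CARD('n). fst v $ e j * fst w $ e j)"
    unfolding inner_vec_def using sum.reindex_bij_betw[OF bij_e, of "\<lambda>i. fst v $ i * fst w $ i"] by simp
  then show ?thesis
    by (simp add: N_def sum.lessThan_Suc_shift comp_def inner_prod_def del: sum.lessThan_Suc)
qed

lemma comp_add: "comp (v + w) j = comp v j + comp w j"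
  by (simp add: comp_def split: nat.splits)

lemma comp_diff: "comp (v - w) j = comp v j - comp w j"
  by (simp add: comp_def split: nat.splits)

lemma comp_scaleR: "comp (c *\<^sub>R v) j = c * comp v j"
  by (simp add: comp_def split: nat.splits)

lemma comp_le_norm: "\<bar>comp v j\<bar> \<le> norm v"
proof (cases j)
  case 0
  then show ?thesis using norm_snd_le[of "snd v" "fst v"] by (simp add: comp_def)
next
  case (Suc i)
  then show ?thesis using component_le_norm_cart[of "fst v" "e i"] norm_fst_le[of "fst v" "snd v"] by (simp add: comp_def)
qed

lemma norm_le_comp:
  fixes c :: real
  assumes "\<And>j. j < N \<Longrightarrow> \<bar>comp v j\<bar> \<le> c"
  shows "norm v \<le> N * c"
proof -
  have c: "c \<ge> 0" using assms[of 0] by (simp add: N_def)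
  have "norm v ^ 2 = (\<Sum>j<N. (comp v j)^2)"
    using inner_comp[of v v] by (simp add: dot_square_norm power2_eq_square)
  also have "\<dots> \<le> (\<Sum>j<N. c^2)" using assms by (intro sum_mono) (metis abs_le_square_iff abs_of_nonneg c lessThan_iff)
  also have "\<dots> = N * c^2" by simp
  also have "\<dots> \<le> (N * c)^2"
  proof -
    have "real N \<le> (real N)^2" by (simp add: N_def power2_eq_square)
    then show ?thesis using mult_right_mono[of "real N" "(real N)^2" "c^2"] by (simp add: power_mult_distrib)
  qed
  finally show ?thesis using c by (simp add: power2_le_iff_abs_le)
qed

definition dvec :: "nat \<Rightarrow> (real list \<Rightarrow> (real ^ 'n) \<times> real) \<Rightarrow> bool" where
  "dvec m F \<longleftrightarrow> (\<forall>j<N. dfun m (\<lambda>xs. comp (F xs) j))"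

lemma dvec_const: "dvec m (\<lambda>_. v)"
  by (auto simp: dvec_def intro: dfun_const)

lemma dvec_diff: "dvec m F \<Longrightarrow> dvec m G \<Longrightarrow> dvec m (\<lambda>xs. F xs - G xs)"
  by (auto simp: dvec_def comp_diff intro: dfun_diff)

lemma dvec_scaleR: "dfun m f \<Longrightarrow> dvec m G \<Longrightarrow> dvec m (\<lambda>xs. f xs *\<^sub>R G xs)"
  by (auto simp: dvec_def comp_scaleR intro: dfun_mult)

lemma dvec_take: "dvec m F \<Longrightarrow> m \<le> k \<Longrightarrow> dvec k (\<lambda>xs. F (take m xs))"
  by (auto simp: dvec_def intro: dfun_take)

lemma dvec_dec_drop: "dvec (m + N) (\<lambda>xs. dec (drop m xs))"
proof -
  have "dfun (m + N) (\<lambda>xs. comp (dec (drop m xs)) j)" if "j < N" for j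
    by (rule dfun_eqI[OF dfun_var[of "m + j"]]) (use that in \<open>auto simp: comp_dec\<close>)
  then show ?thesis by (simp add: dvec_def)
qed

lemma dfun_inner: "dvec m F \<Longrightarrow> dvec m G \<Longrightarrow> dfun m (\<lambda>xs. F xs \<bullet> G xs)"
  unfolding inner_comp by (intro dfun_sum dfun_mult) (auto simp: dvec_def)

lemma dfn_mem:
  assumes "enc ` K \<in> S N" "dvec m F"
  shows "dfn m (\<lambda>xs. F xs \<in> K)"
proof -
  have "enc ` K = {ys. length ys = N \<and> dec ys \<in> K}"
  proof (intro set_eqI iffI)
    fix ys assume "ys \<in> {ys. length ys = N \<and> dec ys \<in> K}"
    then show "ys \<in> enc ` K" by (intro image_eqI[of _ _ "dec ys"]) (auto simp: enc_dec)
  qed (auto simp: length_enc dec_enc)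
  then have "dfn N (\<lambda>ys. dec ys \<in> K)" using assms(1) by (simp add: dfn_def)
  from dfn_subst[OF this, of m "\<lambda>j xs. comp (F xs) j"] assms(2)
  have "dfn m (\<lambda>xs. dec (enc (F xs)) \<in> K)" by (simp add: dvec_def enc_def)
  then show ?thesis by (simp add: dec_enc)
qed

lemma dfn_ex_vec:
  assumes "dfn (m + N) (\<lambda>xs. P (take m xs) (dec (drop m xs)))"
  shows "dfn m (\<lambda>xs. \<exists>v. P xs v)"
proof (rule dfn_eqI[OF dfn_ex_list[OF assms]])
  fix xs :: "real list" assume "length xs = m"
  then show "(\<exists>ys. length ys = N \<and> P (take m (xs @ ys)) (dec (drop m (xs @ ys)))) = (\<exists>v. P xs v)"
    by (auto simp del: split_paired_Ex) (metis length_enc dec_enc)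
qed

lemma dfn_all_vec:
  assumes "dfn (m + N) (\<lambda>xs. P (take m xs) (dec (drop m xs)))"
  shows "dfn m (\<lambda>xs. \<forall>v. P xs v)"
  using dfn_neg[OF dfn_ex_vec[OF dfn_neg[OF assms]]] by simp

lemma dfn_proximal_normal:
  assumes K: "enc ` K \<in> S N" and F: "dvec m F" "dvec m G"
  shows "dfn m (\<lambda>xs. proximal_normal K (F xs) (G xs))"
proof -
  \<comment> \<open>Order of the variables: m parameters, then \<open>\<sigma>\<close> at index m,
    then the N coordinates of w.\<close>
  have v: "dvec (Suc m + N) (\<lambda>xs. F (take m (take (Suc m) xs)))" "dvec (Suc m + N) (\<lambda>xs. G (take m (take (Suc m) xs)))"
    "dvec (Suc m + N) (\<lambda>xs. dec (drop (Suc m) xs))"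
    by (intro dvec_take[of "Suc m"] dvec_take[of m] F dvec_dec_drop; simp)+
  have s: "dfun (Suc m + N) (\<lambda>xs. take (Suc m) xs ! m)"
    by (rule dfun_take[OF dfun_var]) auto
  have "dfn m (\<lambda>xs. F xs \<in> K \<and> (\<exists>\<sigma>. \<forall>w. w \<in> K \<longrightarrow> G xs \<bullet> (w - F xs) \<le> \<sigma> * ((w - F xs) \<bullet> (w - F xs))))"
    by (intro dfn_conj dfn_mem[OF K] F dfn_ex_real dfn_all_vec dfn_imp dfn_le dfun_mult dfun_inner dvec_diff v s)
  then show ?thesis by (simp add: proximal_normal_def Ball_def)
qed

end

section \<open>Directional limits of normals\<close>

context o_minimal_coordinates
begin

text \<open>By \<open>freq\<close> the relation can be satisfied for arbitrarily small s, hence for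
  all small s, since a definable property does not oscillate. The components of a definable
  selection obey the linear estimate of \<open>dfun1_lipschitz_at_0\<close>; passing from components
  to the norm costs the factor N.\<close>

lemma definable_curve_selection:
  assumes P: "dfn (Suc N) (\<lambda>xs. P (xs ! 0) (dec (drop 1 xs)))"
    and lin: "\<And>s y. P s y \<Longrightarrow> 0 < s \<and> s < 1 \<and> norm (y - z - s *\<^sub>R u) \<le> \<epsilon> * s"
    and "\<epsilon> \<ge> 0"
    and freq: "\<And>\<delta>. \<delta> > 0 \<Longrightarrow> \<exists>s y. s < \<delta> \<and> P s y"
  shows "\<exists>\<delta>>0. \<exists>y. (\<forall>s\<in>{0<..<\<delta>}. P s (y s)) \<and>
    (\<forall>s\<in>{0<..<\<delta>}. \<forall>t\<in>{0<..<\<delta>}. norm (y t - y s) \<le> N * (norm u + \<epsilon> + 1) * \<bar>t - s\<bar>)"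
proof -
  \<comment> \<open>Definable choice needs bounded fibres; the estimate \<open>lin\<close> together
    with s < 1 provides the bound.\<close>
  define B where "B = norm z + norm u + \<epsilon>"
  have bd: "norm y \<le> B" if "P s y" for s y
  proof -
    have s: "0 < s" "s < 1" "norm (y - z - s *\<^sub>R u) \<le> \<epsilon> * s" using lin[OF that] by auto
    have "norm y \<le> norm (y - z - s *\<^sub>R u) + norm (z + s *\<^sub>R u)"
      using norm_triangle_ineq[of "y - z - s *\<^sub>R u" "z + s *\<^sub>R u"] by simp
    also have "norm (z + s *\<^sub>R u) \<le> norm z + s * norm u"
      using norm_triangle_ineq[of z "s *\<^sub>R u"] s(1) by simp
    also have "s * norm u \<le> norm u" using s by (intro mult_left_le_one_le) auto
    also have "norm (y - z - s *\<^sub>R u) \<le> \<epsilon>"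
      using s(3) mult_left_le[of s \<epsilon>] s(2) \<open>\<epsilon> \<ge> 0\<close> by linarith
    finally show ?thesis by (simp add: B_def)
  qed
  \<comment> \<open>The length is part of the predicate because choice also has to bound entries of
    lists of unspecified length.\<close>
  define Q where "Q xs \<longleftrightarrow> length xs = Suc N \<and> P (xs ! 0) (dec (drop 1 xs))" for xs
  have Q: "dfn (Suc N) Q" by (rule dfn_eqI[OF P]) (auto simp: Q_def)
  have Qb: "\<bar>y\<bar> \<le> B" if q: "Q (s # ys)" "y \<in> set ys" for s ys y
  proof -
    have l: "length ys = N" and p: "P s (dec ys)" using q(1) by (auto simp: Q_def)
    obtain j where "j < N" "y = ys ! j" using q(2) l by (auto simp: in_set_conv_nth)
    then show ?thesis using comp_le_norm[of "dec ys" j] bd[OF p] comp_dec[of j ys] by simp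
  qed
  have "\<exists>f. (\<forall>i<N. dfun1 (f i)) \<and>
    (\<forall>s. (\<exists>ys. length ys = N \<and> Q (s # ys)) \<longrightarrow> Q (s # map (\<lambda>i. f i s) [0..<N]))"
    by (rule definable_choice[OF Q]) (erule (1) Qb)
  then obtain f where f: "\<And>i. i < N \<Longrightarrow> dfun1 (f i)"
    "\<And>s. (\<exists>ys. length ys = N \<and> Q (s # ys)) \<Longrightarrow> Q (s # map (\<lambda>i. f i s) [0..<N])" by blast
  define y where "y s = dec (map (\<lambda>i. f i s) [0..<N])" for s
  have comp_y: "comp (y s) j = f j s" if "j < N" for s j using that by (simp add: y_def comp_dec)
  have Py: "P s (y s)" if ex: "\<exists>v. P s v" for s
  proof -
    obtain v where "P s v" using ex by blast
    then have "Q (s # enc v)" by (simp add: Q_def length_enc dec_enc)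
    then have "Q (s # map (\<lambda>i. f i s) [0..<N])" using f(2) length_enc by blast
    then show ?thesis by (simp add: Q_def y_def)
  qed
  have "dfn (Suc 0) (\<lambda>xs. \<exists>v. P (xs ! 0) v)"
  proof (rule dfn_ex_vec)
    show "dfn (Suc 0 + N) (\<lambda>xs. P (take (Suc 0) xs ! 0) (dec (drop (Suc 0) xs)))"
      using P by simp
  qed
  from dfn1_eventually_right[OF this, of 0]
  have "\<forall>\<^sub>F s in at_right 0. \<exists>v. P s v"
  proof
    assume "\<forall>\<^sub>F s in at_right 0. \<nexists>v. P s v"
    then obtain b where b: "b > 0" "\<And>s. s > 0 \<Longrightarrow> s < b \<Longrightarrow> \<nexists>v. P s v"
      unfolding eventually_at_right_field by blast
    then show ?thesis using freq[OF b(1)] lin by blast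
  qed
  then obtain \<delta>0 where \<delta>0: "\<delta>0 > 0" "\<And>s. s > 0 \<Longrightarrow> s < \<delta>0 \<Longrightarrow> \<exists>v. P s v"
    unfolding eventually_at_right_field by blast
  have "\<exists>\<delta>>0. \<forall>s\<in>{0<..<\<delta>}. \<forall>t\<in>{0<..<\<delta>}. \<bar>f j t - f j s\<bar> \<le> (norm u + \<epsilon> + 1) * \<bar>t - s\<bar>" if j: "j < N" for j
  proof -
    have "\<bar>f j s - comp z j - s * comp u j\<bar> \<le> \<epsilon> * s" if "s \<in> {0<..<\<delta>0}" for s
    proof -
      have "P s (y s)" using that by (intro Py \<delta>0) auto
      then show ?thesis
        using comp_le_norm[of "y s - z - s *\<^sub>R u" j] lin[of s "y s"] comp_y[OF j, of s]
        by (simp add: comp_diff comp_scaleR)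
    qed
    from dfun1_lipschitz_at_0[OF f(1)[OF j] \<delta>0(1) \<open>\<epsilon> \<ge> 0\<close> this]
    obtain \<delta> where d: "\<delta> > 0" "\<And>s t. s \<in> {0<..<\<delta>} \<Longrightarrow> t \<in> {0<..<\<delta>} \<Longrightarrow>
       \<bar>f j t - f j s\<bar> \<le> (\<bar>comp u j\<bar> + \<epsilon> + 1) * \<bar>t - s\<bar>" by blast
    have "(\<bar>comp u j\<bar> + \<epsilon> + 1) * \<bar>t - s\<bar> \<le> (norm u + \<epsilon> + 1) * \<bar>t - s\<bar>" for s t
      using comp_le_norm[of u j] by (intro mult_right_mono) auto
    then show ?thesis using d by (meson order_trans)
  qed
  then obtain D where D: "\<And>j. j < N \<Longrightarrow> D j > 0" "\<And>j s t. j < N \<Longrightarrow> s \<in> {0<..<D j} \<Longrightarrow> t \<in> {0<..<D j} \<Longrightarrow>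
       \<bar>f j t - f j s\<bar> \<le> (norm u + \<epsilon> + 1) * \<bar>t - s\<bar>" by metis
  define \<delta> where "\<delta> = Min (insert \<delta>0 (D ` {..<N}))"
  have \<delta>: "\<delta> > 0" "\<delta> \<le> \<delta>0" "\<And>j. j < N \<Longrightarrow> \<delta> \<le> D j"
    using D(1) \<delta>0(1) by (auto simp: \<delta>_def)
  show ?thesis
  proof (intro exI[of _ \<delta>] conjI exI[of _ y] ballI)
    fix s assume "s \<in> {0<..<\<delta>}"
    then show "P s (y s)" using \<delta> by (intro Py \<delta>0) auto
  next
    fix s t assume st: "s \<in> {0<..<\<delta>}" "t \<in> {0<..<\<delta>}"
    have "\<bar>comp (y t - y s) j\<bar> \<le> (norm u + \<epsilon> + 1) * \<bar>t - s\<bar>" if j: "j < N" for j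
    proof -
      have "\<bar>f j t - f j s\<bar> \<le> (norm u + \<epsilon> + 1) * \<bar>t - s\<bar>"
        using st \<delta>(3)[OF j] by (intro D(2) j) auto
      then show ?thesis by (simp add: comp_diff comp_y[OF j])
    qed
    from norm_le_comp[OF this]
    show "norm (y t - y s) \<le> N * (norm u + \<epsilon> + 1) * \<bar>t - s\<bar>" by (simp add: mult.assoc)
  qed (rule \<delta>)
qed

text \<open>
  Curve selection produces a Lipschitz curve in \<open>K\<close> from \<open>z\<close> in direction \<open>u\<close> that carries normals
  near \<open>\<nu>\<close>; moving along a curve in \<open>K\<close> to first order orthogonally to its normals keeps
  \<open>\<nu> \<bullet> y\<close> almost from growing.
\<close>

lemma proximal_normal_directional_limit:
  assumes K: "enc ` K \<in> S N"
    and zk: "\<And>k::nat. proximal_normal K (zk k) (\<nu>k k)" and \<nu>k: "\<nu>k \<longlonglongrightarrow> \<nu>"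
    and s: "\<And>k. snd (zk k) - snd z > 0" "(\<lambda>k. snd (zk k) - snd z) \<longlonglongrightarrow> 0"
    and dir: "(\<lambda>k. (zk k - z) /\<^sub>R (snd (zk k) - snd z)) \<longlonglongrightarrow> u"
  shows "\<nu> \<bullet> u \<le> 0"
proof -
  \<comment> \<open>Collects the errors below: 1 + M from the slope in \<open>\<phi>\<close>, and
    the norm of \<nu> from replacing the curve at time b by its tangent line.\<close>
  define C where "C = 1 + N * (norm u + 2) + norm \<nu>"
  have "\<nu> \<bullet> u \<le> C * \<epsilon>" if e: "0 < \<epsilon>" "\<epsilon> \<le> 1" for \<epsilon>
  proof -
    \<comment> \<open>Norm bounds are squared to become polynomial conditions. The normal is
      existentially quantified, so only the base point has to be selected as a function of
      s.\<close>
    define P where "P s y \<longleftrightarrow> 0 < s \<and> s < 1 \<and> (y - z - s *\<^sub>R u) \<bullet> (y - z - s *\<^sub>R u) \<le> (\<epsilon> * s) * (\<epsilon> * s) \<and>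
      (\<exists>\<nu>'. (\<nu>' - \<nu>) \<bullet> (\<nu>' - \<nu>) \<le> \<epsilon> * \<epsilon> \<and> proximal_normal K y \<nu>')" for s y
    have norm_le_iff: "v \<bullet> v \<le> c * c \<longleftrightarrow> norm v \<le> c" if "c \<ge> 0" for v :: "(real ^ 'n) \<times> real" and c
      using that by (simp add: dot_square_norm power2_eq_square[symmetric] power2_le_iff_abs_le)
    have P_iff: "P s y \<longleftrightarrow> 0 < s \<and> s < 1 \<and> norm (y - z - s *\<^sub>R u) \<le> \<epsilon> * s \<and>
      (\<exists>\<nu>'. norm (\<nu>' - \<nu>) \<le> \<epsilon> \<and> proximal_normal K y \<nu>')" for s y
      unfolding P_def using e(1) by (cases "0 < s") (simp_all add: norm_le_iff)
    have v: "dvec (Suc N) (\<lambda>xs. dec (drop 1 xs))" using dvec_dec_drop[of "Suc 0"] by simp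
    have v': "dvec (Suc N + N) (\<lambda>xs. dec (drop 1 (take (Suc N) xs)))" by (rule dvec_take[OF v]) simp
    have Pd: "dfn (Suc N) (\<lambda>xs. P (xs ! 0) (dec (drop 1 xs)))"
      unfolding P_def
      by (intro dfn_conj dfn_less dfn_le dfn_ex_vec dfn_proximal_normal[OF K] dfun_const dfun_var
          dfun_mult dfun_inner dvec_diff dvec_scaleR dvec_const v v' dvec_dec_drop) auto
    have freq: "\<exists>s y. s < \<delta> \<and> P s y" if "\<delta> > 0" for \<delta>
    proof -
      have "\<forall>\<^sub>F k in sequentially. snd (zk k) - snd z < min \<delta> 1"
        using that by (intro order_tendstoD(2)[OF s(2)]) auto
      moreover have "\<forall>\<^sub>F k in sequentially. dist (\<nu>k k) \<nu> < \<epsilon>"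
        using tendstoD[OF \<nu>k e(1)] .
      moreover have "\<forall>\<^sub>F k in sequentially. dist ((zk k - z) /\<^sub>R (snd (zk k) - snd z)) u < \<epsilon>"
        using tendstoD[OF dir e(1)] .
      ultimately have "\<forall>\<^sub>F k in sequentially. \<exists>s y. s < \<delta> \<and> P s y"
      proof eventually_elim
        case (elim k)
        let ?s = "snd (zk k) - snd z"
        have sp: "?s > 0" using s(1) .
        have "zk k - z - ?s *\<^sub>R u = ?s *\<^sub>R ((zk k - z) /\<^sub>R ?s - u)"
          using sp by (simp add: scaleR_diff_right)
        then have "norm (zk k - z - ?s *\<^sub>R u) = ?s * norm ((zk k - z) /\<^sub>R ?s - u)" using sp by simp
        also have "\<dots> \<le> ?s * \<epsilon>" using elim(3) sp by (intro mult_left_mono) (auto simp: dist_norm)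
        finally have "norm (zk k - z - ?s *\<^sub>R u) \<le> \<epsilon> * ?s" by (simp add: mult.commute)
        moreover have "norm (\<nu>k k - \<nu>) \<le> \<epsilon>" using elim(2) by (simp add: dist_norm)
        ultimately have "P ?s (zk k)"
          unfolding P_iff using sp elim(1) zk[of k] by (intro conjI exI[of _ "\<nu>k k"]) auto
        moreover have "?s < \<delta>" using elim(1) by simp
        ultimately show ?case by blast
      qed
      then show ?thesis using eventually_happens'[OF sequentially_bot] by blast
    qed
    obtain \<delta> y where \<delta>: "\<delta> > 0" and Py: "\<And>s. s \<in> {0<..<\<delta>} \<Longrightarrow> P s (y s)"
      and lip: "\<And>s t. s \<in> {0<..<\<delta>} \<Longrightarrow> t \<in> {0<..<\<delta>} \<Longrightarrow> norm (y t - y s) \<le> N * (norm u + \<epsilon> + 1) * \<bar>t - s\<bar>"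
    proof -
      have "0 < s \<and> s < 1 \<and> norm (y - z - s *\<^sub>R u) \<le> \<epsilon> * s" if "P s y" for s y
        using that unfolding P_iff by blast
      from definable_curve_selection[OF Pd this less_imp_le[OF e(1)] freq] show ?thesis
        using that by blast
    qed
    define M where "M = N * (norm u + 2)"
    have M: "M \<ge> 0" by (simp add: M_def)
    have lip': "norm (y t - y s) \<le> M * \<bar>t - s\<bar>" if "s \<in> {0<..<\<delta>}" "t \<in> {0<..<\<delta>}" for s t
    proof -
      have "N * (norm u + \<epsilon> + 1) * \<bar>t - s\<bar> \<le> M * \<bar>t - s\<bar>" unfolding M_def
        using e by (intro mult_right_mono mult_left_mono) auto
      then show ?thesis using lip[OF that] by linarith
    qed
    \<comment> \<open>Over a short step, the quadratic term of the proximal inequality costs at most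
      \<epsilon> per unit of time, and replacing the actual normal by \<nu> costs \<epsilon> *
      M.\<close>
    define \<phi> where "\<phi> s = \<nu> \<bullet> y s - (\<epsilon> * (1 + M)) * s" for s
    have mono: "\<phi> b \<le> \<phi> a" if ab: "0 < a" "a \<le> b" "b < \<delta>" for a b
    proof (rule antimono_of_local_right[OF ab(2)])
      have "M-lipschitz_on {a..b} y"
        using lip' ab M by (intro lipschitz_onI) (auto simp: dist_norm dist_real_def)
      then have "continuous_on {a..b} y" by (rule lipschitz_on_continuous_on)
      then show "continuous_on {a..b} \<phi>" unfolding \<phi>_def by (intro continuous_intros)
      fix r assume r: "a \<le> r" "r < b"
      then have rd: "r \<in> {0<..<\<delta>}" using ab by auto
      obtain \<nu>' \<sigma> where \<nu>': "norm (\<nu>' - \<nu>) \<le> \<epsilon>" "\<And>w. w \<in> K \<Longrightarrow> \<nu>' \<bullet> (w - y r) \<le> \<sigma> * ((w - y r) \<bullet> (w - y r))"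
        using Py[OF rd] unfolding P_iff proximal_normal_def by blast
      \<comment> \<open>The constant \<sigma> at the point y r is not bounded uniformly in r, so the
        step must depend on r; a condition local on the right is all that
        \<open>antimono_of_local_right\<close> asks for.\<close>
      define \<eta> where "\<eta> = min (b - r) (\<epsilon> / (\<bar>\<sigma>\<bar> * M^2 + 1))"
      have "\<phi> r' \<le> \<phi> r" if r': "r < r'" "r' < r + \<eta>" for r'
      proof -
        have r'd: "r' \<in> {0<..<\<delta>}" and h: "r' - r > 0" using r r' ab by (auto simp: \<eta>_def)
        have yK: "y r' \<in> K" using Py[OF r'd] unfolding P_iff proximal_normal_def by blast
        let ?v = "y r' - y r"
        have nv: "norm ?v \<le> M * (r' - r)" using lip'[OF rd r'd] h by simp
        then have "norm ?v ^ 2 \<le> (M * (r' - r))^2" by (intro power_mono) auto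
        then have "?v \<bullet> ?v \<le> M^2 * (r' - r)^2" by (simp add: dot_square_norm power_mult_distrib)
        then have "\<bar>\<sigma>\<bar> * (?v \<bullet> ?v) \<le> \<bar>\<sigma>\<bar> * (M^2 * (r' - r)^2)" by (intro mult_left_mono) auto
        also have "\<dots> = (\<bar>\<sigma>\<bar> * M^2 * (r' - r)) * (r' - r)" by (simp add: power2_eq_square)
        also have "\<dots> \<le> \<epsilon> * (r' - r)"
        proof (rule mult_right_mono)
          have pos: "\<bar>\<sigma>\<bar> * M^2 + 1 > 0" by (simp add: add_nonneg_pos)
          have "r' - r \<le> \<epsilon> / (\<bar>\<sigma>\<bar> * M^2 + 1)" using r' by (simp add: \<eta>_def)
          then have "(r' - r) * (\<bar>\<sigma>\<bar> * M^2 + 1) \<le> \<epsilon>" using pos by (simp add: pos_le_divide_eq)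
          then show "\<bar>\<sigma>\<bar> * M^2 * (r' - r) \<le> \<epsilon>" using h by (simp add: algebra_simps)
        qed (use h in auto)
        finally have 1: "\<bar>\<sigma>\<bar> * (?v \<bullet> ?v) \<le> \<epsilon> * (r' - r)" .
        have "\<sigma> * (?v \<bullet> ?v) \<le> \<bar>\<sigma>\<bar> * (?v \<bullet> ?v)" by (intro mult_right_mono) auto
        then have 2: "\<nu>' \<bullet> ?v \<le> \<epsilon> * (r' - r)" using 1 \<nu>'(2)[OF yK] by linarith
        have "\<bar>(\<nu>' - \<nu>) \<bullet> ?v\<bar> \<le> norm (\<nu>' - \<nu>) * norm ?v" by (rule Cauchy_Schwarz_ineq2)
        also have "\<dots> \<le> \<epsilon> * (M * (r' - r))" using \<nu>'(1) nv e by (intro mult_mono) auto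
        finally have "\<nu> \<bullet> ?v \<le> \<epsilon> * (r' - r) + \<epsilon> * (M * (r' - r))"
          using 2 by (simp add: inner_diff_left abs_le_iff)
        then show ?thesis by (simp add: \<phi>_def inner_diff_right algebra_simps)
      qed
      moreover have "\<eta> > 0" using r e by (simp add: \<eta>_def add_nonneg_pos)
      ultimately show "\<forall>\<^sub>F r' in at_right r. \<phi> r' \<le> \<phi> r"
        unfolding eventually_at_right_field by (intro exI[of _ "r + \<eta>"]) auto
    qed
    define b where "b = \<delta> / 2"
    have b: "b \<in> {0<..<\<delta>}" using \<delta> by (simp add: b_def)
    have near: "\<bar>\<nu> \<bullet> y s - \<nu> \<bullet> z - s * (\<nu> \<bullet> u)\<bar> \<le> norm \<nu> * (\<epsilon> * s)" if "s \<in> {0<..<\<delta>}" for s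
    proof -
      have "\<bar>\<nu> \<bullet> (y s - z - s *\<^sub>R u)\<bar> \<le> norm \<nu> * norm (y s - z - s *\<^sub>R u)" by (rule Cauchy_Schwarz_ineq2)
      also have "\<dots> \<le> norm \<nu> * (\<epsilon> * s)" using Py[OF that] unfolding P_iff by (intro mult_left_mono) auto
      finally show ?thesis by (simp add: inner_diff_right)
    qed
    \<comment> \<open>Moving the left end of the interval to 0 compares time b with the point z
      itself; division by b then gives the estimate.\<close>
    have "\<phi> b \<le> \<nu> \<bullet> z"
    proof (rule tendsto_lowerbound)
      let ?g = "\<lambda>s. \<nu> \<bullet> z + s * (\<nu> \<bullet> u) + norm \<nu> * (\<epsilon> * s)"
      have "((\<lambda>s. ?g s) \<longlongrightarrow> ?g 0) (at_right 0)" by (intro tendsto_intros)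
      then show "(?g \<longlongrightarrow> \<nu> \<bullet> z) (at_right 0)" by simp
      have "\<phi> b \<le> ?g s" if "0 < s" "s < b" for s
      proof -
        have "\<phi> b \<le> \<phi> s" using that b by (intro mono) auto
        also have "\<dots> \<le> \<nu> \<bullet> y s" using that e M by (simp add: \<phi>_def)
        also have "\<dots> \<le> ?g s" using near[of s] that b by (simp add: abs_le_iff)
        finally show ?thesis .
      qed
      then show "\<forall>\<^sub>F s in at_right 0. \<phi> b \<le> ?g s"
        unfolding eventually_at_right_field using b by (intro exI[of _ b]) auto
    qed simp
    then have "b * (\<nu> \<bullet> u) \<le> norm \<nu> * (\<epsilon> * b) + \<epsilon> * (1 + M) * b"
      using near[OF b] by (simp add: \<phi>_def abs_le_iff)
    then have "b * (\<nu> \<bullet> u) \<le> b * (C * \<epsilon>)" by (simp add: C_def M_def algebra_simps)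
    then show ?thesis using b by simp
  qed
  note * = this
  have C: "C > 0" unfolding C_def by (simp add: add_pos_nonneg)
  show ?thesis
  proof (rule field_le_epsilon)
    fix \<epsilon> :: real assume "\<epsilon> > 0"
    then have "0 < min 1 (\<epsilon> / C)" "min 1 (\<epsilon> / C) \<le> 1" using C by auto
    from *[OF this] have "\<nu> \<bullet> u \<le> C * min 1 (\<epsilon> / C)" .
    also have "\<dots> \<le> C * (\<epsilon> / C)" using C by (intro mult_left_mono) auto
    finally show "\<nu> \<bullet> u \<le> 0 + \<epsilon>" using C by simp
  qed
qed

text \<open>Each projection is replaced by a proximal normal at a point within h k / (k + 1) of
  \<open>zk k\<close>. This error is negligible relative to h k, so the direction of approach is
  still (v, 1), and pairing it with the limit normal gives the claim.\<close>

lemma tangent_proj_directional_limit: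
  assumes K: "enc ` K \<in> S N" "closed K"
    and g: "\<And>k::nat. (dk k, zk k, (qk k, 1)) \<in> tangent_proj_graph K"
    and lim: "dk \<longlonglongrightarrow> D" "qk \<longlonglongrightarrow> q"
    and h: "\<And>k. h k > 0" "h \<longlonglongrightarrow> 0" "(\<lambda>k. (zk k - (x, t)) /\<^sub>R h k) \<longlonglongrightarrow> (v, 1)"
  shows "(D - q) \<bullet> (v - q) \<le> 0"
proof -
  define \<epsilon> where "\<epsilon> k = h k / real (Suc k)" for k
  have \<epsilon>: "\<epsilon> k > 0" for k using h(1) by (simp add: \<epsilon>_def)
  define \<nu> where "\<nu> k = (dk k - qk k, - ((dk k - qk k) \<bullet> qk k))" for k
  have "\<exists>z' \<nu>'. proximal_normal K z' \<nu>' \<and> norm (z' - zk k) < \<epsilon> k \<and> norm (\<nu>' - \<nu> k) < \<epsilon> k" for k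
    unfolding \<nu>_def by (rule tangent_proj_normal[OF K(2) g \<epsilon>])
  then obtain z' \<nu>' where p: "\<And>k. proximal_normal K (z' k) (\<nu>' k)"
    and z': "\<And>k. norm (z' k - zk k) < \<epsilon> k" and \<nu>': "\<And>k. norm (\<nu>' k - \<nu> k) < \<epsilon> k" by metis
  have e1: "(\<lambda>k. \<epsilon> k / h k) \<longlonglongrightarrow> 0"
    using LIMSEQ_inverse_real_of_nat h(1) by (simp add: \<epsilon>_def inverse_eq_divide less_imp_neq[symmetric])
  have "(\<lambda>k. h k * (\<epsilon> k / h k)) \<longlonglongrightarrow> 0" using tendsto_mult[OF h(2) e1] by simp
  then have e0: "\<epsilon> \<longlonglongrightarrow> 0" using h(1) by (simp add: less_imp_neq[symmetric])
  have "(\<lambda>k. \<nu>' k - \<nu> k) \<longlonglongrightarrow> 0"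
    by (rule Lim_null_comparison[OF _ e0]) (intro always_eventually allI less_imp_le \<nu>')
  moreover have "\<nu> \<longlonglongrightarrow> (D - q, - ((D - q) \<bullet> q))"
    unfolding \<nu>_def using lim by (intro tendsto_intros)
  ultimately have "(\<lambda>k. (\<nu>' k - \<nu> k) + \<nu> k) \<longlonglongrightarrow> 0 + (D - q, - ((D - q) \<bullet> q))" by (rule tendsto_add)
  then have \<nu>lim: "\<nu>' \<longlonglongrightarrow> (D - q, - ((D - q) \<bullet> q))" by simp
  have "(\<lambda>k. (z' k - zk k) /\<^sub>R h k) \<longlonglongrightarrow> 0"
  proof (rule Lim_null_comparison[OF _ e1])
    show "\<forall>\<^sub>F k in sequentially. norm ((z' k - zk k) /\<^sub>R h k) \<le> \<epsilon> k / h k"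
      using z' h(1) by (intro always_eventually allI) (simp add: divide_inverse_commute mult_left_mono less_imp_le)
  qed
  moreover have "(a - b) /\<^sub>R c + (b - w) /\<^sub>R c = (a - w) /\<^sub>R c" for a b w :: "(real ^ 'n) \<times> real" and c
    by (simp add: scaleR_add_right[symmetric])
  ultimately have dir: "(\<lambda>k. (z' k - (x, t)) /\<^sub>R h k) \<longlonglongrightarrow> (v, 1)"
    using tendsto_add[OF _ h(3), of "\<lambda>k. (z' k - zk k) /\<^sub>R h k" 0] by (simp only: add_0_left)
  from tendsto_snd[OF this] have s1: "(\<lambda>k. (snd (z' k) - t) / h k) \<longlonglongrightarrow> 1"
    by (simp add: divide_inverse_commute)
  then have "\<forall>\<^sub>F k in sequentially. (snd (z' k) - t) / h k > 0" by (intro order_tendstoD(1)) auto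
  then obtain k0 where k0: "\<And>k. k \<ge> k0 \<Longrightarrow> (snd (z' k) - t) / h k > 0"
    unfolding eventually_sequentially by blast
  \<comment> \<open>The displaced points may precede time t for small k; the sequence is started at
    k0, where this no longer occurs.\<close>
  have pos: "snd (z' (k + k0)) - t > 0" for k using k0[of "k + k0"] h(1)[of "k + k0"] by (simp add: zero_less_divide_iff)
  have "(\<lambda>k. (snd (z' k) - t) / h k * h k) \<longlonglongrightarrow> 1 * 0" by (intro tendsto_mult s1 h)
  then have s0: "(\<lambda>k. snd (z' k) - t) \<longlonglongrightarrow> 0" using h(1) by (simp add: less_imp_neq[symmetric])
  \<comment> \<open>Quotients by h k become quotients by the true time increments, as
    \<open>proximal_normal_directional_limit\<close> requires; the ratio of the two tends to
    1.\<close>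
  have "(\<lambda>k. inverse ((snd (z' k) - t) / h k) *\<^sub>R ((z' k - (x, t)) /\<^sub>R h k)) \<longlonglongrightarrow> inverse 1 *\<^sub>R (v, 1)"
    by (intro tendsto_scaleR tendsto_inverse s1 dir) simp
  moreover have "inverse ((snd (z' k) - t) / h k) *\<^sub>R ((z' k - (x, t)) /\<^sub>R h k) = (z' k - (x, t)) /\<^sub>R (snd (z' k) - t)" for k
    using h(1)[of k] by (simp add: inverse_eq_divide)
  ultimately have dir': "(\<lambda>k. (z' k - (x, t)) /\<^sub>R (snd (z' k) - t)) \<longlonglongrightarrow> (v, 1)"
    by (simp only: inverse_1 scaleR_one)
  have "(D - q, - ((D - q) \<bullet> q)) \<bullet> (v, 1) \<le> 0"
  proof (rule proximal_normal_directional_limit[OF K(1), of "\<lambda>k. z' (k + k0)" "\<lambda>k. \<nu>' (k + k0)" _ "(x, t)"])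
    show "(\<lambda>k. \<nu>' (k + k0)) \<longlonglongrightarrow> (D - q, - ((D - q) \<bullet> q))" using \<nu>lim by (rule LIMSEQ_ignore_initial_segment)
    show "(\<lambda>k. snd (z' (k + k0)) - snd (x, t)) \<longlonglongrightarrow> 0"
      using LIMSEQ_ignore_initial_segment[OF s0, of k0] by simp
    show "(\<lambda>k. (z' (k + k0) - (x, t)) /\<^sub>R (snd (z' (k + k0)) - snd (x, t))) \<longlonglongrightarrow> (v, 1)"
      using LIMSEQ_ignore_initial_segment[OF dir', of k0] by simp
  qed (use p pos in auto)
  then show ?thesis by (simp add: inner_diff_right)
qed

end

section \<open>Almost everywhere differentiability of Lipschitz curves\<close>

text \<open>
  The image measure under the inverse of a bi-Lipschitz increasing function \<open>F\<close> has measure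
  \<open>F b - F a\<close> on \<open>{a..b}\<close> and is absolutely continuous, so \<open>F\<close> is an indefinite integral.
\<close>

lemma bilipschitz_has_integral:
  fixes F :: "real \<Rightarrow> real"
  assumes low: "\<And>x y. x \<le> y \<Longrightarrow> y - x \<le> F y - F x"
    and up: "\<And>x y. x \<le> y \<Longrightarrow> F y - F x \<le> c * (y - x)"
  shows "\<exists>h. \<forall>a b. a \<le> b \<longrightarrow> (h has_integral (F b - F a)) {a..b}"
proof -
  have up': "\<bar>F y - F x\<bar> \<le> c * \<bar>y - x\<bar>" and low': "\<bar>y - x\<bar> \<le> \<bar>F y - F x\<bar>" for x y
    using up[of x y] up[of y x] low[of x y] low[of y x] by (cases "x \<le> y"; force)+
  have c: "c \<ge> 0" using up[of 0 1] low[of 0 1] by simp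
  have lip: "c-lipschitz_on UNIV F"
    using up' c by (intro lipschitz_onI) (auto simp: dist_real_def abs_minus_commute)
  then have cont: "continuous_on UNIV F" by (rule lipschitz_on_continuous_on)
  have "\<exists>x. F x = y" for y
  proof -
    \<comment> \<open>F grows at least at unit rate, so going this far to either side of 0 brackets
      the value y.\<close>
    define B where "B = \<bar>y\<bar> + \<bar>F 0\<bar>"
    have B: "- B \<le> 0" "0 \<le> B" by (auto simp: B_def)
    have "F (- B) \<le> y"
      using low[OF B(1)] B_def abs_ge_self[of "F 0"] abs_ge_minus_self[of y] by linarith
    moreover have "y \<le> F B"
      using low[OF B(2)] B_def abs_ge_minus_self[of "F 0"] abs_ge_self[of y] by linarith
    ultimately have "\<exists>x. - B \<le> x \<and> x \<le> B \<and> F x = y"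
      using continuous_on_subset[OF cont] by (intro IVT') (auto simp: B_def)
    then show ?thesis by blast
  qed
  then obtain G where FG: "\<And>y. F (G y) = y" by metis
  have inj: "x = y" if "F x = F y" for x y using low'[of y x] that by simp
  have GF: "G (F x) = x" for x using inj FG by blast
  have "1-lipschitz_on UNIV G"
    using low' FG by (intro lipschitz_onI) (auto simp: dist_real_def, metis)
  then have "continuous_on UNIV G" by (rule lipschitz_on_continuous_on)
  then have G: "G \<in> borel_measurable borel" by (rule borel_measurable_continuous_onI)
  have vim: "G -` A = F ` A" for A :: "real set" using FG GF by (auto simp: image_iff) metis
  define \<mu> where "\<mu> = distr lborel borel G"
  have em: "emeasure \<mu> A = emeasure lborel (F ` A)" if "A \<in> sets borel" for A :: "real set"
    using G that by (simp add: \<mu>_def emeasure_distr vim)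
  have "absolutely_continuous lborel \<mu>"
    unfolding absolutely_continuous_def
  proof
    fix A :: "real set" assume A: "A \<in> null_sets lborel"
    then have Ab: "A \<in> sets borel" by auto
    have "negligible A" using A by (simp add: negligible_iff_null_sets null_sets_completionI)
    then have "negligible (F ` A)"
    proof (rule negligible_locally_Lipschitz_image[rotated])
      fix x show "\<exists>T B. open T \<and> x \<in> T \<and> (\<forall>y\<in>A \<inter> T. norm (F y - F x) \<le> B * norm (y - x))"
        using up' by (intro exI[of _ UNIV] exI[of _ c]) auto
    qed simp
    moreover have "F ` A \<in> sets borel" using measurable_sets[OF G Ab] by (simp add: vim)
    ultimately have "F ` A \<in> null_sets lborel"
      by (simp add: negligible_iff_null_sets null_sets_completion_iff)
    then show "A \<in> null_sets \<mu>" using em[OF Ab] Ab by (auto simp: null_sets_def \<mu>_def)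
  qed
  then obtain h where h: "h \<in> borel_measurable lborel" "density lborel h = \<mu>"
    using sigma_finite_measure.Radon_Nikodym[OF lborel.sigma_finite_measure_axioms, of \<mu>] by (auto simp: \<mu>_def)
  have "((\<lambda>x. enn2real (h x)) has_integral (F b - F a)) {a..b}" if ab: "a \<le> b" for a b
  proof -
    have img: "F ` {a..b} = {F a..F b}"
    proof (intro set_eqI iffI)
      fix y assume y: "y \<in> {F a..F b}"
      have "a \<le> G y" using low[of "G y" a] FG[of y] y by (cases "G y \<le> a") auto
      moreover have "G y \<le> b" using low[of b "G y"] FG[of y] y by (cases "b \<le> G y") auto
      ultimately show "y \<in> F ` {a..b}" using FG[of y] by (intro image_eqI[of _ _ "G y"]) auto
    next
      fix y assume "y \<in> F ` {a..b}"
      then obtain x where "y = F x" "a \<le> x" "x \<le> b" by auto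
      then show "y \<in> {F a..F b}" using low[of a x] low[of x b] by auto
    qed
    have Fab: "F a \<le> F b" using low[OF ab] ab by simp
    have "(\<integral>\<^sup>+x. h x * indicator {a..b} x \<partial>lborel) = emeasure \<mu> {a..b}"
      using h(1) by (simp add: h(2)[symmetric] emeasure_density)
    also have "\<dots> = ennreal (F b - F a)" using Fab by (simp add: em img)
    finally have int: "(\<integral>\<^sup>+x. h x * indicator {a..b} x \<partial>lborel) = ennreal (F b - F a)" .
    then have "AE x in lborel. h x * indicator {a..b} x \<noteq> \<infinity>"
      using h(1) by (intro nn_integral_noteq_infinite) auto
    \<comment> \<open>The density may be infinite on a null set, which is the only place where
      \<open>enn2real\<close> alters it.\<close>
    then have "AE x in lborel. ennreal (enn2real (h x) * indicator {a..b} x) = h x * indicator {a..b} x"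
      by eventually_elim (auto simp: indicator_def top.not_eq_extremum)
    then have "(\<integral>\<^sup>+x. ennreal (enn2real (h x) * indicator {a..b} x) \<partial>lborel) = ennreal (F b - F a)"
      using int by (subst nn_integral_cong_AE) auto
    then have "((\<lambda>x. enn2real (h x) * indicator {a..b} x) has_integral (F b - F a)) UNIV"
      using h(1) Fab by (intro nn_integral_has_integral[of _ "F b - F a"]) auto
    moreover have "(\<lambda>x. enn2real (h x) * indicator {a..b} x) = (\<lambda>x. if x \<in> {a..b} then enn2real (h x) else 0)"
      by (auto simp: indicator_def)
    ultimately show ?thesis by (simp only: has_integral_restrict_UNIV)
  qed
  then show ?thesis by blast
qed

text \<open>The differentiation theorem applied here averages over cubes with lower corner x, which
  on the line are the intervals from x to x + k; so only right difference quotients are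
  controlled.\<close>

lemma indefinite_integral_derivative_right:
  fixes h :: "real \<Rightarrow> real"
  assumes h: "\<And>a b. a \<le> b \<Longrightarrow> (h has_integral (F b - F a)) {a..b}"
  obtains N where "negligible N"
    "\<And>x e. x \<notin> N \<Longrightarrow> 0 < e \<Longrightarrow> \<exists>d>0. \<forall>k. 0 < k \<and> k < d \<longrightarrow> \<bar>(F (x + k) - F x) / k - h x\<bar> < e"
proof -
  have "h integrable_on cbox a b" for a b
    using h[of a b] by (cases "a \<le> b") (auto simp: integrable_on_def)
  then obtain N where N: "negligible N"
    "\<And>x e. x \<notin> N \<Longrightarrow> 0 < e \<Longrightarrow> \<exists>d>0. \<forall>k. 0 < k \<and> k < d \<longrightarrow>
       norm (integral (cbox x (x + k *\<^sub>R One)) h /\<^sub>R k ^ DIM(real) - h x) < e"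
    using integrable_ccontinuous_explicit[of h] by metis
  have "integral (cbox x (x + k *\<^sub>R One)) h /\<^sub>R k ^ DIM(real) = (F (x + k) - F x) / k" if "0 < k" for x k
    using integral_unique[OF h[of x "x + k"]] that by (simp add: divide_inverse_commute)
  then show ?thesis using N by (intro that[of N]) fastforce+
qed

text \<open>Adding (L + 1) * x puts all slopes between 1 and 2 * L + 1, so the sum F has a density
  h. Left quotients of F are right quotients of its reflection, whose density is h (- x); off two
  null sets both one-sided derivatives are therefore h t.\<close>

lemma lipschitz_ae_differentiable_real:
  fixes f :: "real \<Rightarrow> real"
  assumes f: "L-lipschitz_on UNIV f"
  obtains N where "negligible N" "\<And>t. t \<notin> N \<Longrightarrow> \<exists>D. (f has_real_derivative D) (at t)"
proof -
  have L: "\<bar>f y - f x\<bar> \<le> L * (y - x)" if "x \<le> y" for x y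
    using lipschitz_onD[OF f, of y x] that by (simp add: dist_real_def)
  define F where "F x = f x + (L + 1) * x" for x
  have "\<exists>h. \<forall>a b. a \<le> b \<longrightarrow> (h has_integral (F b - F a)) {a..b}"
  proof (rule bilipschitz_has_integral)
    show "y - x \<le> F y - F x" if "x \<le> y" for x y
      using L[OF that] by (simp add: F_def algebra_simps abs_le_iff)
    show "F y - F x \<le> (2 * L + 1) * (y - x)" if "x \<le> y" for x y
      using L[OF that] by (simp add: F_def algebra_simps abs_le_iff)
  qed
  then obtain h where h: "\<And>a b. a \<le> b \<Longrightarrow> (h has_integral (F b - F a)) {a..b}" by blast
  obtain N1 where N1: "negligible N1" "\<And>x e. x \<notin> N1 \<Longrightarrow> 0 < e \<Longrightarrow>
      \<exists>d>0. \<forall>k. 0 < k \<and> k < d \<longrightarrow> \<bar>(F (x + k) - F x) / k - h x\<bar> < e"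
    using indefinite_integral_derivative_right[of h F] h by metis
  have "((\<lambda>x. h (- x)) has_integral (- F (- b) - - F (- a))) {a..b}" if "a \<le> b" for a b
    using has_integral_reflect_lemma_real[OF h[of "-b" "-a"]] that by simp
  then obtain N2 where N2: "negligible N2" "\<And>x e. x \<notin> N2 \<Longrightarrow> 0 < e \<Longrightarrow>
      \<exists>d>0. \<forall>k. 0 < k \<and> k < d \<longrightarrow> \<bar>(- F (- (x + k)) - - F (- x)) / k - h (- x)\<bar> < e"
    using indefinite_integral_derivative_right[of "\<lambda>x. h (- x)" "\<lambda>x. - F (- x)"] by metis
  show ?thesis
  proof (rule that[of "N1 \<union> uminus ` N2"])
    show "negligible (N1 \<union> uminus ` N2)"
      using N1(1) N2(1)
      by (intro negligible_Un negligible_differentiable_image_negligible derivative_intros) simp_all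
    fix t assume "t \<notin> N1 \<union> uminus ` N2"
    then have t: "t \<notin> N1" "- t \<notin> N2" by (auto simp: image_iff)
    have "(F has_real_derivative h t) (at t)"
      unfolding DERIV_def
    proof (rule LIM_I)
      fix e :: real assume e: "0 < e"
      obtain d1 where d1: "d1 > 0" "\<And>k. 0 < k \<Longrightarrow> k < d1 \<Longrightarrow> \<bar>(F (t + k) - F t) / k - h t\<bar> < e"
        using N1(2)[OF t(1) e] by blast
      obtain d2 where d2: "d2 > 0" "\<And>k. 0 < k \<Longrightarrow> k < d2 \<Longrightarrow> \<bar>(- F (- (- t + k)) - - F (- (- t))) / k - h (- (- t))\<bar> < e"
        using N2(2)[OF t(2) e] by blast
      have "\<bar>(F (t + k) - F t) / k - h t\<bar> < e" if "k \<noteq> 0" "\<bar>k\<bar> < min d1 d2" for k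
      proof (cases "k > 0")
        case False
        have "(F (t + k) - F t) / k = (- F (- (- t + (- k))) - - F (- (- t))) / (- k)"
          using that by (simp add: field_simps)
        then show ?thesis using d2(2)[of "- k"] that False by simp
      qed (use d1(2)[of k] that in auto)
      then show "\<exists>d>0. \<forall>k. k \<noteq> 0 \<and> norm (k - 0) < d \<longrightarrow> norm ((F (t + k) - F t) / k - h t) < e"
        using d1(1) d2(1) by (intro exI[of _ "min d1 d2"]) auto
    qed
    then have "((\<lambda>x. F x - (L + 1) * x) has_real_derivative h t - (L + 1)) (at t)"
      by (auto intro!: derivative_eq_intros)
    then show "\<exists>D. (f has_real_derivative D) (at t)" by (auto simp: F_def)
  qed
qed

theorem lipschitz_ae_has_vector_derivative:
  fixes f :: "real \<Rightarrow> 'a::euclidean_space"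
  assumes f: "L-lipschitz_on UNIV f"
  obtains N where "negligible N" "\<And>t. t \<notin> N \<Longrightarrow> \<exists>v. (f has_vector_derivative v) (at t)"
proof -
  have "\<exists>N. negligible N \<and> (\<forall>t. t \<notin> N \<longrightarrow> (\<exists>D. ((\<lambda>x. f x \<bullet> i) has_real_derivative D) (at t)))"
    if i: "i \<in> Basis" for i
  proof -
    have "L-lipschitz_on UNIV (\<lambda>x. f x \<bullet> i)"
    proof (rule lipschitz_onI)
      fix x y
      have "\<bar>(f x - f y) \<bullet> i\<bar> \<le> norm (f x - f y)" using Basis_le_norm[OF i] by blast
      also have "\<dots> \<le> L * dist x y" using lipschitz_onD[OF f, of x y] by (simp add: dist_norm)
      finally show "dist (f x \<bullet> i) (f y \<bullet> i) \<le> L * dist x y" by (simp add: dist_real_def inner_diff_left)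
    qed (use lipschitz_on_nonneg[OF f] in auto)
    from lipschitz_ae_differentiable_real[OF this] show ?thesis by metis
  qed
  then obtain N where N: "\<And>i. i \<in> Basis \<Longrightarrow> negligible (N i)"
    "\<And>i t. i \<in> Basis \<Longrightarrow> t \<notin> N i \<Longrightarrow> \<exists>D. ((\<lambda>x. f x \<bullet> i) has_real_derivative D) (at t)" by metis
  show ?thesis
  proof (rule that[of "\<Union>i\<in>Basis. N i"])
    show "negligible (\<Union>i\<in>Basis. N i)" using N(1) by (intro negligible_Union) auto
    fix t assume t: "t \<notin> (\<Union>i\<in>Basis. N i)"
    then have "\<exists>D. ((\<lambda>x. f x \<bullet> i) has_real_derivative D) (at t)" if "i \<in> Basis" for i
      using that N(2) by blast
    then obtain D where D: "\<And>i. i \<in> Basis \<Longrightarrow> ((\<lambda>x. f x \<bullet> i) has_real_derivative D i) (at t)" by metis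
    have "(f has_vector_derivative (\<Sum>i\<in>Basis. D i *\<^sub>R i)) (at t)"
      unfolding has_vector_derivative_def
    proof (subst has_derivative_componentwise_within, intro ballI)
      fix i :: 'a assume i: "i \<in> Basis"
      have "(\<lambda>x. (x *\<^sub>R (\<Sum>i\<in>Basis. D i *\<^sub>R i)) \<bullet> i) = (\<lambda>x. D i * x)"
        using i by (auto simp: inner_sum_left inner_Basis if_distrib cong: if_cong)
      then show "((\<lambda>x. f x \<bullet> i) has_derivative (\<lambda>x. (x *\<^sub>R (\<Sum>i\<in>Basis. D i *\<^sub>R i)) \<bullet> i)) (at t)"
        using D[OF i] by (simp add: has_field_derivative_def)
    qed
    then show "\<exists>v. (f has_vector_derivative v) (at t)" by blast
  qed
qed

section \<open>Euler curves\<close>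

lemma tangent_cone_iff:
  fixes K :: "'a::real_normed_vector set"
  shows "v \<in> tangent_cone K z \<longleftrightarrow> (\<forall>\<epsilon>>0. \<exists>h w. 0 < h \<and> h < \<epsilon> \<and> norm (w - v) < \<epsilon> \<and> z + h *\<^sub>R w \<in> K)"
proof
  assume "v \<in> tangent_cone K z"
  then obtain h w where hw: "\<And>k. (0::real) < h k" "h \<longlonglongrightarrow> 0" "w \<longlonglongrightarrow> v" "\<And>k::nat. z + h k *\<^sub>R w k \<in> K"
    using tangent_coneE by metis
  show "\<forall>\<epsilon>>0. \<exists>h w. 0 < h \<and> h < \<epsilon> \<and> norm (w - v) < \<epsilon> \<and> z + h *\<^sub>R w \<in> K"
  proof (intro allI impI)
    fix \<epsilon> :: real assume e: "0 < \<epsilon>"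
    have "\<forall>\<^sub>F k in sequentially. h k < \<epsilon> \<and> dist (w k) v < \<epsilon>"
      by (intro eventually_conj order_tendstoD(2)[OF hw(2) e] tendstoD[OF hw(3) e])
    then obtain k where "h k < \<epsilon>" "dist (w k) v < \<epsilon>"
      using eventually_happens'[OF sequentially_bot] by blast
    then show "\<exists>h w. 0 < h \<and> h < \<epsilon> \<and> norm (w - v) < \<epsilon> \<and> z + h *\<^sub>R w \<in> K"
      using hw(1,4)[of k] by (intro exI[of _ "h k"] exI[of _ "w k"]) (simp add: dist_norm)
  qed
next
  assume a: "\<forall>\<epsilon>>0. \<exists>h w. 0 < h \<and> h < \<epsilon> \<and> norm (w - v) < \<epsilon> \<and> z + h *\<^sub>R w \<in> K"
  have "\<exists>h w. 0 < h \<and> h < inverse (real (Suc k)) \<and> norm (w - v) < inverse (real (Suc k)) \<and> z + h *\<^sub>R w \<in> K" for k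
    using a[rule_format, of "inverse (real (Suc k))"] by simp
  then obtain h w where hw: "\<And>k::nat. 0 < h k" "\<And>k. h k < inverse (real (Suc k))"
    "\<And>k. norm (w k - v) < inverse (real (Suc k))" "\<And>k. z + h k *\<^sub>R w k \<in> K" by metis
  show "v \<in> tangent_cone K z"
  proof (rule tangent_coneI[of h w])
    show "h \<longlonglongrightarrow> 0"
      by (rule Lim_null_comparison[OF _ LIMSEQ_inverse_real_of_nat])
        (use hw(1,2) in \<open>intro always_eventually allI, simp add: less_imp_le\<close>)
    have "(\<lambda>k. w k - v) \<longlonglongrightarrow> 0"
      by (rule Lim_null_comparison[OF _ LIMSEQ_inverse_real_of_nat])
        (intro always_eventually allI less_imp_le hw(3))
    then show "w \<longlonglongrightarrow> v" by (simp add: LIM_zero_iff)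
  qed (use hw in auto)
qed

lemma closed_tangent_cone:
  fixes K :: "'a::real_normed_vector set"
  shows "closed (tangent_cone K z)"
  unfolding closed_sequential_limits
proof (intro allI impI, elim conjE)
  fix f l assume f: "\<forall>n. f n \<in> tangent_cone K z" "f \<longlonglongrightarrow> l"
  show "l \<in> tangent_cone K z"
    unfolding tangent_cone_iff
  proof (intro allI impI)
    fix \<epsilon> :: real assume e: "0 < \<epsilon>"
    obtain n where n: "dist (f n) l < \<epsilon> / 2"
      using tendstoD[OF f(2), of "\<epsilon> / 2"] e eventually_happens'[OF sequentially_bot] by force
    obtain h w where hw: "0 < h" "h < \<epsilon> / 2" "norm (w - f n) < \<epsilon> / 2" "z + h *\<^sub>R w \<in> K"
      using f(1) e unfolding tangent_cone_iff by (metis half_gt_zero)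
    have "norm (w - l) \<le> norm (w - f n) + norm (f n - l)" using norm_triangle_ineq[of "w - f n" "f n - l"] by simp
    then have "norm (w - l) < \<epsilon>" using n hw(3) by (simp add: dist_norm)
    then show "\<exists>h w. 0 < h \<and> h < \<epsilon> \<and> norm (w - l) < \<epsilon> \<and> z + h *\<^sub>R w \<in> K"
      using hw e by (intro exI[of _ h] exI[of _ w]) auto
  qed
qed

text \<open>Compactness of A keeps the supremum from being taken over an unbounded set, and
  compactness of B lets the distance be attained.\<close>

lemma hausdorff_distance_reach:
  fixes A B :: "'a::euclidean_space set"
  assumes "compact A" "compact B" "B \<noteq> {}" "a \<in> A"
  shows "\<exists>b\<in>B. dist a b \<le> hausdorff_distance A B"
proof -
  have "compact ((\<lambda>a. infdist a B) ` A)"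
    using assms(1) by (intro compact_continuous_image continuous_intros)
  then have "bdd_above ((\<lambda>a. infdist a B) ` A)" by (intro bounded_imp_bdd_above compact_imp_bounded)
  then have "infdist a B \<le> (SUP a\<in>A. infdist a B)" using assms(4) by (intro cSUP_upper)
  then have "infdist a B \<le> hausdorff_distance A B" by (simp add: hausdorff_distance_def)
  moreover obtain b where "b \<in> B" "infdist a B = dist a b"
    using infdist_attains_inf[OF compact_imp_closed[OF assms(2)] assms(3), of a] by metis
  ultimately show ?thesis by auto
qed

section \<open>Moving sets and the tangent cones of their space-time graph\<close>

locale moving_set =
  fixes T L :: real and C :: "real \<Rightarrow> (real ^ 'n) set"
  assumes T_pos: "T > 0" and L_nonneg: "L \<ge> 0"
    and compact_C: "t \<in> {0..T} \<Longrightarrow> compact (C t)"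
    and reach: "\<lbrakk>s \<in> {0..T}; t \<in> {0..T}; x \<in> C s\<rbrakk> \<Longrightarrow> \<exists>y\<in>C t. dist x y \<le> L * dist s t"
begin

abbreviation K :: "((real ^ 'n) \<times> real) set" where
  "K \<equiv> space_time_graph {0..T} C"

lemma K_iff: "(x, t) \<in> K \<longleftrightarrow> 0 \<le> t \<and> t \<le> T \<and> x \<in> C t"
  by (auto simp: space_time_graph_def)

lemma closed_K: "closed K"
  unfolding closed_sequential_limits
proof (intro allI impI, elim conjE)
  fix f l assume f: "\<forall>n. f n \<in> K" "f \<longlonglongrightarrow> l"
  obtain x t where l: "l = (x, t)" by fastforce
  have fst: "(\<lambda>n. fst (f n)) \<longlonglongrightarrow> x" and snd: "(\<lambda>n. snd (f n)) \<longlonglongrightarrow> t"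
    using tendsto_fst[OF f(2)] tendsto_snd[OF f(2)] by (auto simp: l)
  have fn: "snd (f n) \<in> {0..T}" "fst (f n) \<in> C (snd (f n))" for n
    using f(1) K_iff[of "fst (f n)" "snd (f n)"] by auto
  have t: "t \<in> {0..T}" by (rule closed_sequentially[OF closed_atLeastAtMost fn(1) snd])
  have "\<exists>y\<in>C t. dist (fst (f n)) y \<le> L * dist (snd (f n)) t" for n
    using reach[OF fn(1) t fn(2)] .
  then obtain y where y: "\<And>n. y n \<in> C t" "\<And>n. dist (fst (f n)) (y n) \<le> L * dist (snd (f n)) t" by metis
  have "(\<lambda>n. L * dist (snd (f n)) t) \<longlonglongrightarrow> L * 0"
    by (intro tendsto_mult tendsto_const) (use snd in \<open>simp add: tendsto_dist_iff[symmetric]\<close>)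
  then have 0: "(\<lambda>n. L * dist (snd (f n)) t) \<longlonglongrightarrow> 0" by simp
  have "(\<lambda>n. fst (f n) - y n) \<longlonglongrightarrow> 0"
    by (rule Lim_null_comparison[OF _ 0]) (use y(2) in \<open>simp add: dist_norm\<close>)
  from tendsto_diff[OF fst this] have "y \<longlonglongrightarrow> x" by simp
  then have "x \<in> C t" using closed_sequentially[OF compact_imp_closed[OF compact_C[OF t]]] y(1) by blast
  then show "l \<in> K" using t by (simp add: l K_iff)
qed

lemma compact_K: "compact K"
proof -
  obtain B where B: "\<And>y. y \<in> C 0 \<Longrightarrow> norm y \<le> B"
    using compact_imp_bounded[OF compact_C[of 0]] T_pos unfolding bounded_iff by auto
  have "norm z \<le> B + L * T + T" if z: "z \<in> K" for z
  proof -
    obtain x t where xt: "z = (x, t)" by fastforce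
    then have t: "0 \<le> t" "t \<le> T" "x \<in> C t" using z by (auto simp: K_iff)
    then obtain y where "y \<in> C 0" "dist x y \<le> L * dist t 0" using reach[of t 0 x] T_pos by auto
    then have "norm x \<le> B + L * t" using B[of y] norm_triangle_sub[of x y] t(1) by (simp add: dist_norm)
    moreover have "L * t \<le> L * T" using t L_nonneg by (intro mult_left_mono)
    moreover have "norm z \<le> norm x + norm t" unfolding xt by (rule norm_Pair_le)
    ultimately show ?thesis using t by simp
  qed
  then have "bounded K" by (rule boundedI)
  then show ?thesis using closed_K by (simp add: compact_eq_bounded_closed)
qed

text \<open>Points of C (t + h) within L * h of x have difference quotients of norm at most L, and
  these accumulate. At time T the slice is empty, because K has no later points.\<close>

lemma tangent_nonempty:
  assumes z: "(x, t) \<in> K" and t: "t < T"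
  shows "\<exists>v. (v, 1) \<in> tangent_cone K (x, t) \<and> norm v \<le> L"
proof -
  define h where "h k = (T - t) * inverse (real (Suc k))" for k
  have h: "h k > 0" "h k \<le> T - t" for k
    using t mult_left_mono[of "inverse (real (Suc k))" 1 "T - t"] by (auto simp: h_def inverse_le_1_iff)
  have h0: "h \<longlonglongrightarrow> 0" unfolding h_def using tendsto_mult[OF tendsto_const LIMSEQ_inverse_real_of_nat, of "T - t"] by simp
  have xt: "0 \<le> t" "x \<in> C t" using z by (auto simp: K_iff)
  have "\<exists>y\<in>C (t + h k). dist x y \<le> L * h k" for k
    using reach[of t "t + h k" x] h[of k] xt t by (auto simp: dist_real_def)
  then obtain y where y: "\<And>k. y k \<in> C (t + h k)" "\<And>k. dist x (y k) \<le> L * h k" by metis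
  define w where "w k = (y k - x) /\<^sub>R h k" for k
  have wL: "norm (w k) \<le> L" for k
    using y(2)[of k] h(1)[of k] by (simp add: w_def dist_norm norm_minus_commute divide_inverse_commute[symmetric] pos_divide_le_eq)
  then have "bounded (range w)" by (intro boundedI) auto
  then obtain l r where r: "strict_mono r" "(w \<circ> r) \<longlonglongrightarrow> l"
    using bounded_imp_convergent_subsequence by blast
  have "(l, 1) \<in> tangent_cone K (x, t)"
  proof (rule tangent_coneI[of "h \<circ> r" "\<lambda>k. ((w \<circ> r) k, 1)"])
    show "(h \<circ> r) \<longlonglongrightarrow> 0" using LIMSEQ_subseq_LIMSEQ[OF h0 r(1)] .
    show "(\<lambda>k. ((w \<circ> r) k, 1)) \<longlonglongrightarrow> (l, 1)" by (intro tendsto_intros r)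
    fix k
    have "x + h (r k) *\<^sub>R w (r k) = y (r k)" using h(1)[of "r k"] by (simp add: w_def)
    then show "(x, t) + (h \<circ> r) k *\<^sub>R ((w \<circ> r) k, 1) \<in> K"
      using y(1)[of "r k"] h[of "r k"] xt by (simp add: K_iff)
  qed (use h in auto)
  moreover have "norm l \<le> L"
    using Lim_bounded[OF tendsto_norm[OF r(2)], of 0 L] wL by auto
  ultimately show ?thesis by blast
qed

text \<open>Comparison of q with a tangent vector of norm at most L. This is the origin of the speed
  bound M.\<close>

lemma norm_tangent_proj:
  assumes g: "(d, z, (q, 1)) \<in> tangent_proj_graph K" and "snd z < T"
  shows "norm q \<le> 2 * norm d + L"
proof -
  obtain v where v: "(v, 1) \<in> tangent_cone K z" "norm v \<le> L"
    using tangent_nonempty[of "fst z" "snd z"] tangent_proj_graphD(1)[OF g] assms(2) by auto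
  have "norm (d - q) \<le> norm (d - v)" using tangent_proj_graphD(4)[OF g v(1)] by simp
  then show ?thesis using v(2) norm_triangle_ineq4[of d v] norm_triangle_sub[of q d]
    by (simp add: norm_minus_commute)
qed

lemma tangent_proj_exists:
  assumes z: "z \<in> K" "snd z < T"
  shows "\<exists>q. (d, z, (q, 1)) \<in> tangent_proj_graph K"
proof -
  define A where "A = {w. (w, 1) \<in> tangent_cone K z}"
  have "A = (\<lambda>w. (w, 1)) -` tangent_cone K z" by (auto simp: A_def)
  then have A: "closed A" using closed_tangent_cone
    by (auto intro!: continuous_closed_vimage continuous_intros)
  have ne: "A \<noteq> {}" using tangent_nonempty[of "fst z" "snd z"] z by (auto simp: A_def)
  define q where "q = closest_point A d"
  have q: "q \<in> A" "\<And>w. w \<in> A \<Longrightarrow> dist d q \<le> dist d w"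
    using closest_point_in_set[OF A ne] closest_point_le[OF A] by (auto simp: q_def)
  have "dist (d, 1) (q, 1) \<le> dist (d, 1) b" if "b \<in> tangent_cone K z" "snd b = 1" for b
    using q(2)[of "fst b"] that by (cases b) (auto simp: A_def dist_prod_def)
  then have "(q, 1) \<in> metric_proj (tangent_cone K z \<inter> {v. snd v = 1}) (d, 1)"
    using q(1) by (auto simp: metric_proj_def A_def)
  then show ?thesis using z by (auto simp: tangent_proj_graph_def)
qed

text \<open>
  Steps started near a point of a finite net move to the endpoint of the step of that net point;
  compactness of \<open>K\<close> therefore bounds the step length from below.
\<close>

lemma uniform_step:
  assumes d: "\<forall>z\<in>K. 2 * norm (d z) + L \<le> M" and \<epsilon>: "0 < \<epsilon>" "\<epsilon> \<le> 1/4" and \<sigma>: "\<sigma> < T"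
  shows "\<exists>\<eta>>0. \<forall>z\<in>K. snd z \<le> \<sigma> \<longrightarrow> (\<exists>z'\<in>K. \<exists>q z0. (d z0, z0, (q, 1)) \<in> tangent_proj_graph K \<and>
      norm q \<le> M \<and> dist z0 z \<le> \<epsilon> \<and> \<eta> \<le> snd z' - snd z \<and> snd z' - snd z \<le> 2 * \<epsilon> \<and>
      norm (fst z' - fst z - (snd z' - snd z) *\<^sub>R q) \<le> 4 * \<epsilon> * (1 + M) * (snd z' - snd z))"
proof -
  \<comment> \<open>Tangent vectors with time component 1 exist before time T only, so the net is
    restricted to times at most \<sigma>.\<close>
  define K' where "K' = K \<inter> {z. snd z \<le> \<sigma>}"
  have "closed {z :: (real ^ 'n) \<times> real. snd z \<le> \<sigma>}" by (intro closed_Collect_le continuous_intros)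
  then have K': "compact K'" unfolding K'_def using compact_K by (intro compact_Int_closed)
  have "\<exists>h w q. 0 < h \<and> h < \<epsilon> \<and> norm (w - (q, 1)) < \<epsilon> \<and> z + h *\<^sub>R w \<in> K \<and> (d z, z, (q, 1)) \<in> tangent_proj_graph K \<and> norm q \<le> M"
    if z: "z \<in> K'" for z
  proof -
    have zK: "z \<in> K" "snd z < T" using z \<sigma> by (auto simp: K'_def)
    obtain q where q: "(d z, z, (q, 1)) \<in> tangent_proj_graph K" using tangent_proj_exists[OF zK] by blast
    have "norm q \<le> M" using norm_tangent_proj[OF q zK(2)] bspec[OF d zK(1)] by simp
    then show ?thesis using tangent_proj_graphD(3)[OF q] q \<epsilon>(1) unfolding tangent_cone_iff by blast
  qed
  then obtain h w q where hwq: "\<And>z. z \<in> K' \<Longrightarrow> 0 < h z \<and> h z < \<epsilon> \<and> norm (w z - (q z, 1)) < \<epsilon> \<and> z + h z *\<^sub>R w z \<in> K \<and>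
      (d z, z, (q z, 1)) \<in> tangent_proj_graph K \<and> norm (q z) \<le> M" by metis
  \<comment> \<open>The radius is proportional to the step length: starting at z instead of its net
    point is then a relative error \<epsilon> of the displacement.\<close>
  have "K' \<subseteq> (\<Union>z\<in>K'. ball z (\<epsilon> * h z))"
  proof
    fix z assume "z \<in> K'"
    then show "z \<in> (\<Union>z\<in>K'. ball z (\<epsilon> * h z))" using hwq[of z] \<epsilon>(1) by (intro UN_I[of z]) auto
  qed
  then obtain Z where Z: "Z \<subseteq> K'" "finite Z" "K' \<subseteq> (\<Union>z\<in>Z. ball z (\<epsilon> * h z))"
    using compactE_image[OF K', of K' "\<lambda>z. ball z (\<epsilon> * h z)"] by auto
  \<comment> \<open>The actual duration differs from h by at most 2 * \<epsilon> * h, hence by at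
    most h / 2. The element 1 covers an empty net.\<close>
  define \<eta> where "\<eta> = Min (insert 1 ((\<lambda>z. h z / 2) ` Z))"
  have \<eta>: "\<eta> \<le> h z / 2" if "z \<in> Z" for z
    unfolding \<eta>_def using Z(2) that by (intro Min_le) auto
  have "h z / 2 > 0" if "z \<in> Z" for z using hwq[of z] that Z(1) by auto
  then have \<eta>_pos: "\<eta> > 0"
    unfolding \<eta>_def using Z(2) by (subst Min_gr_iff) (simp_all add: ball_simps del: split_paired_All)
  show ?thesis
  proof (intro exI[of _ \<eta>] conjI ballI impI)
    fix z assume "z \<in> K" "snd z \<le> \<sigma>"
    then have "z \<in> K'" by (simp add: K'_def)
    then obtain z0 where z0: "z0 \<in> Z" "dist z0 z < \<epsilon> * h z0" using Z(3) by auto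
    let ?h = "h z0" and ?w = "w z0" and ?q = "q z0"
    have s: "0 < ?h" "?h < \<epsilon>" "norm (?w - (?q, 1)) < \<epsilon>" "z0 + ?h *\<^sub>R ?w \<in> K"
      "(d z0, z0, (?q, 1)) \<in> tangent_proj_graph K" "norm ?q \<le> M" using hwq[of z0] z0(1) Z(1) by auto
    define z' where "z' = z0 + ?h *\<^sub>R ?w"
    define \<Delta> where "\<Delta> = snd z' - snd z"
    have w1: "norm (fst ?w - ?q) \<le> \<epsilon>" "\<bar>snd ?w - 1\<bar> \<le> \<epsilon>"
      using norm_fst_le[of "fst ?w - ?q" "snd ?w - 1"] norm_snd_le[of "snd ?w - 1" "fst ?w - ?q"] s(3)
      by (cases ?w; simp)+
    have z1: "norm (fst z0 - fst z) \<le> \<epsilon> * ?h" "\<bar>snd z0 - snd z\<bar> \<le> \<epsilon> * ?h"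
      using dist_fst_le[of z0 z] dist_snd_le[of z0 z] z0(2) by (auto simp: dist_norm)
    have "?h * snd ?w - ?h = ?h * (snd ?w - 1)" by (simp add: right_diff_distrib)
    then have "\<bar>?h * snd ?w - ?h\<bar> = ?h * \<bar>snd ?w - 1\<bar>" using s(1) by (simp add: abs_mult)
    also have "\<dots> \<le> ?h * \<epsilon>" using w1(2) s(1) by (intro mult_left_mono) auto
    finally have hw: "\<bar>?h * snd ?w - ?h\<bar> \<le> \<epsilon> * ?h" by (simp only: mult.commute)
    have \<Delta>: "\<Delta> = ?h * snd ?w + (snd z0 - snd z)" by (simp add: \<Delta>_def z'_def)
    have \<Delta>h: "\<bar>\<Delta> - ?h\<bar> \<le> 2 * (\<epsilon> * ?h)" using hw z1(2) unfolding \<Delta> by linarith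
    have eh: "2 * (\<epsilon> * ?h) \<le> ?h / 2" using mult_right_mono[OF \<epsilon>(2), of ?h] s(1) by simp
    have \<Delta>1: "?h / 2 \<le> \<Delta>" "\<Delta> \<le> 2 * ?h" using \<Delta>h eh s(1) by linarith+
    have M: "M \<ge> 0" using s(6) norm_ge_zero[of ?q] by linarith
    have eq: "fst z' - fst z - \<Delta> *\<^sub>R ?q = ?h *\<^sub>R (fst ?w - ?q) + (fst z0 - fst z) - (\<Delta> - ?h) *\<^sub>R ?q"
      by (simp add: z'_def algebra_simps)
    have "norm (fst z' - fst z - \<Delta> *\<^sub>R ?q) \<le> ?h * norm (fst ?w - ?q) + norm (fst z0 - fst z) + \<bar>\<Delta> - ?h\<bar> * norm ?q"
      unfolding eq using norm_triangle_ineq4[of "?h *\<^sub>R (fst ?w - ?q) + (fst z0 - fst z)" "(\<Delta> - ?h) *\<^sub>R ?q"]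
        norm_triangle_ineq[of "?h *\<^sub>R (fst ?w - ?q)" "fst z0 - fst z"] s(1) by simp
    also have "\<dots> \<le> ?h * \<epsilon> + \<epsilon> * ?h + 2 * (\<epsilon> * ?h) * M"
      using w1 z1 \<Delta>h s(1,6) M \<epsilon> by (intro add_mono mult_left_mono mult_mono) auto
    \<comment> \<open>Written as a multiple of h / 2, because h / 2 is the available lower bound for
      the duration.\<close>
    also have "\<dots> = 4 * \<epsilon> * (1 + M) * (?h / 2)" by (simp add: algebra_simps)
    also have "\<dots> \<le> 4 * \<epsilon> * (1 + M) * \<Delta>" using \<Delta>1 \<epsilon> M by (intro mult_left_mono) auto
    finally have "norm (fst z' - fst z - \<Delta> *\<^sub>R ?q) \<le> 4 * \<epsilon> * (1 + M) * \<Delta>" .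
    moreover have "\<eta> \<le> \<Delta>" "\<Delta> \<le> 2 * \<epsilon>" using \<eta>[OF z0(1)] \<Delta>1 s(2) by auto
    moreover have "dist z0 z \<le> \<epsilon>"
      using z0(2) mult_left_le[of ?h \<epsilon>] s(1,2) \<epsilon> by linarith
    ultimately show "\<exists>z'\<in>K. \<exists>q z0. (d z0, z0, (q, 1)) \<in> tangent_proj_graph K \<and>
      norm q \<le> M \<and> dist z0 z \<le> \<epsilon> \<and> \<eta> \<le> snd z' - snd z \<and> snd z' - snd z \<le> 2 * \<epsilon> \<and>
      norm (fst z' - fst z - (snd z' - snd z) *\<^sub>R q) \<le> 4 * \<epsilon> * (1 + M) * (snd z' - snd z)"
      using s unfolding z'_def[symmetric] \<Delta>_def
      by (intro bexI[of _ z'] exI[of _ ?q] exI[of _ z0]) auto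
  qed (rule \<eta>_pos)
qed

text \<open>Only the endpoint is required to lie in K; earlier points are merely within \<epsilon>
  of base points z0 in K. The drift is evaluated at z0, so (q, 1) is an exact projection there, and
  the affine pieces extend to the right as needed by \<open>antimono_of_local_right\<close>.\<close>

definition euler :: "((real ^ 'n) \<times> real \<Rightarrow> real ^ 'n) \<Rightarrow> real \<Rightarrow> real \<Rightarrow> real \<Rightarrow> (real \<Rightarrow> real ^ 'n) \<Rightarrow> bool" where
  "euler d M \<epsilon> \<tau> y \<longleftrightarrow> M-lipschitz_on UNIV y \<and> 0 \<le> \<tau> \<and> (y \<tau>, \<tau>) \<in> K \<and>
    (\<forall>t. 0 \<le> t \<and> t < \<tau> \<longrightarrow> (\<exists>\<eta>>0. \<exists>V q z0. (\<forall>r\<in>{t..t+\<eta>}. y r = y t + (r - t) *\<^sub>R V) \<and> norm (V - q) \<le> \<epsilon> \<and>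
       (d z0, z0, (q, 1)) \<in> tangent_proj_graph K \<and> dist z0 (y t, t) \<le> \<epsilon>))"

text \<open>M + 1 bounds the speed of the curve in space-time, so \<open>near\<close> keeps z0
  within \<epsilon> of the entire new piece and not only of its start.\<close>

lemma euler_extend:
  assumes y: "euler d M \<epsilon> \<tau> y" and z': "z' \<in> K" "snd z' > \<tau>"
    and V: "V = (fst z' - y \<tau>) /\<^sub>R (snd z' - \<tau>)" "norm V \<le> M"
    and q: "norm (V - q) \<le> \<epsilon>" "(d z0, z0, (q, 1)) \<in> tangent_proj_graph K"
    and near: "dist z0 (y \<tau>, \<tau>) + (M + 1) * (snd z' - \<tau>) \<le> \<epsilon>"
  shows "\<exists>y'. euler d M \<epsilon> (snd z') y' \<and> y' 0 = y 0"
proof -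
  define \<tau>' where "\<tau>' = snd z'"
  \<comment> \<open>The clamps follow y up to \<tau>, then move with velocity V until \<tau>', then
    rest. A single formula on the whole line permits a single Lipschitz estimate.\<close>
  define y' where "y' r = y (min r \<tau>) + (max \<tau> (min r \<tau>') - \<tau>) *\<^sub>R V" for r
  have \<tau>: "0 \<le> \<tau>" "\<tau> < \<tau>'" using y z' by (auto simp: euler_def \<tau>'_def)
  have lip: "M-lipschitz_on UNIV y" using y by (simp add: euler_def)
  have M: "M \<ge> 0" using lipschitz_on_nonneg[OF lip] .
  have y'_le: "y' r = y r" if "r \<le> \<tau>" for r using that \<tau> by (simp add: y'_def min_def)
  have y'_ge: "y' r = y \<tau> + (r - \<tau>) *\<^sub>R V" if "\<tau> \<le> r" "r \<le> \<tau>'" for r using that by (auto simp: y'_def min_def)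
  have incr: "norm (y' s - y' r) \<le> M * (s - r)" if rs: "r \<le> s" for r s
  proof -
    have "y' s - y' r = (y (min s \<tau>) - y (min r \<tau>)) + (max \<tau> (min s \<tau>') - max \<tau> (min r \<tau>')) *\<^sub>R V"
      by (simp add: y'_def algebra_simps)
    then have "norm (y' s - y' r) \<le> norm (y (min s \<tau>) - y (min r \<tau>)) + \<bar>max \<tau> (min s \<tau>') - max \<tau> (min r \<tau>')\<bar> * norm V"
      using norm_triangle_ineq[of "y (min s \<tau>) - y (min r \<tau>)" "(max \<tau> (min s \<tau>') - max \<tau> (min r \<tau>')) *\<^sub>R V"] by simp
    also have "\<dots> \<le> M * \<bar>min s \<tau> - min r \<tau>\<bar> + \<bar>max \<tau> (min s \<tau>') - max \<tau> (min r \<tau>')\<bar> * M"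
      using lipschitz_onD[OF lip, of "min s \<tau>" "min r \<tau>"] V(2)
      by (intro add_mono mult_left_mono) (auto simp: dist_norm)
    also have "\<dots> = M * (\<bar>min s \<tau> - min r \<tau>\<bar> + \<bar>max \<tau> (min s \<tau>') - max \<tau> (min r \<tau>')\<bar>)"
      by (simp add: algebra_simps)
    also have "\<dots> \<le> M * (s - r)" using rs \<tau> M by (intro mult_left_mono) (auto simp: min_def max_def)
    finally show ?thesis .
  qed
  have lip': "M-lipschitz_on UNIV y'"
  proof (rule lipschitz_onI[OF _ M])
    fix r s show "dist (y' r) (y' s) \<le> M * dist r s"
      using incr[of r s] incr[of s r] by (cases "r \<le> s") (auto simp: dist_norm norm_minus_commute dist_real_def)
  qed
  have "y' \<tau>' = fst z'" using y'_ge[of \<tau>'] \<tau> by (simp add: V(1) \<tau>'_def)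
  then have K': "(y' \<tau>', \<tau>') \<in> K" using z'(1) by (simp add: \<tau>'_def)
  have "\<exists>\<eta>>0. \<exists>V q z0. (\<forall>r\<in>{t..t+\<eta>}. y' r = y' t + (r - t) *\<^sub>R V) \<and> norm (V - q) \<le> \<epsilon> \<and>
       (d z0, z0, (q, 1)) \<in> tangent_proj_graph K \<and> dist z0 (y' t, t) \<le> \<epsilon>" if t: "0 \<le> t" "t < \<tau>'" for t
  proof (cases "t < \<tau>")
    case True
    then obtain \<eta> V q z0 where *: "\<eta> > 0" "\<And>r. r \<in> {t..t+\<eta>} \<Longrightarrow> y r = y t + (r - t) *\<^sub>R V" "norm (V - q) \<le> \<epsilon>"
       "(d z0, z0, (q, 1)) \<in> tangent_proj_graph K" "dist z0 (y t, t) \<le> \<epsilon>"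
      using y t(1) unfolding euler_def by meson
    have "y' r = y' t + (r - t) *\<^sub>R V" if "r \<in> {t..t + min \<eta> (\<tau> - t)}" for r
      using *(2)[of r] that True y'_le[of r] y'_le[of t] by auto
    moreover have "min \<eta> (\<tau> - t) > 0" "dist z0 (y' t, t) \<le> \<epsilon>" using *(1,5) True y'_le[of t] by auto
    ultimately show ?thesis using *(3,4) by blast
  next
    case False
    have "y' r = y' t + (r - t) *\<^sub>R V" if "r \<in> {t..t + (\<tau>' - t)}" for r
    proof -
      have "y' r = y \<tau> + (r - \<tau>) *\<^sub>R V" "y' t = y \<tau> + (t - \<tau>) *\<^sub>R V"
        using that False t by (intro y'_ge; simp)+
      then show ?thesis by (simp only:) (simp add: algebra_simps)
    qed
    moreover have "dist z0 (y' t, t) \<le> \<epsilon>"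
    proof -
      have "dist z0 (y' t, t) \<le> dist z0 (y \<tau>, \<tau>) + dist (y \<tau>, \<tau>) (y' t, t)" by (rule dist_triangle)
      also have "dist (y \<tau>, \<tau>) (y' t, t) \<le> norm (y \<tau> - y' t) + norm (\<tau> - t)"
        unfolding dist_norm diff_Pair by (rule norm_Pair_le)
      also have "\<dots> \<le> M * (t - \<tau>) + (t - \<tau>)"
        using incr[of \<tau> t] y'_le[of \<tau>] False by (simp add: norm_minus_commute)
      also have "\<dots> = (M + 1) * (t - \<tau>)" by (simp add: algebra_simps)
      also have "\<dots> \<le> (M + 1) * (snd z' - \<tau>)" using t M by (intro mult_left_mono) (auto simp: \<tau>'_def)
      finally show ?thesis using near by simp
    qed
    moreover have "\<tau>' - t > 0" using t(2) by simp
    ultimately show ?thesis using q by blast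
  qed
  then have "euler d M \<epsilon> \<tau>' y'" using lip' K' \<tau> by (auto simp: euler_def)
  then show ?thesis using y'_le[of 0] \<tau>(1) by (auto simp: \<tau>'_def)
qed

text \<open>Every step lasts at least \<eta>, so finitely many of them pass \<sigma> = T -
  \<epsilon> / 2; the lower bound on the duration is available only away from T. The speed bound is
  M + 1 because each velocity is within 1 of a projection of norm at most M.\<close>

lemma euler_exists:
  assumes d: "\<forall>z\<in>K. 2 * norm (d z) + L \<le> M" and x0: "x0 \<in> C 0" and e: "0 < \<epsilon>"
  shows "\<exists>y \<tau>. euler d (M + 1) \<epsilon> \<tau> y \<and> y 0 = x0 \<and> T - \<epsilon> < \<tau>"
proof -
  have z0: "(x0, 0) \<in> K" using x0 T_pos by (simp add: K_iff)
  have M: "M \<ge> 0" using bspec[OF d z0] L_nonneg norm_ge_zero[of "d (x0, 0)"] by linarith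
  \<comment> \<open>Gives 4 * \<delta> * (M + 2) \<le> min \<epsilon> 1, which bounds the velocity
    error by \<epsilon> and by 1 and also yields the proximity condition of
    \<open>euler_extend\<close>.\<close>
  define \<delta> where "\<delta> = min (1/4) (min \<epsilon> 1 / (4 * (M + 2)))"
  have \<delta>: "\<delta> > 0" "\<delta> \<le> 1/4" using e M by (auto simp: \<delta>_def)
  have "\<delta> \<le> min \<epsilon> 1 / (4 * (M + 2))" by (simp add: \<delta>_def)
  then have "\<delta> * (4 * (M + 2)) \<le> min \<epsilon> 1" using M by (subst (asm) pos_le_divide_eq) auto
  then have \<delta>M: "4 * \<delta> * (M + 2) \<le> \<epsilon>" "4 * \<delta> * (M + 2) \<le> 1" by (auto simp: algebra_simps)
  define \<sigma> where "\<sigma> = T - \<epsilon> / 2"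
  have \<sigma>: "\<sigma> < T" using e by (simp add: \<sigma>_def)
  obtain \<eta> where \<eta>: "\<eta> > 0" and step: "\<forall>z\<in>K. snd z \<le> \<sigma> \<longrightarrow> (\<exists>z'\<in>K. \<exists>q z0. (d z0, z0, (q, 1)) \<in> tangent_proj_graph K \<and>
      norm q \<le> M \<and> dist z0 z \<le> \<delta> \<and> \<eta> \<le> snd z' - snd z \<and> snd z' - snd z \<le> 2 * \<delta> \<and>
      norm (fst z' - fst z - (snd z' - snd z) *\<^sub>R q) \<le> 4 * \<delta> * (1 + M) * (snd z' - snd z))"
    using uniform_step[OF d \<delta> \<sigma>] by (elim exE conjE) (rule that)
  have "\<exists>y \<tau>. euler d (M + 1) \<epsilon> \<tau> y \<and> y 0 = x0 \<and> (\<sigma> < \<tau> \<or> real k * \<eta> \<le> \<tau>)" for k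
  proof (induction k)
    case 0
    have "(M + 1)-lipschitz_on UNIV (\<lambda>_. x0)" using M by (intro lipschitz_onI) auto
    then have "euler d (M + 1) \<epsilon> 0 (\<lambda>_. x0)" using z0 unfolding euler_def by auto
    then show ?case by (intro exI[of _ "\<lambda>_. x0"] exI[of _ 0]) auto
  next
    case (Suc k)
    then obtain y \<tau> where y: "euler d (M + 1) \<epsilon> \<tau> y" "y 0 = x0" "\<sigma> < \<tau> \<or> real k * \<eta> \<le> \<tau>" by blast
    show ?case
    proof (cases "\<sigma> < \<tau>")
      case True
      then show ?thesis using y by blast
    next
      case False
      have "(y \<tau>, \<tau>) \<in> K" using y(1) by (simp add: euler_def)
      from step[rule_format, OF this] False obtain z' q z0 where z': "z' \<in> K" "(d z0, z0, (q, 1)) \<in> tangent_proj_graph K"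
        "norm q \<le> M" "dist z0 (y \<tau>, \<tau>) \<le> \<delta>" "\<eta> \<le> snd z' - \<tau>" "snd z' - \<tau> \<le> 2 * \<delta>"
        "norm (fst z' - y \<tau> - (snd z' - \<tau>) *\<^sub>R q) \<le> 4 * \<delta> * (1 + M) * (snd z' - \<tau>)" by auto
      define \<Delta> where "\<Delta> = snd z' - \<tau>"
      have \<Delta>: "\<Delta> > 0" using z'(5) \<eta> by (simp add: \<Delta>_def)
      define V where "V = (fst z' - y \<tau>) /\<^sub>R \<Delta>"
      have "fst z' - y \<tau> - \<Delta> *\<^sub>R q = \<Delta> *\<^sub>R (V - q)" using \<Delta> by (simp add: V_def scaleR_diff_right)
      then have "\<Delta> * norm (V - q) \<le> \<Delta> * (4 * \<delta> * (1 + M))"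
        using z'(7) \<Delta> by (simp add: \<Delta>_def[symmetric] mult.commute)
      then have Vq: "norm (V - q) \<le> 4 * \<delta> * (1 + M)" using \<Delta> by simp
      also have "4 * \<delta> * (1 + M) \<le> 4 * \<delta> * (M + 2)" using \<delta>(1) by (intro mult_left_mono) auto
      finally have Vq: "norm (V - q) \<le> \<epsilon>" "norm (V - q) \<le> 1" using \<delta>M by auto
      have "norm V \<le> M + 1" using Vq(2) z'(3) norm_triangle_sub[of V q] by simp
      moreover have "dist z0 (y \<tau>, \<tau>) + (M + 1 + 1) * (snd z' - \<tau>) \<le> \<epsilon>"
      proof -
        have "(M + 1 + 1) * (snd z' - \<tau>) \<le> (M + 2) * (2 * \<delta>)" using z'(5,6) M \<delta> \<eta> by (intro mult_mono) auto
        moreover have "\<delta> \<le> (M + 2) * (2 * \<delta>)" using M \<delta>(1) mult_nonneg_nonneg[of M \<delta>] by (simp add: algebra_simps)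
        ultimately show ?thesis using z'(4) \<delta>M(1) by (simp add: algebra_simps)
      qed
      ultimately obtain y' where "euler d (M + 1) \<epsilon> (snd z') y'" "y' 0 = y 0"
        using euler_extend[OF y(1) z'(1) _ _ _ Vq(1) z'(2)] \<Delta> unfolding V_def \<Delta>_def by auto
      moreover have "real (Suc k) * \<eta> \<le> snd z'" using y(3) False z'(5) by (simp add: algebra_simps)
      ultimately show ?thesis using y(2) by (intro exI[of _ y'] exI[of _ "snd z'"]) auto
    qed
  qed
  note * = this
  obtain k where "\<sigma> < real k * \<eta>" using reals_Archimedean3[OF \<eta>] by blast
  then have "\<exists>y \<tau>. euler d (M + 1) \<epsilon> \<tau> y \<and> y 0 = x0 \<and> \<sigma> < \<tau>" using *[of k] by fastforce
  then obtain y \<tau> where "euler d (M + 1) \<epsilon> \<tau> y" "y 0 = x0" "\<sigma> < \<tau>" by blast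
  moreover have "T - \<epsilon> < \<sigma>" using e by (simp add: \<sigma>_def)
  ultimately have "euler d (M + 1) \<epsilon> \<tau> y \<and> y 0 = x0 \<and> T - \<epsilon> < \<tau>" by simp
  then show ?thesis by blast
qed

end

section \<open>Existence of solutions\<close>

text \<open>A rational placed in the gap to the right of each such point increases strictly with the
  point.\<close>

lemma countable_right_isolated:
  fixes E :: "real set"
  shows "countable {s \<in> E. \<exists>\<delta>>0. E \<inter> {s<..<s + \<delta>} = {}}" (is "countable ?I")
proof -
  have ex: "\<exists>q. q \<in> \<rat> \<and> s < q \<and> E \<inter> {s<..<q} = {}" if s: "s \<in> ?I" for s
  proof -
    have "\<exists>\<delta>>0. E \<inter> {s<..<s + \<delta>} = {}" using s unfolding mem_Collect_eq by (rule conjunct2)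
    then obtain \<delta> where \<delta>: "\<delta> > 0" "E \<inter> {s<..<s + \<delta>} = {}" by blast
    have "s < s + \<delta>" using \<delta>(1) by simp
    from Rats_dense_in_real[OF this] obtain q where q: "q \<in> \<rat>" "s < q" "q < s + \<delta>" by blast
    then have "{s<..<q} \<subseteq> {s<..<s + \<delta>}" by auto
    then have "E \<inter> {s<..<q} = {}" using \<delta>(2) by blast
    then show ?thesis using q(1,2) by blast
  qed
  define Q where "Q s = (SOME q. q \<in> \<rat> \<and> s < q \<and> E \<inter> {s<..<q} = {})" for s
  have Q: "Q s \<in> \<rat>" "s < Q s" "E \<inter> {s<..<Q s} = {}" if "s \<in> ?I" for s
    using someI_ex[OF ex[OF that]] by (simp_all add: Q_def)
  have lt: "Q a < Q b" if ab: "a \<in> ?I" "b \<in> ?I" "a < b" for a b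
  proof -
    have "b \<in> E" using ab(2) unfolding mem_Collect_eq by (rule conjunct1)
    then have "b \<notin> {a<..<Q a}" using Q(3)[OF ab(1)] by (metis IntI empty_iff)
    then show ?thesis using Q(2)[OF ab(2)] ab(3) by auto
  qed
  have "inj_on Q ?I"
  proof (rule inj_onI)
    fix a b assume ab: "a \<in> ?I" "b \<in> ?I" "Q a = Q b"
    show "a = b" using lt[OF ab(1,2)] lt[OF ab(2,1)] ab(3) by (cases a b rule: linorder_cases) auto
  qed
  moreover have "countable (Q ` ?I)" using Q(1) by (intro countable_subset[OF _ countable_rat]) blast
  ultimately show ?thesis by (rule countable_image_inj_on[rotated])
qed

text \<open>For c in a countable dense set and each m, consider the times at which V meets the ball
  of radius 1 / (m + 1) about c. If t is not isolated from the right in any of these sets, every q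
  in V t is approximated at later times; the discarded times form countably many countable
  sets.\<close>

lemma right_accumulation:
  fixes V :: "real \<Rightarrow> 'a::euclidean_space set"
  obtains N where "countable N"
    "\<And>t q \<delta>. t \<notin> N \<Longrightarrow> q \<in> V t \<Longrightarrow> \<delta> > 0 \<Longrightarrow> \<exists>s q'. t < s \<and> s < t + \<delta> \<and> q' \<in> V s \<and> norm (q' - q) < \<delta>"
proof -
  obtain D :: "'a set" where D: "countable D" "\<And>X. open X \<Longrightarrow> X \<noteq> {} \<Longrightarrow> \<exists>d\<in>D. d \<in> X"
    using countable_dense_setE by metis
  define E where "E c m = {s. \<exists>q\<in>V s. norm (q - c) < inverse (real (Suc m))}" for c m
  define I where "I c m = {s \<in> E c m. \<exists>\<delta>>0. E c m \<inter> {s<..<s + \<delta>} = {}}" for c m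
  show ?thesis
  proof (rule that[of "\<Union>c\<in>D. \<Union>m. I c m"])
    show "countable (\<Union>c\<in>D. \<Union>m. I c m)"
      unfolding I_def by (intro countable_UN D(1) countable_right_isolated countableI_type)
    fix t q and \<delta> :: real assume t: "t \<notin> (\<Union>c\<in>D. \<Union>m. I c m)" and q: "q \<in> V t" and \<delta>: "\<delta> > 0"
    obtain m where m: "inverse (real (Suc m)) < \<delta> / 2" using reals_Archimedean[of "\<delta> / 2"] \<delta> by auto
    obtain c where c: "c \<in> D" "c \<in> ball q (inverse (real (Suc m)))"
      using D(2)[of "ball q (inverse (real (Suc m)))"] by auto
    then have "t \<in> E c m" using q by (auto simp: E_def dist_norm)
    moreover have "t \<notin> I c m" using t c(1) by blast
    ultimately have "E c m \<inter> {t<..<t + \<delta>} \<noteq> {}" using \<delta> unfolding I_def by blast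
    then obtain s q' where s: "t < s" "s < t + \<delta>" "q' \<in> V s" "norm (q' - c) < inverse (real (Suc m))"
      by (auto simp: E_def)
    have "norm (q' - q) \<le> norm (q' - c) + norm (c - q)" using norm_triangle_ineq[of "q' - c" "c - q"] by simp
    also have "\<dots> < \<delta>" using s(4) c(2) m by (simp add: dist_norm norm_minus_commute)
    finally show "\<exists>s q'. t < s \<and> s < t + \<delta> \<and> q' \<in> V s \<and> norm (q' - q) < \<delta>" using s by blast
  qed
qed

lemma G_mapI:
  assumes "(d, (x, t), y) \<in> closure (tangent_proj_graph K)" "(x, t) \<in> K"
  shows "y \<in> G_map K d x t"
  unfolding G_map_def mem_Collect_eq in_closure_of
proof (intro conjI allI impI)
  show "(d, (x, t), y) \<in> topspace (top_of_set (UNIV \<times> K \<times> UNIV))" using assms(2) by simp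
  fix U assume U: "(d, (x, t), y) \<in> U \<and> openin (top_of_set (UNIV \<times> K \<times> UNIV)) U"
  then obtain W where W: "open W" "U = (UNIV \<times> K \<times> UNIV) \<inter> W" by (auto simp: openin_open)
  then have "W \<inter> tangent_proj_graph K \<noteq> {}"
    using U assms(1) open_Int_closure_eq_empty[OF W(1)] by blast
  moreover have "tangent_proj_graph K \<subseteq> UNIV \<times> K \<times> UNIV" by (auto simp: tangent_proj_graph_def)
  ultimately show "\<exists>z. z \<in> tangent_proj_graph K \<and> z \<in> U" unfolding W(2) by blast
qed

lemma has_vector_derivative_sequence:
  fixes x :: "real \<Rightarrow> 'a::real_normed_vector"
  assumes "(x has_vector_derivative v) (at t)" "\<And>k. s k \<noteq> t" "s \<longlonglongrightarrow> t"
  shows "(\<lambda>k. (x (s k) - x t) /\<^sub>R (s k - t)) \<longlonglongrightarrow> v"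
proof -
  have "((\<lambda>y. ((x y - x t) - (y - t) *\<^sub>R v) /\<^sub>R norm (y - t)) \<longlongrightarrow> 0) (at t)"
    using assms(1) unfolding has_vector_derivative_def has_derivative_at_within by blast
  then have "(\<lambda>k. ((x (s k) - x t) - (s k - t) *\<^sub>R v) /\<^sub>R norm (s k - t)) \<longlonglongrightarrow> 0"
    by (rule filterlim_compose) (use assms(2,3) in \<open>simp add: filterlim_at\<close>)
  from tendsto_norm[OF this]
  have "(\<lambda>k. norm (((x (s k) - x t) - (s k - t) *\<^sub>R v) /\<^sub>R norm (s k - t))) \<longlonglongrightarrow> 0" by simp
  moreover have "norm (((x (s k) - x t) - (s k - t) *\<^sub>R v) /\<^sub>R norm (s k - t)) =
      norm ((x (s k) - x t) /\<^sub>R (s k - t) - v)" for k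
  proof -
    have "(x (s k) - x t) /\<^sub>R (s k - t) - v = ((x (s k) - x t) - (s k - t) *\<^sub>R v) /\<^sub>R (s k - t)"
      using assms(2)[of k] by (simp add: scaleR_diff_right)
    then show ?thesis by simp
  qed
  ultimately have "(\<lambda>k. norm ((x (s k) - x t) /\<^sub>R (s k - t) - v)) \<longlonglongrightarrow> 0" by (simp only:)
  then show ?thesis by (simp add: tendsto_norm_zero_iff LIM_zero_iff)
qed

locale definable_moving_set = o_minimal_coordinates S e + moving_set T L C
  for S :: "nat \<Rightarrow> real list set set" and e :: "nat \<Rightarrow> 'n::finite"
    and T L :: real and C :: "real \<Rightarrow> (real ^ 'n) set" +
  assumes definable: "definable_multimap S e {0..T} C"
begin

lemma enc_K: "enc ` K \<in> S N"
proof -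
  have "enc (x, t) = t # coord_list e x" for x t
    by (simp add: enc_def N_def comp_def coord_list_def map_upt_Suc del: upt_Suc)
  then have "enc ` K = {t # coord_list e x |t x. t \<in> {0..T} \<and> x \<in> C t}"
    by (auto simp: space_time_graph_def image_def)
  then show ?thesis using definable by (simp add: definable_multimap_def N_def)
qed

text \<open>The values Pr G with the closure taken in the whole space, which is convenient for
  sequences; \<open>G_mapI\<close> returns to the relative closure at base points in K.\<close>

definition velocities :: "real ^ 'n \<Rightarrow> (real ^ 'n) \<times> real \<Rightarrow> (real ^ 'n) set" where
  "velocities D z = {q. (D, z, (q, 1)) \<in> closure (tangent_proj_graph K)}"

lemma velocities_approx:
  assumes "q \<in> velocities D z" "\<delta> > 0"
  shows "\<exists>D' z' q'. (D', z', (q', 1)) \<in> tangent_proj_graph K \<and> norm (D' - D) < \<delta> \<and> norm (z' - z) < \<delta> \<and> norm (q' - q) < \<delta>"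
proof -
  obtain p where p: "p \<in> tangent_proj_graph K" "dist p (D, z, (q, 1)) < \<delta>"
    using assms by (auto simp: velocities_def closure_approachable)
  obtain D' z' q' r where pe: "p = (D', z', (q', r))" by (metis prod.collapse)
  then have "r = 1" using tangent_proj_graphD(2)[of D' z' "(q', r)" K] p(1) by simp
  have "dist D' D < \<delta>" "dist (z', (q', r)) (z, (q, 1)) < \<delta>"
    using p(2) dist_fst_le[of p "(D, z, (q, 1))"] dist_snd_le[of p "(D, z, (q, 1))"] by (auto simp: pe)
  moreover from this(2) have "dist z' z < \<delta>" "dist (q', r) (q, 1) < \<delta>"
    using dist_fst_le[of "(z', (q', r))" "(z, (q, 1))"] dist_snd_le[of "(z', (q', r))" "(z, (q, 1))"] by auto
  moreover from this(2) have "dist q' q < \<delta>"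
    using dist_fst_le[of "(q', r)" "(q, 1)"] by auto
  moreover have "(D', z', (q', 1)) \<in> tangent_proj_graph K" using p(1) unfolding pe \<open>r = 1\<close> .
  ultimately show ?thesis unfolding dist_norm by blast
qed

lemma velocitiesI:
  assumes "\<And>k::nat. (Dk k, zk k, (qk k, 1)) \<in> tangent_proj_graph K" "Dk \<longlonglongrightarrow> D" "zk \<longlonglongrightarrow> z" "qk \<longlonglongrightarrow> q"
  shows "q \<in> velocities D z"
proof -
  have "(\<lambda>k. (Dk k, zk k, (qk k, 1::real))) \<longlonglongrightarrow> (D, z, (q, 1))"
    using assms(2-4) by (intro tendsto_intros)
  then show ?thesis
    unfolding velocities_def mem_Collect_eq closure_sequential
    by (intro exI[of _ "\<lambda>k. (Dk k, zk k, (qk k, 1))"] conjI allI assms(1))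
qed

text \<open>The velocities accumulating at q from later times are again only limits, so each is
  replaced by a genuine projection at a point near the curve. Chosen close enough, these points
  still approach (x t, t) in direction (v, 1).\<close>

lemma projection_formula:
  fixes d :: "(real ^ 'n) \<times> real \<Rightarrow> real ^ 'n"
  assumes d: "continuous_on UNIV d" and x: "continuous_on UNIV x"
    and deriv: "(x has_vector_derivative v) (at t)"
    and acc: "\<And>\<delta>. \<delta> > 0 \<Longrightarrow> \<exists>s q'. t < s \<and> s < t + \<delta> \<and> q' \<in> velocities (d (x s, s)) (x s, s) \<and> norm (q' - q) < \<delta>"
  shows "(d (x t, t) - q) \<bullet> (v - q) \<le> 0"
proof -
  define \<delta> where "\<delta> k = inverse (real (Suc k))" for k
  have \<delta>: "\<delta> k > 0" for k by (simp add: \<delta>_def)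
  have \<delta>0: "\<delta> \<longlonglongrightarrow> 0" unfolding \<delta>_def by (rule LIMSEQ_inverse_real_of_nat)
  have "\<exists>s q'. t < s \<and> s < t + \<delta> k \<and> q' \<in> velocities (d (x s, s)) (x s, s) \<and> norm (q' - q) < \<delta> k" for k
    using acc[OF \<delta>] .
  then obtain s p where s: "\<And>k. t < s k" "\<And>k. s k < t + \<delta> k"
    and p: "\<And>k. p k \<in> velocities (d (x (s k), s k)) (x (s k), s k)" "\<And>k. norm (p k - q) < \<delta> k" by metis
  \<comment> \<open>The factor s k - t makes the displacement negligible against the elapsed time;
    the minimum with 1 makes it a null sequence as well.\<close>
  define \<rho> where "\<rho> k = \<delta> k * min 1 (s k - t)" for k
  have \<rho>: "\<rho> k > 0" for k using \<delta>[of k] s(1)[of k] by (simp add: \<rho>_def)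
  have \<rho>\<delta>: "\<rho> k \<le> \<delta> k" "\<rho> k \<le> \<delta> k * (s k - t)" for k
    using \<delta>[of k] mult_left_mono[of "min 1 (s k - t)" 1 "\<delta> k"] mult_left_mono[of "min 1 (s k - t)" "s k - t" "\<delta> k"]
    by (auto simp: \<rho>_def)
  have "\<exists>D' z' q'. (D', z', (q', 1)) \<in> tangent_proj_graph K \<and> norm (D' - d (x (s k), s k)) < \<rho> k \<and>
      norm (z' - (x (s k), s k)) < \<rho> k \<and> norm (q' - p k) < \<rho> k" for k
    by (rule velocities_approx[OF p(1) \<rho>])
  then obtain D' z' q' where g: "\<And>k. (D' k, z' k, (q' k, 1)) \<in> tangent_proj_graph K"
    and D': "\<And>k. norm (D' k - d (x (s k), s k)) < \<rho> k" and z': "\<And>k. norm (z' k - (x (s k), s k)) < \<rho> k"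
    and q': "\<And>k. norm (q' k - p k) < \<rho> k" by metis
  have null: "f \<longlonglongrightarrow> l" if "\<And>k. norm (f k - g k) < \<rho> k" "g \<longlonglongrightarrow> l" for f g :: "nat \<Rightarrow> real ^ 'n" and l
  proof -
    have "(\<lambda>k. f k - g k) \<longlonglongrightarrow> 0"
      by (rule Lim_null_comparison[OF _ \<delta>0]) (intro always_eventually allI order_trans[OF less_imp_le[OF that(1)] \<rho>\<delta>(1)])
    from tendsto_add[OF this that(2)] show ?thesis by simp
  qed
  have "(\<lambda>k. s k - t) \<longlonglongrightarrow> 0"
    by (rule Lim_null_comparison[OF _ \<delta>0]) (use s in \<open>intro always_eventually allI, simp add: abs_le_iff less_imp_le algebra_simps\<close>)
  then have st: "s \<longlonglongrightarrow> t" by (simp add: LIM_zero_iff)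
  have xs: "(\<lambda>k. x (s k)) \<longlonglongrightarrow> x t"
    using x st by (intro isCont_tendsto_compose[of t x]) (auto simp: continuous_on_eq_continuous_at)
  have ds: "(\<lambda>k. d (x (s k), s k)) \<longlonglongrightarrow> d (x t, t)"
    using d by (intro isCont_tendsto_compose[of "(x t, t)" d] tendsto_Pair xs st) (auto simp: continuous_on_eq_continuous_at)
  have "(\<lambda>k. p k - q) \<longlonglongrightarrow> 0"
    by (rule Lim_null_comparison[OF _ \<delta>0]) (intro always_eventually allI less_imp_le p(2))
  then have pq: "p \<longlonglongrightarrow> q" by (simp add: LIM_zero_iff)
  have "(\<lambda>k. (z' k - (x (s k), s k)) /\<^sub>R (s k - t)) \<longlonglongrightarrow> 0"
  proof (rule Lim_null_comparison[OF _ \<delta>0], intro always_eventually allI)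
    fix k
    have "norm (z' k - (x (s k), s k)) \<le> \<delta> k * (s k - t)" using z'[of k] \<rho>\<delta>(2)[of k] by linarith
    then show "norm ((z' k - (x (s k), s k)) /\<^sub>R (s k - t)) \<le> \<delta> k"
      using s(1)[of k] unfolding norm_scaleR by (simp add: divide_inverse_commute[symmetric] pos_divide_le_eq)
  qed
  moreover have "(\<lambda>k. ((x (s k) - x t) /\<^sub>R (s k - t), 1::real)) \<longlonglongrightarrow> (v, 1)"
    using s(1) by (intro tendsto_Pair tendsto_const has_vector_derivative_sequence[OF deriv _ st]) (metis less_irrefl)
  ultimately have "(\<lambda>k. (z' k - (x (s k), s k)) /\<^sub>R (s k - t) + ((x (s k) - x t) /\<^sub>R (s k - t), 1)) \<longlonglongrightarrow> 0 + (v, 1)"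
    by (rule tendsto_add)
  moreover have "(z' k - (x (s k), s k)) /\<^sub>R (s k - t) + ((x (s k) - x t) /\<^sub>R (s k - t), 1) = (z' k - (x t, t)) /\<^sub>R (s k - t)" for k
  proof -
    have "((x (s k) - x t) /\<^sub>R (s k - t), 1) = ((x (s k), s k) - (x t, t)) /\<^sub>R (s k - t)"
      using s(1)[of k] by simp
    then show ?thesis by (simp only: scaleR_add_right[symmetric]) simp
  qed
  ultimately have dir: "(\<lambda>k. (z' k - (x t, t)) /\<^sub>R (s k - t)) \<longlonglongrightarrow> (v, 1)" by (simp only: add_0_left)
  show ?thesis
  proof (rule tangent_proj_directional_limit[OF enc_K closed_K g null[OF D' ds] null[OF q' pq] _ _ dir])
    show "(\<lambda>k. s k - t) \<longlonglongrightarrow> 0" by fact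
  qed (use s(1) in simp)
qed

text \<open>
  If \<open>v\<close> were not admissible, the projection formula \<open>(D - q) \<bullet> (v - q) \<le> 0\<close>, that is
  \<open>(D - v) \<bullet> (v - q) \<le> - (norm (v - q))\<^sup>2\<close>, would separate \<open>v\<close> strictly from all nearby velocities,
  hence from the difference quotients of the Euler curves.
\<close>

lemma limit_velocity:
  fixes d :: "(real ^ 'n) \<times> real \<Rightarrow> real ^ 'n"
  assumes d: "continuous_on UNIV d"
    and y: "\<And>k::nat. euler d M (\<epsilon> k) (\<tau> k) (y k)" and \<epsilon>: "\<epsilon> \<longlonglongrightarrow> 0" and \<tau>: "\<tau> \<longlonglongrightarrow> T"
    and lim: "\<And>s. s \<in> {0..T} \<Longrightarrow> (\<lambda>k. y k s) \<longlonglongrightarrow> x s"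
    and t: "0 < t" "t < T" and deriv: "(x has_vector_derivative v) (at t)"
    and pf: "\<And>q. q \<in> velocities (d (x t, t)) (x t, t) \<Longrightarrow> (d (x t, t) - q) \<bullet> (v - q) \<le> 0"
  shows "v \<in> velocities (d (x t, t)) (x t, t)"
proof (rule ccontr)
  assume v: "v \<notin> velocities (d (x t, t)) (x t, t)"
  define D where "D = d (x t, t)"
  define a where "a = D - v"
  \<comment> \<open>Uniform separation by compactness: a violating sequence would have a limit q
    with a \<bullet> (v - q) \<ge> 0, and the projection formula would then force q = v.\<close>
  have "\<exists>c>0. \<forall>D' z' q'. (D', z', (q', 1)) \<in> tangent_proj_graph K \<and> norm (D' - D) < c \<and> norm (z' - (x t, t)) < c
     \<longrightarrow> a \<bullet> (v - q') \<le> - c"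
  proof (rule ccontr)
    assume n: "\<not> ?thesis"
    \<comment> \<open>The bound T - t keeps the base points before time T, where projections are
      bounded by \<open>norm_tangent_proj\<close>.\<close>
    define \<delta> where "\<delta> k = min (T - t) (inverse (real (Suc k)))" for k
    have \<delta>: "\<delta> k > 0" for k using t by (simp add: \<delta>_def)
    have \<delta>0: "\<delta> \<longlonglongrightarrow> 0"
      by (rule Lim_null_comparison[OF _ LIMSEQ_inverse_real_of_nat]) (use \<delta> t in \<open>simp add: \<delta>_def\<close>)
    have "\<exists>D' z' q'. (D', z', (q', 1)) \<in> tangent_proj_graph K \<and> norm (D' - D) < \<delta> k \<and> norm (z' - (x t, t)) < \<delta> k \<and>
      \<not> a \<bullet> (v - q') \<le> - \<delta> k" for k
      using n \<delta>[of k] by blast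
    then obtain D' z' q' where g: "\<And>k. (D' k, z' k, (q' k, 1)) \<in> tangent_proj_graph K"
      and D': "\<And>k. norm (D' k - D) < \<delta> k" and z': "\<And>k. norm (z' k - (x t, t)) < \<delta> k"
      and q': "\<And>k. \<not> a \<bullet> (v - q' k) \<le> - \<delta> k" by metis
    have "(\<lambda>k. D' k - D) \<longlonglongrightarrow> 0" "(\<lambda>k. z' k - (x t, t)) \<longlonglongrightarrow> 0"
      by (rule Lim_null_comparison[OF _ \<delta>0], intro always_eventually allI less_imp_le D' z')+
    then have D'lim: "D' \<longlonglongrightarrow> D" and z'lim: "z' \<longlonglongrightarrow> (x t, t)" by (simp_all only: LIM_zero_iff)
    have "norm (q' k) \<le> 2 * (norm D + (T - t)) + L" for k
    proof -
      have dT: "\<delta> k \<le> T - t" by (simp add: \<delta>_def)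
      have "\<bar>snd (z' k) - t\<bar> \<le> norm (z' k - (x t, t))"
        using norm_snd_le[of "snd (z' k) - t" "fst (z' k) - x t"] by (cases "z' k") simp
      then have "snd (z' k) < T" using z'[of k] dT by linarith
      from norm_tangent_proj[OF g this] have "norm (q' k) \<le> 2 * norm (D' k) + L" .
      moreover have "norm (D' k) \<le> norm D + (T - t)" using norm_triangle_sub[of "D' k" D] D'[of k] dT by linarith
      then have "2 * norm (D' k) \<le> 2 * (norm D + (T - t))" by simp
      ultimately show ?thesis by simp
    qed
    then have "bounded (range q')" by (intro boundedI) auto
    then obtain q r where r: "strict_mono r" "(q' \<circ> r) \<longlonglongrightarrow> q"
      using bounded_imp_convergent_subsequence by blast
    have qv: "q \<in> velocities D (x t, t)"
      by (rule velocitiesI[OF _ LIMSEQ_subseq_LIMSEQ[OF D'lim r(1)] LIMSEQ_subseq_LIMSEQ[OF z'lim r(1)] r(2)])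
        (use g in \<open>simp add: o_def\<close>)
    have "0 \<le> a \<bullet> (v - q)"
    proof (rule LIMSEQ_le)
      show "(\<lambda>k. - (\<delta> \<circ> r) k) \<longlonglongrightarrow> 0" using tendsto_minus[OF LIMSEQ_subseq_LIMSEQ[OF \<delta>0 r(1)]] by simp
      show "(\<lambda>k. a \<bullet> (v - (q' \<circ> r) k)) \<longlonglongrightarrow> a \<bullet> (v - q)" by (intro tendsto_intros r)
      show "\<exists>N. \<forall>n\<ge>N. - (\<delta> \<circ> r) n \<le> a \<bullet> (v - (q' \<circ> r) n)" using q' by (auto simp: not_le less_imp_le)
    qed
    moreover have "(D - q) \<bullet> (v - q) = a \<bullet> (v - q) + (v - q) \<bullet> (v - q)"
      by (simp add: a_def inner_diff_left algebra_simps)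
    moreover have "(D - q) \<bullet> (v - q) \<le> 0" using pf qv by (simp add: D_def)
    ultimately have "(v - q) \<bullet> (v - q) \<le> 0" by linarith
    then have "v = q" by (metis inner_eq_zero_iff inner_ge_zero antisym right_minus_eq)
    then show False using qv v by (simp add: D_def)
  qed
  then obtain c where c: "c > 0" "\<And>D' z' q'. (D', z', (q', 1)) \<in> tangent_proj_graph K \<Longrightarrow> norm (D' - D) < c \<Longrightarrow>
     norm (z' - (x t, t)) < c \<Longrightarrow> a \<bullet> (v - q') \<le> - c" by blast
  have "isCont d (x t, t)" using d by (simp add: continuous_on_eq_continuous_at)
  then obtain \<rho>0 where \<rho>0: "\<rho>0 > 0" "\<And>z. dist z (x t, t) < \<rho>0 \<Longrightarrow> dist (d z) D < c"
    using c(1) unfolding continuous_at_eps_delta D_def by blast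
  define \<rho> where "\<rho> = min c \<rho>0"
  have \<rho>: "\<rho> > 0" using c(1) \<rho>0(1) by (simp add: \<rho>_def)
  have near: "a \<bullet> (v - q') \<le> - c" if "(d z', z', (q', 1)) \<in> tangent_proj_graph K" "dist z' (x t, t) < \<rho>" for z' q'
    using c(2)[OF that(1)] \<rho>0(2)[of z'] that(2) by (simp add: \<rho>_def dist_norm)
  have M: "M \<ge> 0" using lipschitz_on_nonneg y unfolding euler_def by blast
  \<comment> \<open>Base points remain within \<rho> of (x t, t): \<rho> / 2 for motion during time
    \<eta>, and \<rho> / 4 each for convergence at t and for the distance to the Euler
    curve.\<close>
  define \<eta> where "\<eta> = min (\<rho> / (2 * (M + 1))) ((T - t) / 2)"
  have \<eta>: "\<eta> > 0" using \<rho> M t by (simp add: \<eta>_def)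
  have "\<eta> \<le> \<rho> / (2 * (M + 1))" unfolding \<eta>_def by (rule min.cobounded1)
  then have \<eta>\<rho>: "(M + 1) * \<eta> \<le> \<rho> / 2" using M by (simp add: field_simps)
  have "\<eta> \<le> (T - t) / 2" unfolding \<eta>_def by (rule min.cobounded2)
  then have \<eta>T: "t + \<eta> < T" using t by (simp add: field_simps)
  have "\<forall>\<^sub>F k in sequentially. \<epsilon> k < \<rho> / 4 \<and> dist (y k t) (x t) < \<rho> / 4 \<and> t + \<eta> < \<tau> k \<and> norm a * \<epsilon> k < c / 2"
  proof (intro eventually_conj)
    show "\<forall>\<^sub>F k in sequentially. \<epsilon> k < \<rho> / 4" using \<rho> by (intro order_tendstoD(2)[OF \<epsilon>]) auto
    show "\<forall>\<^sub>F k in sequentially. dist (y k t) (x t) < \<rho> / 4" using \<rho> t by (intro tendstoD lim) auto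
    show "\<forall>\<^sub>F k in sequentially. t + \<eta> < \<tau> k" by (rule order_tendstoD(1)[OF \<tau> \<eta>T])
    have "(\<lambda>k. norm a * \<epsilon> k) \<longlonglongrightarrow> norm a * 0" by (intro tendsto_intros \<epsilon>)
    then show "\<forall>\<^sub>F k in sequentially. norm a * \<epsilon> k < c / 2" using c(1) by (intro order_tendstoD(2)) auto
  qed
  then obtain k0 where k0: "\<And>k. k \<ge> k0 \<Longrightarrow> \<epsilon> k < \<rho> / 4 \<and> dist (y k t) (x t) < \<rho> / 4 \<and> t + \<eta> < \<tau> k \<and> norm a * \<epsilon> k < c / 2"
    unfolding eventually_sequentially by blast
  have incr: "a \<bullet> ((b - t) *\<^sub>R v - (y k b - y k t)) \<le> - (c / 2) * (b - t)" if k: "k \<ge> k0" and b: "t \<le> b" "b \<le> t + \<eta>" for k b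
  proof -
    \<comment> \<open>Half of c is spent on the difference between the Euler velocity and the
      projection; the other half is the remaining rate of decrease.\<close>
    define \<phi> where "\<phi> r = a \<bullet> (r *\<^sub>R v - y k r) + (c / 2) * r" for r
    have lip: "M-lipschitz_on UNIV (y k)" using y by (simp add: euler_def)
    have "\<phi> b \<le> \<phi> t"
    proof (rule antimono_of_local_right[OF b(1)])
      have "continuous_on {t..b} (y k)" using lipschitz_on_continuous_on[OF lip] continuous_on_subset by blast
      then show "continuous_on {t..b} \<phi>" unfolding \<phi>_def by (intro continuous_intros)
      fix r assume r: "t \<le> r" "r < b"
      then have "0 \<le> r" "r < \<tau> k" using t b k0[OF k] by auto
      then obtain \<theta> V q z0 where \<theta>: "\<theta> > 0" "\<And>s. s \<in> {r..r+\<theta>} \<Longrightarrow> y k s = y k r + (s - r) *\<^sub>R V" "norm (V - q) \<le> \<epsilon> k"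
       "(d z0, z0, (q, 1)) \<in> tangent_proj_graph K" "dist z0 (y k r, r) \<le> \<epsilon> k"
        using y[of k] unfolding euler_def by meson
      have "dist (y k r) (x t) \<le> dist (y k r) (y k t) + dist (y k t) (x t)" by (rule dist_triangle)
      moreover have "dist (y k r) (y k t) \<le> M * (r - t)" using lipschitz_onD[OF lip, of r t] r by (simp add: dist_real_def)
      moreover have "dist (y k r, r) (x t, t) \<le> dist (y k r) (x t) + dist r t"
        unfolding dist_norm diff_Pair by (rule norm_Pair_le)
      moreover have "dist z0 (x t, t) \<le> dist z0 (y k r, r) + dist (y k r, r) (x t, t)" by (rule dist_triangle)
      moreover have "(M + 1) * (r - t) \<le> (M + 1) * \<eta>" using r b M by (intro mult_left_mono) auto
      ultimately have "dist z0 (x t, t) < \<rho>"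
        using \<theta>(5) k0[OF k] \<eta>\<rho> r by (simp add: dist_real_def algebra_simps)
      from near[OF \<theta>(4) this] have "a \<bullet> (v - q) \<le> - c" .
      moreover have "\<bar>a \<bullet> (V - q)\<bar> \<le> norm a * norm (V - q)" by (rule Cauchy_Schwarz_ineq2)
      moreover have "norm a * norm (V - q) \<le> norm a * \<epsilon> k" using \<theta>(3) by (intro mult_left_mono) auto
      moreover have "a \<bullet> (v - V) = a \<bullet> (v - q) - a \<bullet> (V - q)" by (simp add: inner_diff_right)
      ultimately have aV: "a \<bullet> (v - V) \<le> - (c / 2)" using k0[OF k] by linarith
      have "\<phi> s \<le> \<phi> r" if s: "r < s" "s < r + \<theta>" for s
      proof -
        have "s *\<^sub>R v - y k s = (r *\<^sub>R v - y k r) + (s - r) *\<^sub>R (v - V)"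
          using \<theta>(2)[of s] s by (simp add: algebra_simps)
        then have "\<phi> s - \<phi> r = (s - r) * (a \<bullet> (v - V)) + (c / 2) * (s - r)"
          by (simp add: \<phi>_def inner_add_right right_diff_distrib)
        also have "\<dots> = (s - r) * (a \<bullet> (v - V) + c / 2)" by (simp add: algebra_simps)
        also have "\<dots> \<le> 0" using aV s by (intro mult_nonneg_nonpos) auto
        finally show ?thesis by simp
      qed
      then show "\<forall>\<^sub>F s in at_right r. \<phi> s \<le> \<phi> r"
        unfolding eventually_at_right_field using \<theta>(1) by (intro exI[of _ "r + \<theta>"]) auto
    qed
    then show ?thesis by (simp add: \<phi>_def inner_diff_right algebra_simps diff_divide_distrib)
  qed
  \<comment> \<open>The integrated inequality survives the passage to the limit curve, where
    velocities need not converge; only afterwards does b tend to t.\<close>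
  have incr': "a \<bullet> ((b - t) *\<^sub>R v - (x b - x t)) \<le> - (c / 2) * (b - t)" if b: "t \<le> b" "b \<le> t + \<eta>" for b
  proof (rule LIMSEQ_le_const2)
    show "(\<lambda>k. a \<bullet> ((b - t) *\<^sub>R v - (y k b - y k t))) \<longlonglongrightarrow> a \<bullet> ((b - t) *\<^sub>R v - (x b - x t))"
      using t b \<eta>T by (intro tendsto_intros lim) auto
    show "\<exists>N. \<forall>n\<ge>N. a \<bullet> ((b - t) *\<^sub>R v - (y n b - y n t)) \<le> - (c / 2) * (b - t)" using incr b by blast
  qed
  define s where "s k = t + \<eta> * inverse (real (Suc k))" for k
  have s: "t < s k" "s k \<le> t + \<eta>" for k
    using \<eta> mult_left_mono[of "inverse (real (Suc k))" 1 \<eta>] by (auto simp: s_def inverse_le_1_iff)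
  have "s \<longlonglongrightarrow> t + \<eta> * 0" unfolding s_def by (intro tendsto_intros LIMSEQ_inverse_real_of_nat)
  then have st: "s \<longlonglongrightarrow> t" by simp
  have "(\<lambda>k. a \<bullet> (v - (x (s k) - x t) /\<^sub>R (s k - t))) \<longlonglongrightarrow> a \<bullet> (v - v)"
    using s(1) by (intro tendsto_intros has_vector_derivative_sequence[OF deriv _ st]) (metis less_irrefl)
  moreover have "a \<bullet> (v - (x (s k) - x t) /\<^sub>R (s k - t)) \<le> - (c / 2)" for k
  proof -
    have "(s k - t) *\<^sub>R (v - (x (s k) - x t) /\<^sub>R (s k - t)) = (s k - t) *\<^sub>R v - (x (s k) - x t)"
      using s(1)[of k] by (simp add: scaleR_diff_right)
    then have "(s k - t) * (a \<bullet> (v - (x (s k) - x t) /\<^sub>R (s k - t))) \<le> (s k - t) * (- (c / 2))"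
      using incr'[of "s k"] s[of k] by (metis inner_scaleR_right less_imp_le mult.commute)
    then show ?thesis by (rule mult_left_le_imp_le) (use s(1)[of k] in simp)
  qed
  ultimately have "a \<bullet> (v - v) \<le> - (c / 2)" by (intro LIMSEQ_le_const2) auto
  then show False using c(1) by simp
qed

end

lemma lipschitz_pointwise_limit:
  fixes y :: "nat \<Rightarrow> real \<Rightarrow> 'a::euclidean_space"
  assumes lip: "\<And>k. M-lipschitz_on UNIV (y k)" and y0: "\<And>k. y k 0 = x0" and T: "T \<ge> 0"
  obtains x r where "strict_mono (r :: nat \<Rightarrow> nat)" "M-lipschitz_on UNIV x"
    "\<And>s. s \<in> {0..T} \<Longrightarrow> (\<lambda>k. y (r k) s) \<longlonglongrightarrow> x s"
proof -
  have M: "M \<ge> 0" using lipschitz_on_nonneg[OF lip] .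
  have yd: "norm (y k s - y k t) \<le> M * \<bar>s - t\<bar>" for k s t
    using lipschitz_onD[OF lip, of s t k] by (simp add: dist_norm)
  have bd: "norm (y k s) \<le> norm x0 + M * T" if "s \<in> {0..T}" for k s
  proof -
    have "norm (y k s) \<le> norm x0 + norm (y k s - y k 0)" using norm_triangle_sub[of "y k s" x0] y0 by simp
    moreover have "M * \<bar>s - 0\<bar> \<le> M * T" using that M by (intro mult_left_mono) auto
    ultimately show ?thesis using yd[of k s 0] by linarith
  qed
  have eq: "\<exists>\<delta>>0. \<forall>k t. t \<in> {0..T} \<and> norm (s - t) < \<delta> \<longrightarrow> norm (y k s - y k t) < e" if "e > 0" for s e
  proof (intro exI[of _ "e / (M + 1)"] conjI allI impI)
    show "e / (M + 1) > 0" using that M by simp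
    fix k t assume t: "t \<in> {0..T} \<and> norm (s - t) < e / (M + 1)"
    then have "\<bar>s - t\<bar> * (M + 1) < e" using M by (simp add: pos_less_divide_eq)
    then have "M * \<bar>s - t\<bar> + \<bar>s - t\<bar> < e" by (simp add: algebra_simps)
    then show "norm (y k s - y k t) < e" using yd[of k s t] by linarith
  qed
  obtain g r where r: "strict_mono (r :: nat \<Rightarrow> nat)"
    and g: "\<And>e. 0 < e \<Longrightarrow> \<exists>N. \<forall>n s. n \<ge> N \<and> s \<in> {0..T} \<longrightarrow> norm (y (r n) s - g s) < e"
    using Arzela_Ascoli[of "{0..T}" y "norm x0 + M * T", OF compact_Icc bd eq] by metis
  have lim: "(\<lambda>k. y (r k) s) \<longlonglongrightarrow> g s" if "s \<in> {0..T}" for s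
  proof (rule LIMSEQ_I)
    fix e :: real assume "0 < e"
    then show "\<exists>N. \<forall>n\<ge>N. norm (y (r n) s - g s) < e" using g that by blast
  qed
  \<comment> \<open>The uniform limit lives on {0..T}; clamping the time extends it to the line with
    the same Lipschitz constant.\<close>
  define x where "x s = g (max 0 (min s T))" for s
  have "norm (g s - g t) \<le> M * \<bar>s - t\<bar>" if "s \<in> {0..T}" "t \<in> {0..T}" for s t
    by (rule LIMSEQ_le_const2[OF tendsto_norm[OF tendsto_diff[OF lim[OF that(1)] lim[OF that(2)]]]])
      (use yd in blast)
  then have gl: "norm (x s - x t) \<le> M * \<bar>max 0 (min s T) - max 0 (min t T)\<bar>" for s t
    using T unfolding x_def by simp
  have xlip: "M-lipschitz_on UNIV x"
  proof (rule lipschitz_onI[OF _ M])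
    fix s t
    have "M * \<bar>max 0 (min s T) - max 0 (min t T)\<bar> \<le> M * \<bar>s - t\<bar>"
      using M by (intro mult_left_mono) (auto simp: max_def min_def)
    then show "dist (x s) (x t) \<le> M * dist s t" using gl[of s t] by (simp add: dist_norm)
  qed
  have "x s = g s" if "s \<in> {0..T}" for s using that by (simp add: x_def)
  then have "(\<lambda>k. y (r k) s) \<longlonglongrightarrow> x s" if "s \<in> {0..T}" for s using lim that by simp
  from that[OF r xlip this] show ?thesis .
qed

lemma lipschitz_imp_absolutely_continuous_on:
  assumes "M-lipschitz_on UNIV f"
  shows "absolutely_continuous_on I f"
  unfolding absolutely_continuous_on_def
proof (intro allI impI)
  fix e :: real assume e: "0 < e"
  have M: "M \<ge> 0" using lipschitz_on_nonneg[OF assms] .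
  show "\<exists>\<delta>>0. \<forall>(m :: nat) a b. (\<forall>i<m. a i \<le> b i \<and> {a i..b i} \<subseteq> I) \<and>
      disjoint_family_on (\<lambda>i. {a i<..<b i}) {..<m} \<and> (\<Sum>i<m. b i - a i) < \<delta>
      \<longrightarrow> (\<Sum>i<m. dist (f (a i)) (f (b i))) < e"
  proof (intro exI[of _ "e / (M + 1)"] conjI allI impI, goal_cases)
    case 1
    then show ?case using e M by simp
  next
    case (2 m a b)
    have "(\<Sum>i<m. dist (f (a i)) (f (b i))) \<le> (\<Sum>i<m. M * (b i - a i))"
    proof (rule sum_mono)
      fix i assume "i \<in> {..<m}"
      then show "dist (f (a i)) (f (b i)) \<le> M * (b i - a i)"
        using lipschitz_onD[OF assms, of "a i" "b i"] 2 by (auto simp: dist_real_def)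
    qed
    also have "\<dots> = M * (\<Sum>i<m. b i - a i)" by (simp add: sum_distrib_left)
    also have "\<dots> \<le> M * (e / (M + 1))" using 2 M by (intro mult_left_mono) auto
    also have "\<dots> < e" using e M by (simp add: divide_less_eq algebra_simps)
    finally show ?case .
  qed
qed

theorem (in definable_moving_set) projection_process_solution_exists:
  fixes d :: "(real ^ 'n) \<times> real \<Rightarrow> real ^ 'n"
  assumes d: "continuous_on UNIV d" and x0: "x0 \<in> C 0"
  shows "\<exists>x. projection_process_solution T C d x0 x"
proof -
  have "compact (d ` K)" using compact_K continuous_on_subset[OF d] by (intro compact_continuous_image) auto
  then have "bounded (d ` K)" by (rule compact_imp_bounded)
  then obtain B where "\<forall>v\<in>d ` K. norm v \<le> B" unfolding bounded_iff by (rule exE)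
  then have B: "norm (d z) \<le> B" if "z \<in> K" for z using that by (rule bspec[OF _ imageI])
  \<comment> \<open>Speed bound for all projections of the drift over K, from
    \<open>norm_tangent_proj\<close>.\<close>
  define M where "M = 2 * B + L"
  have dM: "\<forall>z\<in>K. 2 * norm (d z) + L \<le> M" using B by (simp add: M_def)
  define \<epsilon> where "\<epsilon> k = inverse (real (Suc k))" for k
  have \<epsilon>: "\<epsilon> k > 0" for k by (simp add: \<epsilon>_def)
  have \<epsilon>0: "\<epsilon> \<longlonglongrightarrow> 0" unfolding \<epsilon>_def by (rule LIMSEQ_inverse_real_of_nat)
  have "\<exists>y \<tau>. euler d (M + 1) (\<epsilon> k) \<tau> y \<and> y 0 = x0 \<and> T - \<epsilon> k < \<tau>" for k
    by (rule euler_exists[OF dM x0 \<epsilon>])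
  then obtain y \<tau> where y: "\<And>k. euler d (M + 1) (\<epsilon> k) (\<tau> k) (y k)" "\<And>k. y k 0 = x0" "\<And>k. T - \<epsilon> k < \<tau> k"
    by metis
  have "\<tau> k \<le> T" for k using y(1)[of k] by (auto simp: euler_def K_iff)
  then have "(\<lambda>k. \<tau> k - T) \<longlonglongrightarrow> 0"
    by (intro Lim_null_comparison[OF _ \<epsilon>0] always_eventually allI)
      (use y(3) in \<open>auto simp: abs_le_iff less_imp_le algebra_simps\<close>)
  then have \<tau>T: "\<tau> \<longlonglongrightarrow> T" by (simp add: LIM_zero_iff)
  have ylip: "(M + 1)-lipschitz_on UNIV (y k)" for k using y(1) by (simp add: euler_def)
  obtain x r where r: "strict_mono (r :: nat \<Rightarrow> nat)" and xlip: "(M + 1)-lipschitz_on UNIV x"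
    and lim: "\<And>s. s \<in> {0..T} \<Longrightarrow> (\<lambda>k. y (r k) s) \<longlonglongrightarrow> x s"
    by (rule lipschitz_pointwise_limit[of "M + 1" y x0 T, OF ylip y(2) less_imp_le[OF T_pos]]) blast
  have xc: "continuous_on UNIV x" by (rule lipschitz_on_continuous_on[OF xlip])
  have \<epsilon>r: "(\<lambda>k. \<epsilon> (r k)) \<longlonglongrightarrow> 0" and \<tau>r: "(\<lambda>k. \<tau> (r k)) \<longlonglongrightarrow> T"
    using LIMSEQ_subseq_LIMSEQ[OF \<epsilon>0 r] LIMSEQ_subseq_LIMSEQ[OF \<tau>T r] by (simp_all add: o_def)
  have "x 0 = x0" using LIMSEQ_unique[OF lim[of 0]] y(2) T_pos by simp
  \<comment> \<open>Euler curves may leave K, but the base points of their projections lie in K and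
    converge to (x s, s).\<close>
  have inK: "(x s, s) \<in> K" if s: "0 \<le> s" "s < T" for s
  proof -
    have "\<exists>z\<in>K. dist z (x s, s) < e" if e: "e > 0" for e
    proof -
      have "\<forall>\<^sub>F k in sequentially. \<epsilon> (r k) < e / 2 \<and> dist (y (r k) s) (x s) < e / 2 \<and> s < \<tau> (r k)"
        using e s by (intro eventually_conj order_tendstoD(2)[OF \<epsilon>r] tendstoD[OF lim] order_tendstoD(1)[OF \<tau>r]) auto
      then obtain k where k: "\<epsilon> (r k) < e / 2" "dist (y (r k) s) (x s) < e / 2" "s < \<tau> (r k)"
        using eventually_happens'[OF sequentially_bot] by blast
      obtain q z0 where z0: "(d z0, z0, (q, 1)) \<in> tangent_proj_graph K" "dist z0 (y (r k) s, s) \<le> \<epsilon> (r k)"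
        using y(1)[of "r k"] s(1) k(3) unfolding euler_def by meson
      have "dist z0 (x s, s) \<le> dist z0 (y (r k) s, s) + dist (y (r k) s, s) (x s, s)" by (rule dist_triangle)
      moreover have "dist (y (r k) s, s) (x s, s) = dist (y (r k) s) (x s)" by (simp add: dist_prod_def)
      ultimately have "dist z0 (x s, s) < e" using z0(2) k by linarith
      then show ?thesis using tangent_proj_graphD(1)[OF z0(1)] by blast
    qed
    then show ?thesis using closed_approachable[OF closed_K] by blast
  qed
  have "closed {s. (x s, s) \<in> K}"
  proof -
    have "closed ((\<lambda>s. (x s, s)) -` K)"
      using xc by (intro continuous_closed_vimage closed_K continuous_intros) (auto simp: continuous_on_eq_continuous_at)
    then show ?thesis by (simp add: vimage_def)
  qed
  \<comment> \<open>Base points are available at times below T only; closedness of K adds the final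
    time.\<close>
  moreover have "{0..<T} \<subseteq> {s. (x s, s) \<in> K}" using inK by auto
  ultimately have "closure {0..<T} \<subseteq> {s. (x s, s) \<in> K}" by (rule closure_minimal[rotated])
  then have xK: "(x s, s) \<in> K" if "s \<in> {0..T}" for s using that T_pos by auto
  obtain N1 where N1: "negligible N1" "\<And>t. t \<notin> N1 \<Longrightarrow> \<exists>v. (x has_vector_derivative v) (at t)"
    using lipschitz_ae_has_vector_derivative[OF xlip] by blast
  obtain N2 where N2: "countable N2" "\<And>t q \<delta>. t \<notin> N2 \<Longrightarrow> q \<in> velocities (d (x t, t)) (x t, t) \<Longrightarrow> \<delta> > 0 \<Longrightarrow>
      \<exists>s q'. t < s \<and> s < t + \<delta> \<and> q' \<in> velocities (d (x s, s)) (x s, s) \<and> norm (q' - q) < \<delta>"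
    using right_accumulation[of "\<lambda>t. velocities (d (x t, t)) (x t, t)"] by blast
  \<comment> \<open>Discarded are the points of nondifferentiability, the countable set without
    accumulation from the right, and the endpoints, where no two-sided argument is possible.\<close>
  have good: "\<exists>v. (x has_vector_derivative v) (at t within {0..T}) \<and> v \<in> fst ` G_map K (d (x t, t)) (x t) t"
    if t: "t \<in> {0..T}" "t \<notin> N1 \<union> N2 \<union> {0, T}" for t
  proof -
    obtain v where v: "(x has_vector_derivative v) (at t)" using N1(2) t(2) by blast
    have pf: "(d (x t, t) - q) \<bullet> (v - q) \<le> 0" if "q \<in> velocities (d (x t, t)) (x t, t)" for q
      using t(2) that by (intro projection_formula[OF d xc v] N2(2)) auto
    have "v \<in> velocities (d (x t, t)) (x t, t)"
      by (rule limit_velocity[OF d y(1) \<epsilon>r \<tau>r lim _ _ v pf]) (use t in auto)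
    then have "(v, 1) \<in> G_map K (d (x t, t)) (x t) t"
      unfolding velocities_def using xK[OF t(1)] by (intro G_mapI) auto
    then have "v \<in> fst ` G_map K (d (x t, t)) (x t) t" by force
    then show ?thesis using has_vector_derivative_at_within[OF v] by blast
  qed
  have "N2 \<in> null_sets lborel" using N2(1) by (rule countable_imp_null_set_lborel)
  then have "negligible N2" unfolding negligible_iff_null_sets by (rule null_sets_completionI)
  then have "negligible (N1 \<union> N2 \<union> {0, T})"
    using N1(1) by (simp add: negligible_finite)
  then have "N1 \<union> N2 \<union> {0, T} \<in> null_sets lebesgue" by (simp add: negligible_iff_null_sets)
  then have "AE t in lebesgue. t \<notin> N1 \<union> N2 \<union> {0, T}" by (rule AE_not_in)
  then have "AE t in lebesgue. t \<in> {0..T} \<longrightarrow>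
      (\<exists>v. (x has_vector_derivative v) (at t within {0..T}) \<and> v \<in> fst ` G_map K (d (x t, t)) (x t) t)"
    by (rule AE_mp) (use good in \<open>intro AE_I2 impI, blast\<close>)
  then have "AE t in lebesgue_on {0..T}.
      \<exists>v. (x has_vector_derivative v) (at t within {0..T}) \<and> v \<in> fst ` G_map K (d (x t, t)) (x t) t"
    by (subst AE_restrict_space_iff) auto
  then have "projection_process_solution T C d x0 x"
    unfolding projection_process_solution_def
    using lipschitz_imp_absolutely_continuous_on[OF xlip] \<open>x 0 = x0\<close> xK by (auto simp: K_iff)
  then show ?thesis by blast
qed

theorem theorem4p4:
  fixes T :: real
    and C :: "real \<Rightarrow> (real ^ 'n) set"
    and d :: "(real ^ 'n) \<times> real \<Rightarrow> real ^ 'n"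
    and x0 :: "real ^ 'n"
    and S :: "nat \<Rightarrow> real list set set"
    and e :: "nat \<Rightarrow> 'n"
  assumes "T > 0"
    and "hausdorff_lipschitz_on {0..T} C"
    and "bij_betw e {..<CARD('n)} UNIV"
    and "o_minimal S"
    and "definable_multimap S e {0..T} C"
    and "\<And>t. t \<in> {0..T} \<Longrightarrow> C t \<noteq> {} \<and> compact (C t)"
    and "continuous_on UNIV d"
    and "x0 \<in> C 0"
  shows "\<exists>x. projection_process_solution T C d x0 x"
proof -
  obtain L where L: "L \<ge> 0" "\<And>s t. s \<in> {0..T} \<Longrightarrow> t \<in> {0..T} \<Longrightarrow> hausdorff_distance (C s) (C t) \<le> L * dist s t"
    using assms(2) unfolding hausdorff_lipschitz_on_def by blast
  interpret definable_moving_set S e T L C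
  proof
    show "o_minimal S" "bij_betw e {..<CARD('n)} UNIV" "T > 0" "L \<ge> 0" "definable_multimap S e {0..T} C"
      by fact+
    show "compact (C t)" if "t \<in> {0..T}" for t using assms(6)[OF that] by blast
    show "\<exists>y\<in>C t. dist x y \<le> L * dist s t" if st: "s \<in> {0..T}" "t \<in> {0..T}" "x \<in> C s" for s t x
    proof -
      obtain y where "y \<in> C t" "dist x y \<le> hausdorff_distance (C s) (C t)"
        using hausdorff_distance_reach[of "C s" "C t" x] assms(6) st by blast
      then show ?thesis using L(2)[OF st(1,2)] order_trans by blast
    qed
  qed
  show ?thesis using assms(7,8) by (rule projection_process_solution_exists)
qed

end
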